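(* Let $\mathbb{K}$ be a field and let $X \subset \mathbb{P}^{n_1} \times \dots \times \mathbb{P}^{n_q}$ be a zero-dimensional subscheme. Then $R(X) = [0, \operatorname{rem}(X)]$ is the smallest rectangular relevant domain for the Hilbert function $\mathcal{H}_X$ of $X$. Here $\operatorname{rem}(X) = (\operatorname{rin}(Z_1), \dots, \operatorname{rin}(Z_q))$, where $Z_i$ is the projection of $X$ onto $\mathbb{P}^{n_i}$.
   Context: Let $q, n_1, \dots, n_q$ be positive integers and let $\mathbb{V} = \mathbb{P}^{n_1} \times \dots \times \mathbb{P}^{n_q}$ over the field $\mathbb{K}$, with coordinate ring $\mathbb{S} = \mathbb{K}[x_{ij} \mid 1 \le i \le q,\ 0 \le j \le n_i]$, which is $\mathbb{Z}^q$-graded by $\deg(x_{ij}) = e_i$, the $i$-th standard basis element of $\mathbb{Z}^q$. For a finitely generated $\mathbb{Z}^q$-graded $\mathbb{S}$-module $M$, its Hilbert function is $\mathcal{H}_M \colon \mathbb{Z}^q \to \mathbb{Z}$, $\mathcal{H}_M(a) = \dim_{\mathbb{K}} M_a$. For a zero-dimensional subscheme $X \subset \mathbb{V}$, $I(X) \subset \mathbb{S}$ is the ideal generated by the $\mathbb{Z}^q$-homogeneous forms vanishing on $X$, and $\mathcal{H}_X = \mathcal{H}_{\mathbb{S}/I(X)}$. The same notation is used for $q=1$. Partial order on $\mathbb{Z}^q$: $a \le b$ iff $a_i \le b_i$ for all $i$. For $r \le s$, $[r,s] = \{a \in \mathbb{Z}^q \mid r \le a \le s\}$. $\mathbb{Z}_+^q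 = \{a \in \mathbb{Z}^q \mid a \ge 0\}$. For $\mathcal{F}\colon \mathbb{Z}^q \to \mathbb{Z}$, the difference function is $$\Delta \mathcal{F}(a) = \mathcal{F}(a) + \sum_{1 \le p \le q} (-1)^p \sum_{1 \le i_1 < \dots < i_p \le q} \mathcal{F}(a - e_{i_1} - \dots - e_{i_p}).$$ A rectangular domain is a set $[0,r]$ with $r \in \mathbb{Z}_+^q$. A rectangular domain $Q$ is relevant to $\mathcal{F}$ (where $\mathcal F$ vanishes outside $\mathbb{Z}_+^q$) if $\Delta\mathcal{F}(a) = 0$ for all $a \in \mathbb{Z}^q \setminus Q$. "Smallest" is with respect to inclusion among rectangular relevant domains. The projection $Z_i$ of $X$ onto $\mathbb{P}^{n_i}$ is the zero-dimensional subscheme of $\mathbb{P}^{n_i}$ defined by the ideal $I(Z_i) = I(X) \cap \mathbb{K}[x_{ij} \mid 0 \le j \le n_i]$. For a zero-dimensional subscheme $Z \subset \mathbb{P}^n$, the regularity index $\operatorname{rin}(Z)$ is the integer $r \ge 0$ such that $\mathcal{H}_Z$ is strictly increasing on $[0,r]$ and constant on $[r,\infty)$ (such an integer exists). *)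

theory Defs
  imports
    "HOL-Analysis.Finite_Cartesian_Product"
    "HOL-Library.Poly_Mapping"
    "HOL-Library.FuncSet"
    "HOL-Algebra.Ideal"
begin

section \<open>Multigraded polynomial rings\<close>

text \<open>
  The factors of the product of projective spaces are indexed by a finite type \<open>'q\<close>, so that
  multidegrees are the elements of \<open>int ^ 'q\<close>.  The variable \<open>x\<^sub>i\<^sub>j\<close> is the pair \<open>(i, j)\<close>, a monomial
  is a finitely supported exponent function, and a polynomial is a finitely supported function
  from monomials to coefficients, with the convolution product.

  Everything is relative to a set \<open>I\<close> of factors: \<open>I = UNIV\<close> gives the full product, and
  \<open>I = {i}\<close> gives the single projective space \<open>P^(n i)\<close>, whose coordinate ring is then literally
  a subring of the full coordinate ring.
\<close>

type_synonym 'q monomial = "('q \<times> nat) \<Rightarrow>\<^sub>0 nat"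
type_synonym ('q, 'k) mpoly = "'q monomial \<Rightarrow>\<^sub>0 'k"

definition const :: "'k::comm_ring_1 \<Rightarrow> ('q, 'k) mpoly" where
  "const c = Poly_Mapping.single 0 c"

definition var :: "'q \<times> nat \<Rightarrow> ('q, 'k::comm_ring_1) mpoly" where
  "var v = Poly_Mapping.single (Poly_Mapping.single v 1) 1"

definition poly_subst ::
    "('q \<times> nat \<Rightarrow> ('q, 'k::comm_ring_1) mpoly) \<Rightarrow> ('q, 'k) mpoly \<Rightarrow> ('q, 'k) mpoly" where
  "poly_subst f p = (\<Sum>m\<in>Poly_Mapping.keys p.
     const (Poly_Mapping.lookup p m) * (\<Prod>v\<in>Poly_Mapping.keys m. f v ^ Poly_Mapping.lookup m v))"

definition multidegree :: "'q::finite monomial \<Rightarrow> int ^ 'q" where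
  "multidegree m = (\<Sum>v\<in>Poly_Mapping.keys m. axis (fst v) (int (Poly_Mapping.lookup m v)))"

definition polys_in :: "('q \<times> nat) set \<Rightarrow> ('q, 'k::comm_ring_1) mpoly set" where
  "polys_in V = {p. \<forall>m\<in>Poly_Mapping.keys p. Poly_Mapping.keys m \<subseteq> V}"

definition coord_ring :: "'q set \<Rightarrow> ('q \<Rightarrow> nat) \<Rightarrow> ('q, 'k::comm_ring_1) mpoly set" where
  "coord_ring I n = polys_in {(i, j). i \<in> I \<and> j \<le> n i}"

definition forms ::
    "'q::finite set \<Rightarrow> ('q \<Rightarrow> nat) \<Rightarrow> int ^ 'q \<Rightarrow> ('q, 'k::comm_ring_1) mpoly set" where
  "forms I n a = {p \<in> coord_ring I n. \<forall>m\<in>Poly_Mapping.keys p. multidegree m = a}"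

definition subring_of :: "'a::comm_ring_1 set \<Rightarrow> 'a ring" where
  "subring_of A = \<lparr>carrier = A, mult = (*), one = 1, zero = 0, add = (+)\<rparr>"


section \<open>Closed subschemes of products of projective spaces\<close>

text \<open>
  The product is covered by the affine charts \<open>U\<^sub>\<sigma> = {x\<^bsub>i \<sigma>(i)\<^esub> \<noteq> 0 for all i \<in> I}\<close>, an affine space
  whose ring of functions is the polynomial ring in the fractions \<open>x\<^sub>i\<^sub>j / x\<^bsub>i \<sigma>(i)\<^esub>\<close>, \<open>j \<noteq> \<sigma> i\<close>.
  That fraction is written \<open>x\<^sub>i\<^sub>j\<close> again.  For a form \<open>F\<close> of degree \<open>a\<close>, the function
  \<open>F / (\<Prod>i\<in>I. x\<^bsub>i \<sigma>(i)\<^esub> ^ a\<^sub>i)\<close> on \<open>U\<^sub>\<sigma>\<close> is then \<open>dehom \<sigma> F\<close>.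
\<close>

definition charts :: "'q set \<Rightarrow> ('q \<Rightarrow> nat) \<Rightarrow> ('q \<Rightarrow> nat) set" where
  "charts I n = (\<Pi>\<^sub>E i\<in>I. {..n i})"

definition chart_ring ::
    "'q set \<Rightarrow> ('q \<Rightarrow> nat) \<Rightarrow> ('q \<Rightarrow> nat) \<Rightarrow> ('q, 'k::comm_ring_1) mpoly set" where
  "chart_ring I n \<sigma> = polys_in {(i, j). i \<in> I \<and> j \<le> n i \<and> j \<noteq> \<sigma> i}"

definition dehom :: "('q \<Rightarrow> nat) \<Rightarrow> ('q, 'k::comm_ring_1) mpoly \<Rightarrow> ('q, 'k) mpoly" where
  "dehom \<sigma> = poly_subst (\<lambda>(i, j). if j = \<sigma> i then 1 else var (i, j))"

definition chart_monomial :: "'q set \<Rightarrow> ('q \<Rightarrow> nat) \<Rightarrow> ('q, 'k::comm_ring_1) mpoly" where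
  "chart_monomial I \<sigma> = (\<Prod>i\<in>I. var (i, \<sigma> i))"

text \<open>
  A closed subscheme is a quasi-coherent ideal sheaf, that is, an ideal \<open>X \<sigma>\<close> of the ring of each
  chart such that \<open>X \<sigma>\<close> and \<open>X \<tau>\<close> generate the same ideal in the ring of functions on
  \<open>U\<^sub>\<sigma> \<inter> U\<^sub>\<tau>\<close>.  This last ring is the localisation of the ring of \<open>U\<^sub>\<sigma>\<close> at
  \<open>dehom \<sigma> (chart_monomial I \<tau>)\<close>, and vice versa.  Up to a unit each of its elements comes from a
  form \<open>F\<close>, as \<open>dehom \<sigma> F\<close> or, equivalently, as \<open>dehom \<tau> F\<close>; it lies in the ideal generated by
  \<open>X \<sigma>\<close> iff \<open>dehom \<sigma> F\<close> does so after multiplication by a power of \<open>dehom \<sigma> (chart_monomial I \<tau>)\<close>.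
\<close>

type_synonym ('q, 'k) ideal_family = "('q \<Rightarrow> nat) \<Rightarrow> ('q, 'k) mpoly set"

definition closed_subscheme ::
    "'q::finite set \<Rightarrow> ('q \<Rightarrow> nat) \<Rightarrow> ('q, 'k::comm_ring_1) ideal_family \<Rightarrow> bool" where
  "closed_subscheme I n X \<longleftrightarrow>
     (\<forall>\<sigma>\<in>charts I n. ideal (X \<sigma>) (subring_of (chart_ring I n \<sigma>))) \<and>
     (\<forall>\<sigma>\<in>charts I n. \<forall>\<tau>\<in>charts I n. \<forall>a. \<forall>F\<in>forms I n a.
        (\<exists>N. dehom \<sigma> (chart_monomial I \<tau> ^ N * F) \<in> X \<sigma>) \<longleftrightarrow>
        (\<exists>N. dehom \<tau> (chart_monomial I \<sigma> ^ N * F) \<in> X \<tau>))"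

text \<open>
  The dimension is the supremum of the lengths of chains of irreducible closed subsets.  Since the
  charts form an open cover, such chains correspond to chains of primes containing \<open>X \<sigma>\<close> in the
  rings of the charts.  The empty scheme has no dimension in this sense.
\<close>

definition chain_lengths ::
    "'q set \<Rightarrow> ('q \<Rightarrow> nat) \<Rightarrow> ('q, 'k::comm_ring_1) ideal_family \<Rightarrow> nat set" where
  "chain_lengths I n X = {d. \<exists>\<sigma>\<in>charts I n. \<exists>P.
     (\<forall>k\<le>d. primeideal (P k) (subring_of (chart_ring I n \<sigma>)) \<and> X \<sigma> \<subseteq> P k) \<and>
     (\<forall>k<d. P k \<subset> P (Suc k))}"

definition has_dimension ::
    "'q set \<Rightarrow> ('q \<Rightarrow> nat) \<Rightarrow> ('q, 'k::comm_ring_1) ideal_family \<Rightarrow> nat \<Rightarrow> bool" where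
  "has_dimension I n X d \<longleftrightarrow> d \<in> chain_lengths I n X \<and> (\<forall>e\<in>chain_lengths I n X. e \<le> d)"

definition zero_dim_subscheme ::
    "'q::finite set \<Rightarrow> ('q \<Rightarrow> nat) \<Rightarrow> ('q, 'k::comm_ring_1) ideal_family \<Rightarrow> bool" where
  "zero_dim_subscheme I n X \<longleftrightarrow> closed_subscheme I n X \<and> has_dimension I n X 0"

definition vanishing_forms ::
    "'q::finite set \<Rightarrow> ('q \<Rightarrow> nat) \<Rightarrow> ('q, 'k::comm_ring_1) ideal_family \<Rightarrow> ('q, 'k) mpoly set" where
  "vanishing_forms I n X = {F. (\<exists>a. F \<in> forms I n a) \<and> (\<forall>\<sigma>\<in>charts I n. dehom \<sigma> F \<in> X \<sigma>)}"

definition vanishing_ideal ::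
    "'q::finite set \<Rightarrow> ('q \<Rightarrow> nat) \<Rightarrow> ('q, 'k::comm_ring_1) ideal_family \<Rightarrow> ('q, 'k) mpoly set" where
  "vanishing_ideal I n X = Idl\<^bsub>subring_of (coord_ring I n)\<^esub> (vanishing_forms I n X)"

text \<open>The subscheme defined by a homogeneous ideal \<open>J\<close> of the coordinate ring.\<close>

definition subscheme_of_ideal :: "('q, 'k::comm_ring_1) mpoly set \<Rightarrow> ('q, 'k) ideal_family" where
  "subscheme_of_ideal J = (\<lambda>\<sigma>. dehom \<sigma> ` J)"

definition projection ::
    "('q::finite \<Rightarrow> nat) \<Rightarrow> 'q \<Rightarrow> ('q, 'k::comm_ring_1) ideal_family \<Rightarrow> ('q, 'k) ideal_family" where
  "projection n i X = subscheme_of_ideal (vanishing_ideal UNIV n X \<inter> coord_ring {i} n)"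


section \<open>Hilbert functions\<close>

text \<open>The residue classes modulo \<open>W\<close> of the (pairwise incongruent) elements of \<open>B\<close> form a basis of \<open>U / W\<close>.\<close>

definition basis_mod ::
    "('q, 'k::field) mpoly set \<Rightarrow> ('q, 'k) mpoly set \<Rightarrow> ('q, 'k) mpoly set \<Rightarrow> bool" where
  "basis_mod U W B \<longleftrightarrow> finite B \<and> B \<subseteq> U \<and>
     (\<forall>f\<in>U. \<exists>!c. c \<in> B \<rightarrow>\<^sub>E UNIV \<and> f - (\<Sum>b\<in>B. const (c b) * b) \<in> W)"

definition quotient_dim :: "('q, 'k::field) mpoly set \<Rightarrow> ('q, 'k) mpoly set \<Rightarrow> nat" where
  "quotient_dim U W = (THE d. \<exists>B. basis_mod U W B \<and> card B = d)"

definition hilbert_function ::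
    "'q::finite set \<Rightarrow> ('q \<Rightarrow> nat) \<Rightarrow> ('q, 'k::field) ideal_family \<Rightarrow> int ^ 'q \<Rightarrow> int" where
  "hilbert_function I n X a =
     int (quotient_dim (forms I n a) (vanishing_ideal I n X \<inter> forms I n a))"

text \<open>
  On \<open>K[x\<^sub>i\<^sub>0, \<dots>, x\<^bsub>i n(i)\<^esub>]\<close> the standard degree \<open>k\<close> is the multidegree \<open>k e\<^sub>i = axis i k\<close>.
\<close>

definition regularity_index ::
    "('q::finite \<Rightarrow> nat) \<Rightarrow> 'q \<Rightarrow> ('q, 'k::field) ideal_family \<Rightarrow> int" where
  "regularity_index n i Z = (THE r. 0 \<le> r \<and>
     strict_mono_on {0..r} (\<lambda>k. hilbert_function {i} n Z (axis i k)) \<and>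
     (\<forall>k\<ge>r. hilbert_function {i} n Z (axis i k) = hilbert_function {i} n Z (axis i r)))"

definition rem :: "('q::finite \<Rightarrow> nat) \<Rightarrow> ('q, 'k::field) ideal_family \<Rightarrow> int ^ 'q" where
  "rem n X = (\<chi> i. regularity_index n i (projection n i X))"

definition difference :: "(int ^ 'q \<Rightarrow> int) \<Rightarrow> int ^ 'q::finite \<Rightarrow> int" where
  "difference F a = F a + (\<Sum>p = 1..CARD('q). (- 1) ^ p *
     (\<Sum>T\<in>{T. card T = p}. F (a - (\<Sum>i\<in>T. axis i 1))))"

definition rectangular_domain :: "(int ^ 'q::finite) set \<Rightarrow> bool" where
  "rectangular_domain Q \<longleftrightarrow> (\<exists>r\<ge>0. Q = {0..r})"

definition relevant_domain :: "(int ^ 'q::finite \<Rightarrow> int) \<Rightarrow> (int ^ 'q) set \<Rightarrow> bool" where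
  "relevant_domain F Q \<longleftrightarrow> (\<forall>a. \<not> 0 \<le> a \<longrightarrow> F a = 0) \<and>
     rectangular_domain Q \<and> (\<forall>a. a \<notin> Q \<longrightarrow> difference F a = 0)"

definition smallest_relevant_domain :: "(int ^ 'q::finite \<Rightarrow> int) \<Rightarrow> (int ^ 'q) set \<Rightarrow> bool" where
  "smallest_relevant_domain F Q \<longleftrightarrow>
     relevant_domain F Q \<and> (\<forall>Q'. relevant_domain F Q' \<longrightarrow> Q \<subseteq> Q')"


section \<open>The ideals of the projections\<close>

lemma poly_mapping_sum_single:
  "p = (\<Sum>m\<in>Poly_Mapping.keys p. Poly_Mapping.single m (Poly_Mapping.lookup p m))"
proof (rule poly_mapping_eqI)
  fix k
  have "Poly_Mapping.lookup (\<Sum>m\<in>Poly_Mapping.keys p. Poly_Mapping.single m (Poly_Mapping.lookup p m)) k = (\<Sum>m\<in>Poly_Mapping.keys p. if m = k then Poly_Mapping.lookup p m else 0)"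
    unfolding lookup_sum by (intro sum.cong) (auto simp: lookup_single when_def)
  also have "\<dots> = Poly_Mapping.lookup p k"
    by (simp add: sum.delta not_in_keys_iff_lookup_eq_zero[symmetric])
  finally show "Poly_Mapping.lookup p k = Poly_Mapping.lookup (\<Sum>m\<in>Poly_Mapping.keys p. Poly_Mapping.single m (Poly_Mapping.lookup p m)) k" by simp
qed

lemma poly_induct_single:
  fixes p :: "'a \<Rightarrow>\<^sub>0 'b::comm_monoid_add"
  assumes "P 0" "\<And>p q. P p \<Longrightarrow> P q \<Longrightarrow> P (p + q)" "\<And>m c. P (Poly_Mapping.single m c)"
  shows "P p"
proof -
  have "P (\<Sum>m\<in>A. Poly_Mapping.single m (Poly_Mapping.lookup p m))" if "finite A" for A
    using that by induction (auto intro: assms)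
  then show ?thesis using poly_mapping_sum_single[of p] by (metis finite_keys)
qed

abbreviation (input) msubst where
  "msubst f m \<equiv> (\<Prod>v\<in>Poly_Mapping.keys m. f v ^ Poly_Mapping.lookup m v)"

lemma msubst_superset:
  fixes f :: "_ \<Rightarrow> 'a::comm_semiring_1"
  assumes "finite V" "Poly_Mapping.keys m \<subseteq> V"
  shows "msubst f m = (\<Prod>v\<in>V. f v ^ Poly_Mapping.lookup m v)"
  using assms by (intro prod.mono_neutral_left) (auto simp: in_keys_iff)

lemma msubst_add:
  fixes f :: "_ \<Rightarrow> 'a::comm_semiring_1"
  shows "msubst f (m + m') = msubst f m * msubst f m'"
proof -
  let ?V = "Poly_Mapping.keys m \<union> Poly_Mapping.keys m'"
  have "Poly_Mapping.keys (m + m') \<subseteq> ?V" by (rule keys_add)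
  then have "msubst f (m + m') = (\<Prod>v\<in>?V. f v ^ Poly_Mapping.lookup (m + m') v)"
    by (intro msubst_superset) auto
  moreover have "msubst f m = (\<Prod>v\<in>?V. f v ^ Poly_Mapping.lookup m v)" "msubst f m' = (\<Prod>v\<in>?V. f v ^ Poly_Mapping.lookup m' v)"
    by (intro msubst_superset; auto)+
  ultimately show ?thesis
    by (simp only: lookup_add power_add prod.distrib)
qed

lemma poly_subst_superset:
  assumes "finite M" "Poly_Mapping.keys p \<subseteq> M"
  shows "poly_subst f p = (\<Sum>m\<in>M. const (Poly_Mapping.lookup p m) * msubst f m)"
  unfolding poly_subst_def using assms
  by (intro sum.mono_neutral_left) (auto simp: in_keys_iff const_def)

lemma poly_subst_add: "poly_subst f (p + q) = poly_subst f p + poly_subst f q"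
proof -
  let ?M = "Poly_Mapping.keys p \<union> Poly_Mapping.keys q"
  have "Poly_Mapping.keys (p + q) \<subseteq> ?M" by (rule keys_add)
  then have "poly_subst f (p + q) = (\<Sum>m\<in>?M. const (Poly_Mapping.lookup (p + q) m) * msubst f m)"
    by (intro poly_subst_superset) auto
  moreover have "poly_subst f p = (\<Sum>m\<in>?M. const (Poly_Mapping.lookup p m) * msubst f m)"
    "poly_subst f q = (\<Sum>m\<in>?M. const (Poly_Mapping.lookup q m) * msubst f m)"
    by (intro poly_subst_superset; auto)+
  ultimately show ?thesis
    by (simp only: lookup_add const_def single_add distrib_right sum.distrib)
qed

lemma poly_subst_0 [simp]: "poly_subst f 0 = 0"
  by (simp add: poly_subst_def)

lemma poly_subst_single: "poly_subst f (Poly_Mapping.single m c) = const c * msubst f m"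
  by (cases "c = 0") (simp_all add: poly_subst_def const_def)

lemma const_mult: "const (c * d) = const c * const d"
  by (simp add: const_def mult_single)

lemma poly_subst_mult: "poly_subst f (p * q) = poly_subst f p * poly_subst f q"
proof (induction p rule: poly_induct_single)
  case (3 m c)
  show ?case
  proof (induction q rule: poly_induct_single)
    case (3 m' c')
    show ?case
      unfolding mult_single poly_subst_single msubst_add const_mult by (simp only: ac_simps)
  qed (simp_all add: poly_subst_add distrib_left)
qed (simp_all add: poly_subst_add distrib_right)

lemma poly_subst_1 [simp]: "poly_subst f 1 = 1"
  using poly_subst_single[of f 0 1] by (simp add: const_def)

lemma poly_subst_power: "poly_subst f (p ^ N) = poly_subst f p ^ N"
  by (induction N) (simp_all add: poly_subst_mult)

lemma poly_subst_prod: "poly_subst f (prod g A) = (\<Prod>a\<in>A. poly_subst f (g a))"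
  by (induction A rule: infinite_finite_induct) (simp_all add: poly_subst_mult)

lemma poly_subst_sum: "poly_subst f (sum g A) = (\<Sum>a\<in>A. poly_subst f (g a))"
  by (induction A rule: infinite_finite_induct) (simp_all add: poly_subst_add)

lemma poly_subst_diff: "poly_subst f (p - q) = poly_subst f p - poly_subst f q"
  by (metis add_diff_cancel diff_add_cancel poly_subst_add)

lemma poly_subst_var [simp]: "poly_subst f (var v) = f v"
  by (simp add: var_def poly_subst_single const_def)

lemma dehom_add: "dehom \<sigma> (p + q) = dehom \<sigma> p + dehom \<sigma> q"
  and dehom_mult: "dehom \<sigma> (p * q) = dehom \<sigma> p * dehom \<sigma> q"
  and dehom_diff: "dehom \<sigma> (p - q) = dehom \<sigma> p - dehom \<sigma> q"
  and dehom_power: "dehom \<sigma> (p ^ N) = dehom \<sigma> p ^ N"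
  and dehom_0 [simp]: "dehom \<sigma> 0 = 0"
  and dehom_1 [simp]: "dehom \<sigma> 1 = 1"
  and dehom_prod: "dehom \<sigma> (prod g A) = (\<Prod>a\<in>A. dehom \<sigma> (g a))"
  and dehom_sum: "dehom \<sigma> (sum g A) = (\<Sum>a\<in>A. dehom \<sigma> (g a))"
  and dehom_var: "dehom \<sigma> (var (i, j)) = (if j = \<sigma> i then 1 else var (i, j))"
  by (simp_all add: dehom_def poly_subst_add poly_subst_mult poly_subst_power poly_subst_prod
      poly_subst_sum poly_subst_diff)

lemma dehom_chart_monomial:
  "(\<And>i. i \<in> I \<Longrightarrow> \<tau> i = \<sigma> i) \<Longrightarrow> dehom \<tau> (chart_monomial I \<sigma>) = 1"
  by (auto simp: chart_monomial_def dehom_prod dehom_var intro!: prod.neutral)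

definition dehom_monomial :: "('q \<Rightarrow> nat) \<Rightarrow> 'q monomial \<Rightarrow> 'q monomial" where
  "dehom_monomial \<sigma> m = (\<Sum>v\<in>Poly_Mapping.keys m. if snd v = \<sigma> (fst v) then 0 else Poly_Mapping.single v (Poly_Mapping.lookup m v))"

lemma lookup_dehom_monomial: "Poly_Mapping.lookup (dehom_monomial \<sigma> m) v = (if snd v = \<sigma> (fst v) then 0 else Poly_Mapping.lookup m v)"
proof -
  have "Poly_Mapping.lookup (dehom_monomial \<sigma> m) v = (\<Sum>w\<in>Poly_Mapping.keys m. if w = v then (if snd v = \<sigma> (fst v) then 0 else Poly_Mapping.lookup m v) else 0)"
    unfolding dehom_monomial_def lookup_sum
    by (intro sum.cong) (auto simp: lookup_single when_def)
  also have "\<dots> = (if snd v = \<sigma> (fst v) then 0 else Poly_Mapping.lookup m v)"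
    by (simp add: sum.delta not_in_keys_iff_lookup_eq_zero[symmetric])
  finally show ?thesis .
qed

lemma var_power: "var v ^ k = Poly_Mapping.single (Poly_Mapping.single v k) 1"
  by (induction k) (simp_all add: var_def mult_single flip: single_add)

lemma prod_single: "(\<Prod>a\<in>A. Poly_Mapping.single (g a) 1) = (Poly_Mapping.single (\<Sum>a\<in>A. g a) 1 :: ('q, 'k::comm_ring_1) mpoly)"
  by (induction A rule: infinite_finite_induct) (simp_all add: mult_single)

lemma dehom_single: "dehom \<sigma> (Poly_Mapping.single m c) = Poly_Mapping.single (dehom_monomial \<sigma> m) c"
proof -
  have "dehom \<sigma> (Poly_Mapping.single m c) =
      const c * (\<Prod>v\<in>Poly_Mapping.keys m. Poly_Mapping.single (if snd v = \<sigma> (fst v) then 0 else Poly_Mapping.single v (Poly_Mapping.lookup m v)) 1)"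
    unfolding dehom_def poly_subst_single
    by (intro arg_cong2[where f = "(*)"] refl prod.cong) (auto simp: var_power)
  then show ?thesis
    by (simp add: prod_single dehom_monomial_def const_def mult_single)
qed

lemma multidegree_superset:
  assumes "finite V" "Poly_Mapping.keys m \<subseteq> V"
  shows "multidegree m = (\<Sum>v\<in>V. axis (fst v) (int (Poly_Mapping.lookup m v)))"
  unfolding multidegree_def using assms
  by (intro sum.mono_neutral_left) (auto simp: in_keys_iff axis_eq_0_iff)

lemma axis_add: "axis i (x + y) = axis i x + (axis i y :: int ^ 'q::finite)"
  by (simp add: axis_def vec_eq_iff)

lemma multidegree_add: "multidegree (m + m') = multidegree m + multidegree m'"
proof -
  let ?V = "Poly_Mapping.keys m \<union> Poly_Mapping.keys m'"
  have "Poly_Mapping.keys (m + m') \<subseteq> ?V" by (rule keys_add)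
  moreover have "multidegree m = (\<Sum>v\<in>?V. axis (fst v) (int (Poly_Mapping.lookup m v)))"
    "multidegree m' = (\<Sum>v\<in>?V. axis (fst v) (int (Poly_Mapping.lookup m' v)))"
    by (intro multidegree_superset; auto)+
  ultimately show ?thesis
    using multidegree_superset[of ?V "m + m'"] by (simp add: lookup_add sum.distrib axis_add)
qed

lemma multidegree_single [simp]: "multidegree (Poly_Mapping.single v k) = axis (fst v) (int k)"
  by (cases "k = 0") (simp_all add: multidegree_def axis_eq_0_iff)

lemma multidegree_0 [simp]: "multidegree 0 = 0"
  by (simp add: multidegree_def)

lemma multidegree_sum: "multidegree (sum g A) = (\<Sum>a\<in>A. multidegree (g a))"
  by (induction A rule: infinite_finite_induct) (simp_all add: multidegree_add)

lemma dehom_monomial_decomp: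
  "m = dehom_monomial \<sigma> m + (\<Sum>i\<in>UNIV. Poly_Mapping.single (i, \<sigma> i) (Poly_Mapping.lookup m (i, \<sigma> i)))"
  for m :: "'q::finite monomial"
proof (rule poly_mapping_eqI)
  fix v :: "'q \<times> nat"
  obtain i j where v: "v = (i, j)" by (cases v)
  have "Poly_Mapping.lookup (\<Sum>i\<in>UNIV. Poly_Mapping.single (i, \<sigma> i) (Poly_Mapping.lookup m (i, \<sigma> i))) v =
      (\<Sum>i'\<in>UNIV. if i' = i then (if j = \<sigma> i then Poly_Mapping.lookup m v else 0) else 0)"
    unfolding lookup_sum by (intro sum.cong) (auto simp: lookup_single when_def v)
  also have "\<dots> = (if j = \<sigma> i then Poly_Mapping.lookup m v else 0)" by (simp add: sum.delta)
  finally show "Poly_Mapping.lookup m v = Poly_Mapping.lookup (dehom_monomial \<sigma> m + (\<Sum>i\<in>UNIV. Poly_Mapping.single (i, \<sigma> i) (Poly_Mapping.lookup m (i, \<sigma> i)))) v"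
    by (simp add: lookup_add lookup_dehom_monomial v)
qed

lemma dehom_monomial_inj:
  fixes m m' :: "'q::finite monomial"
  assumes "dehom_monomial \<sigma> m = dehom_monomial \<sigma> m'" "multidegree m = multidegree m'"
  shows "m = m'"
proof -
  have *: "multidegree m = multidegree (dehom_monomial \<sigma> m) + (\<chi> i. int (Poly_Mapping.lookup m (i, \<sigma> i)))" for m :: "'q monomial"
  proof -
    have "(\<Sum>i\<in>UNIV. axis i (int (Poly_Mapping.lookup m (i, \<sigma> i)))) = (\<chi> i. int (Poly_Mapping.lookup m (i, \<sigma> i)))"
      by (simp add: vec_eq_iff axis_def if_distrib sum.delta cong: if_cong)
    then show ?thesis
      by (subst dehom_monomial_decomp[of m \<sigma>]) (simp add: multidegree_add multidegree_sum)
  qed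
  have "(\<chi> i. int (Poly_Mapping.lookup m (i, \<sigma> i))) = (\<chi> i. int (Poly_Mapping.lookup m' (i, \<sigma> i)))"
    using *[of m] *[of m'] assms by simp
  then have "Poly_Mapping.lookup m (i, \<sigma> i) = Poly_Mapping.lookup m' (i, \<sigma> i)" for i
    by (simp add: vec_eq_iff)
  then show ?thesis
    using dehom_monomial_decomp[of m \<sigma>] dehom_monomial_decomp[of m' \<sigma>] assms(1) by simp
qed

lemma dehom_eq_0_form:
  assumes "\<forall>m\<in>Poly_Mapping.keys p. multidegree m = a" "dehom \<sigma> p = 0"
  shows "p = 0"
proof (rule poly_mapping_eqI)
  fix m
  show "Poly_Mapping.lookup p m = Poly_Mapping.lookup 0 m"
  proof (cases "m \<in> Poly_Mapping.keys p")
    case True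
    have "dehom \<sigma> p = (\<Sum>m\<in>Poly_Mapping.keys p. Poly_Mapping.single (dehom_monomial \<sigma> m) (Poly_Mapping.lookup p m))"
      by (subst poly_mapping_sum_single[of p]) (simp add: dehom_sum dehom_single)
    then have "Poly_Mapping.lookup (dehom \<sigma> p) (dehom_monomial \<sigma> m) = (\<Sum>m'\<in>Poly_Mapping.keys p. Poly_Mapping.lookup (Poly_Mapping.single (dehom_monomial \<sigma> m') (Poly_Mapping.lookup p m')) (dehom_monomial \<sigma> m))"
      by (simp add: lookup_sum)
    also have "\<dots> = (\<Sum>m'\<in>Poly_Mapping.keys p. if m' = m then Poly_Mapping.lookup p m else 0)"
    proof (rule sum.cong[OF refl])
      fix m' assume "m' \<in> Poly_Mapping.keys p"
      then show "Poly_Mapping.lookup (Poly_Mapping.single (dehom_monomial \<sigma> m') (Poly_Mapping.lookup p m')) (dehom_monomial \<sigma> m) = (if m' = m then Poly_Mapping.lookup p m else 0)"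
        using dehom_monomial_inj[of \<sigma> m' m] assms(1) True by (auto simp: lookup_single when_def)
    qed
    also have "\<dots> = Poly_Mapping.lookup p m" using True by simp
    finally show ?thesis using assms(2) by simp
  qed (simp add: in_keys_iff)
qed

lemma cring_subring_of:
  assumes "0 \<in> A" "1 \<in> A" "\<And>x y. x \<in> A \<Longrightarrow> y \<in> A \<Longrightarrow> x + y \<in> A"
    "\<And>x y. x \<in> A \<Longrightarrow> y \<in> A \<Longrightarrow> x * y \<in> A" "\<And>x. x \<in> A \<Longrightarrow> - x \<in> A"
  shows "cring (subring_of A)"
proof (rule cringI)
  show "abelian_group (subring_of A)"
    by (rule abelian_groupI)
       (use assms in \<open>auto simp: subring_of_def ac_simps intro!: bexI[of _ "- x" for x]\<close>)
  show "comm_monoid (subring_of A)"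
    by (rule comm_monoidI) (use assms in \<open>auto simp: subring_of_def ac_simps\<close>)
qed (use assms in \<open>auto simp: subring_of_def distrib_right\<close>)

lemma polys_in_0 [simp]: "0 \<in> polys_in V" and polys_in_1 [simp]: "1 \<in> polys_in V"
  by (auto simp: polys_in_def)

lemma polys_in_add: "p \<in> polys_in V \<Longrightarrow> q \<in> polys_in V \<Longrightarrow> p + q \<in> polys_in V"
  using keys_add[of p q] by (fastforce simp: polys_in_def)

lemma polys_in_uminus: "p \<in> polys_in V \<Longrightarrow> - p \<in> polys_in V"
  by (auto simp: polys_in_def in_keys_iff)

lemma polys_in_mult:
  assumes "p \<in> polys_in V" "q \<in> polys_in V" shows "p * q \<in> polys_in V"
  unfolding polys_in_def
proof safe
  fix m v w assume m: "m \<in> Poly_Mapping.keys (p * q)" and v: "(v, w) \<in> Poly_Mapping.keys m"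
  obtain a b where ab: "m = a + b" "a \<in> Poly_Mapping.keys p" "b \<in> Poly_Mapping.keys q"
    using m keys_mult[of p q] by blast
  then show "(v, w) \<in> V"
    using v keys_add[of a b] assms by (fastforce simp: polys_in_def)
qed

lemma polys_in_sum: "(\<And>a. a \<in> A \<Longrightarrow> g a \<in> polys_in V) \<Longrightarrow> sum g A \<in> polys_in V"
  by (induction A rule: infinite_finite_induct) (auto intro: polys_in_add)

lemma polys_in_prod: "(\<And>a. a \<in> A \<Longrightarrow> g a \<in> polys_in V) \<Longrightarrow> prod g A \<in> polys_in V"
  by (induction A rule: infinite_finite_induct) (auto intro: polys_in_mult)

lemma polys_in_power: "p \<in> polys_in V \<Longrightarrow> p ^ N \<in> polys_in V"
  by (induction N) (auto intro: polys_in_mult)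

lemma polys_in_var: "v \<in> V \<Longrightarrow> var v \<in> polys_in V"
  by (auto simp: polys_in_def var_def)

lemma polys_in_single: "c \<noteq> 0 \<Longrightarrow> Poly_Mapping.single m c \<in> polys_in V \<longleftrightarrow> Poly_Mapping.keys m \<subseteq> V"
  by (auto simp: polys_in_def)

lemma cring_polys_in: "cring (subring_of (polys_in V))"
  by (rule cring_subring_of) (auto intro: polys_in_add polys_in_mult polys_in_uminus)

lemma ideal_polys_in_iff:
  "ideal J (subring_of (polys_in V)) \<longleftrightarrow>
     J \<subseteq> polys_in V \<and> 0 \<in> J \<and> (\<forall>p\<in>J. \<forall>q\<in>J. p + q \<in> J) \<and> (\<forall>p\<in>J. \<forall>h\<in>polys_in V. h * p \<in> J)"
  (is "?L \<longleftrightarrow> ?R")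
proof
  assume ?L
  then interpret ideal J "subring_of (polys_in V)" .
  show ?R
    using a_subset additive_subgroup.zero_closed[OF is_additive_subgroup]
      additive_subgroup.a_closed[OF is_additive_subgroup] I_l_closed
    by (auto simp: subring_of_def)
next
  let ?A = "subring_of (polys_in V)"
  assume R: ?R
  interpret cring ?A by (rule cring_polys_in)
  have m1: "- 1 \<in> polys_in V" by (rule polys_in_uminus) simp
  have uminus: "\<ominus>\<^bsub>?A\<^esub> p = - p" if "p \<in> polys_in V" for p
    using minus_equality[of "- p" p] polys_in_uminus[OF that] that by (simp add: subring_of_def)
  show ?L
  proof (rule idealI)
    show "ring ?A" by (rule ring_axioms)
    show "subgroup J (add_monoid ?A)"
    proof (rule add.subgroupI)
      show "J \<subseteq> carrier ?A" "J \<noteq> {}" using R by (auto simp: subring_of_def)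
      fix p assume p: "p \<in> J"
      then have "- 1 * p \<in> J" using R m1 by blast
      then show "\<ominus>\<^bsub>?A\<^esub> p \<in> J" using uminus[of p] R p by (metis mult_minus1 subsetD)
    qed (use R in \<open>auto simp: subring_of_def\<close>)
  qed (use R in \<open>auto simp: subring_of_def mult.commute\<close>)
qed

definition component :: "int ^ 'q \<Rightarrow> ('q::finite, 'k::comm_ring_1) mpoly \<Rightarrow> ('q, 'k) mpoly" where
  "component a p = (\<Sum>m\<in>Poly_Mapping.keys p. if multidegree m = a then Poly_Mapping.single m (Poly_Mapping.lookup p m) else 0)"

lemma lookup_component: "Poly_Mapping.lookup (component a p) m = (if multidegree m = a then Poly_Mapping.lookup p m else 0)"
proof -
  have "Poly_Mapping.lookup (component a p) m = (\<Sum>m'\<in>Poly_Mapping.keys p. if m' = m then (if multidegree m = a then Poly_Mapping.lookup p m else 0) else 0)"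
    unfolding component_def lookup_sum by (intro sum.cong) (auto simp: lookup_single when_def)
  then show ?thesis by (simp add: sum.delta not_in_keys_iff_lookup_eq_zero[symmetric])
qed

lemma component_add: "component a (p + q) = component a p + component a q"
  by (rule poly_mapping_eqI) (simp add: lookup_component lookup_add)

lemma component_0 [simp]: "component a 0 = 0"
  by (rule poly_mapping_eqI) (simp add: lookup_component)

lemma component_single: "component a (Poly_Mapping.single m c) = (if multidegree m = a then Poly_Mapping.single m c else 0)"
  by (rule poly_mapping_eqI) (auto simp: lookup_component lookup_single when_def)

lemma component_single_mult: "component a (Poly_Mapping.single m c * p) = Poly_Mapping.single m c * component (a - multidegree m) p"
proof (induction p rule: poly_induct_single)
  case (3 m' c')
  show ?case
    by (auto simp: mult_single component_single multidegree_add algebra_simps)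
qed (simp_all add: component_add distrib_left)

lemma keys_component: "Poly_Mapping.keys (component a p) = {m \<in> Poly_Mapping.keys p. multidegree m = a}"
  by (auto simp: in_keys_iff lookup_component split: if_splits)

lemma component_in_forms: "p \<in> coord_ring I n \<Longrightarrow> component a p \<in> forms I n a"
  by (auto simp: forms_def coord_ring_def polys_in_def keys_component)

lemma component_form: "p \<in> forms I n a \<Longrightarrow> component b p = (if b = a then p else 0)"
  by (rule poly_mapping_eqI) (auto simp: forms_def lookup_component in_keys_iff)

lemma sum_component:
  assumes "finite D" "multidegree ` Poly_Mapping.keys p \<subseteq> D"
  shows "p = (\<Sum>a\<in>D. component a p)"
proof (rule poly_mapping_eqI)
  fix m
  have "Poly_Mapping.lookup (\<Sum>a\<in>D. component a p) m = (\<Sum>a\<in>D. if a = multidegree m then Poly_Mapping.lookup p m else 0)"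
    unfolding lookup_sum by (intro sum.cong) (auto simp: lookup_component)
  also have "\<dots> = Poly_Mapping.lookup p m"
    using assms by (force simp: sum.delta' image_subset_iff simp flip: not_in_keys_iff_lookup_eq_zero)
  finally show "Poly_Mapping.lookup p m = Poly_Mapping.lookup (\<Sum>a\<in>D. component a p) m" by simp
qed

lemma forms_add: "p \<in> forms I n a \<Longrightarrow> q \<in> forms I n a \<Longrightarrow> p + q \<in> forms I n a"
  using keys_add[of p q] by (fastforce simp: forms_def coord_ring_def intro: polys_in_add)

lemma forms_0 [simp]: "0 \<in> forms I n a"
  by (simp add: forms_def coord_ring_def)

lemma forms_sum: "(\<And>a. a \<in> A \<Longrightarrow> g a \<in> forms I n b) \<Longrightarrow> sum g A \<in> forms I n b"
  by (induction A rule: infinite_finite_induct) (auto intro: forms_add)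

lemma forms_mult:
  assumes "p \<in> forms I n a" "q \<in> forms I n b" shows "p * q \<in> forms I n (a + b)"
proof -
  have "multidegree m = a + b" if "m \<in> Poly_Mapping.keys (p * q)" for m
    using that keys_mult[of p q] assms by (fastforce simp: forms_def multidegree_add)
  then show ?thesis using assms by (auto simp: forms_def coord_ring_def intro: polys_in_mult)
qed

lemma forms_1 [simp]: "1 \<in> forms I n 0"
  by (simp add: forms_def coord_ring_def)

lemma forms_var_power: "i \<in> I \<Longrightarrow> j \<le> n i \<Longrightarrow> var (i, j) ^ k \<in> forms I n (axis i (int k))"
  by (auto simp: forms_def coord_ring_def intro!: polys_in_power polys_in_var)
     (auto simp: var_power)

lemma forms_prod: "(\<And>a. a \<in> A \<Longrightarrow> g a \<in> forms I n (d a)) \<Longrightarrow> prod g A \<in> forms I n (sum d A)"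
  by (induction A rule: infinite_finite_induct) (auto intro: forms_mult)

lemma forms_power: "p \<in> forms I n a \<Longrightarrow> p ^ N \<in> forms I n (\<Sum>k<N. a)"
  using forms_prod[of "{..<N}" "\<lambda>_. p" I n "\<lambda>_. a"] by simp

lemma chart_monomial_forms:
  "\<sigma> \<in> charts I n \<Longrightarrow> chart_monomial I \<sigma> ^ N \<in> forms I n (\<Sum>k<N. \<Sum>i\<in>I. axis i 1)"
proof (rule forms_power)
  assume \<sigma>: "\<sigma> \<in> charts I n"
  show "chart_monomial I \<sigma> \<in> forms I n (\<Sum>i\<in>I. axis i 1)"
    unfolding chart_monomial_def
  proof (rule forms_prod)
    fix i assume i: "i \<in> I"
    then have "\<sigma> i \<le> n i" using \<sigma> by (auto simp: charts_def)
    from forms_var_power[of i I _ n 1, OF i this] show "var (i, \<sigma> i) \<in> forms I n (axis i 1)" by simp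
  qed
qed

definition homogeneous :: "('q::finite, 'k::comm_ring_1) mpoly set \<Rightarrow> bool" where
  "homogeneous J \<longleftrightarrow> (\<forall>p\<in>J. \<forall>a. component a p \<in> J)"

text \<open>
  The ideal of the subscheme defined by \<open>J\<close> consists, in each degree, of the forms that a power of
  each \<open>chart_monomial I \<sigma>\<close> multiplies into \<open>J\<close>.
\<close>

lemma dehom_image_iff:
  fixes J :: "('q::finite, 'k::comm_ring_1) mpoly set"
  assumes J: "ideal J (subring_of (coord_ring I n))" "homogeneous J"
    and \<sigma>: "\<sigma> \<in> charts I n" and F: "F \<in> forms I n b"
  shows "dehom \<sigma> F \<in> dehom \<sigma> ` J \<longleftrightarrow> (\<exists>N. chart_monomial I \<sigma> ^ N * F \<in> J)"
proof
  assume "\<exists>N. chart_monomial I \<sigma> ^ N * F \<in> J"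
  then obtain N where N: "chart_monomial I \<sigma> ^ N * F \<in> J" ..
  have "dehom \<sigma> (chart_monomial I \<sigma> ^ N * F) = dehom \<sigma> F"
    by (simp add: dehom_mult dehom_power dehom_chart_monomial)
  then show "dehom \<sigma> F \<in> dehom \<sigma> ` J" using N by (metis imageI)
next
  assume "dehom \<sigma> F \<in> dehom \<sigma> ` J"
  then obtain G where G: "G \<in> J" "dehom \<sigma> F = dehom \<sigma> G" by auto
  have Ji: "J \<subseteq> coord_ring I n" "0 \<in> J" "\<And>p q. p \<in> J \<Longrightarrow> q \<in> J \<Longrightarrow> p + q \<in> J"
    "\<And>p h. p \<in> J \<Longrightarrow> h \<in> coord_ring I n \<Longrightarrow> h * p \<in> J"
    using J(1) unfolding coord_ring_def ideal_polys_in_iff by blast+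
  have Jsum: "sum g A \<in> J" if "\<And>a. a \<in> A \<Longrightarrow> g a \<in> J" for g :: "(int ^ 'q) \<Rightarrow> _" and A
    using that by (induction A rule: infinite_finite_induct) (auto intro: Ji)
  show "\<exists>N. chart_monomial I \<sigma> ^ N * F \<in> J"
  proof (cases "F = 0")
    case True
    then show ?thesis using Ji by simp
  next
    case False
    define D where "D = insert b (multidegree ` Poly_Mapping.keys G)"
    have finD: "finite D" unfolding D_def by simp
    define N where "N = (\<Sum>a\<in>D. \<Sum>i\<in>UNIV. nat (a $ i))"
    have N: "a $ i \<le> int N" if "a \<in> D" for a i
    proof -
      have "nat (a $ i) \<le> (\<Sum>i\<in>UNIV. nat (a $ i))" by (rule member_le_sum) auto
      also have "\<dots> \<le> N" unfolding N_def using that finD by (intro member_le_sum) auto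
      finally show ?thesis by linarith
    qed
    have deg0: "multidegree m $ i = 0" if "Poly_Mapping.keys m \<subseteq> {(i, j). i \<in> I \<and> j \<le> n i}" "i \<notin> I"
      for m :: "'q monomial" and i
      unfolding multidegree_def using that by (auto simp: axis_def intro!: sum.neutral)
    have Gr: "G \<in> coord_ring I n" using G Ji by blast
    obtain mF where "mF \<in> Poly_Mapping.keys F" using False by (metis ex_in_conv keys_eq_empty)
    then have D0: "a $ i = 0" if "a \<in> D" "i \<notin> I" for a i
      using that F Gr deg0[of _ i]
      by (auto simp: D_def forms_def coord_ring_def polys_in_def)
    define u :: "int ^ 'q \<Rightarrow> ('q, 'k) mpoly"
      where "u a = (\<Prod>i\<in>I. var (i, \<sigma> i) ^ nat (int N - a $ i))" for a
    let ?N = "\<Sum>i\<in>I. axis i (int N)"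
    have u: "u a \<in> forms I n (?N - a)" if "a \<in> D" for a
    proof -
      have "u a \<in> forms I n (\<Sum>i\<in>I. axis i (int (nat (int N - a $ i))))"
        unfolding u_def using \<sigma> by (intro forms_prod forms_var_power) (auto simp: charts_def)
      also have "(\<Sum>i\<in>I. axis i (int (nat (int N - a $ i)))) = ?N - a"
        using N[OF that] D0[OF that]
        by (auto simp: vec_eq_iff axis_def if_distrib[of "\<lambda>f. f _"] sum.delta cong: if_cong)
      finally show ?thesis .
    qed
    have du: "dehom \<sigma> (u a) = 1" for a
      by (simp add: u_def dehom_prod dehom_power dehom_var)
    let ?H = "\<Sum>a\<in>D. u a * component a G"
    have H: "?H \<in> J"
      by (rule Jsum) (use G J(2) u in \<open>auto simp: homogeneous_def forms_def intro!: Ji(4)\<close>)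
    have Hf: "?H \<in> forms I n ?N"
    proof (rule forms_sum)
      fix a assume a: "a \<in> D"
      show "u a * component a G \<in> forms I n ?N"
        using forms_mult[OF u[OF a] component_in_forms[OF Gr, of a]] by simp
    qed
    have bD: "b \<in> D" by (simp add: D_def)
    have uF: "u b * F \<in> forms I n ?N" using forms_mult[OF u[OF bD] F] by simp
    have "dehom \<sigma> ?H = dehom \<sigma> G"
      by (subst (2) sum_component[OF finD, of G]) (auto simp: dehom_sum dehom_mult du D_def)
    then have "dehom \<sigma> (u b * F - ?H) = 0"
      using G by (simp add: dehom_diff dehom_mult du)
    moreover have "\<forall>m\<in>Poly_Mapping.keys (u b * F - ?H). multidegree m = ?N"
    proof
      fix m assume "m \<in> Poly_Mapping.keys (u b * F - ?H)"
      then have "m \<in> Poly_Mapping.keys (u b * F) \<or> m \<in> Poly_Mapping.keys ?H" by (auto simp: in_keys_iff lookup_minus)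
      then show "multidegree m = ?N" using uF Hf by (auto simp: forms_def)
    qed
    ultimately have "u b * F - ?H = 0" using dehom_eq_0_form by blast
    then have uFJ: "u b * F \<in> J" using H by simp
    define w :: "('q, 'k) mpoly" where "w = (\<Prod>i\<in>I. var (i, \<sigma> i) ^ nat (b $ i))"
    have "w \<in> coord_ring I n"
      unfolding w_def coord_ring_def using \<sigma>
      by (intro polys_in_prod polys_in_power polys_in_var) (auto simp: charts_def)
    then have wJ: "w * (u b * F) \<in> J" using uFJ Ji by blast
    have b0: "b $ i \<ge> 0" for i
    proof -
      have "multidegree mF $ i \<ge> 0"
        unfolding multidegree_def by (auto simp: axis_def intro!: sum_nonneg)
      then show ?thesis using \<open>mF \<in> Poly_Mapping.keys F\<close> F by (simp add: forms_def)
    qed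
    have "w * u b = chart_monomial I \<sigma> ^ N"
      unfolding w_def u_def chart_monomial_def prod.distrib[symmetric] prod_power_distrib
    proof (rule prod.cong[OF refl])
      fix i
      have "nat (b $ i) + nat (int N - b $ i) = N" using N[OF bD, of i] b0[of i] by simp
      then show "var (i, \<sigma> i) ^ nat (b $ i) * var (i, \<sigma> i) ^ nat (int N - b $ i) =
          (var (i, \<sigma> i) ^ N :: ('q, 'k) mpoly)"
        by (metis power_add)
    qed
    then show ?thesis using wJ by (metis mult.assoc)
  qed
qed

lemma dehom_coord_ring: "p \<in> coord_ring I n \<Longrightarrow> dehom \<sigma> p \<in> chart_ring I n \<sigma>"
proof -
  assume p: "p \<in> coord_ring I n"
  have "dehom \<sigma> p = (\<Sum>m\<in>Poly_Mapping.keys p. Poly_Mapping.single (dehom_monomial \<sigma> m) (Poly_Mapping.lookup p m))"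
    by (subst poly_mapping_sum_single[of p]) (simp add: dehom_sum dehom_single)
  also have "\<dots> \<in> chart_ring I n \<sigma>"
    unfolding chart_ring_def
  proof (rule polys_in_sum)
    fix m assume m: "m \<in> Poly_Mapping.keys p"
    then have "Poly_Mapping.keys m \<subseteq> {(i, j). i \<in> I \<and> j \<le> n i}"
      using p by (auto simp: coord_ring_def polys_in_def)
    moreover have "Poly_Mapping.keys (dehom_monomial \<sigma> m) = {v \<in> Poly_Mapping.keys m. snd v \<noteq> \<sigma> (fst v)}"
      by (auto simp: in_keys_iff lookup_dehom_monomial split: if_splits)
    ultimately show "Poly_Mapping.single (dehom_monomial \<sigma> m) (Poly_Mapping.lookup p m) \<in> polys_in {(i, j). i \<in> I \<and> j \<le> n i \<and> j \<noteq> \<sigma> i}"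
      by (auto simp: polys_in_def)
  qed
  finally show ?thesis .
qed

lemma dehom_chart_ring: "p \<in> chart_ring I n \<sigma> \<Longrightarrow> dehom \<sigma> p = p"
proof -
  assume p: "p \<in> chart_ring I n \<sigma>"
  have "dehom \<sigma> p = (\<Sum>m\<in>Poly_Mapping.keys p. Poly_Mapping.single (dehom_monomial \<sigma> m) (Poly_Mapping.lookup p m))"
    by (subst poly_mapping_sum_single[of p]) (simp add: dehom_sum dehom_single)
  also have "\<dots> = (\<Sum>m\<in>Poly_Mapping.keys p. Poly_Mapping.single m (Poly_Mapping.lookup p m))"
  proof (rule sum.cong[OF refl])
    fix m assume "m \<in> Poly_Mapping.keys p"
    then have "dehom_monomial \<sigma> m = m"
      using p by (intro poly_mapping_eqI)
        (force simp: lookup_dehom_monomial chart_ring_def polys_in_def in_keys_iff)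
    then show "Poly_Mapping.single (dehom_monomial \<sigma> m) (Poly_Mapping.lookup p m) = Poly_Mapping.single m (Poly_Mapping.lookup p m)" by simp
  qed
  finally show ?thesis using poly_mapping_sum_single[of p] by simp
qed

lemma chart_ring_subset: "chart_ring I n \<sigma> \<subseteq> coord_ring I n"
  by (auto simp: chart_ring_def coord_ring_def polys_in_def)

lemma closed_subscheme_of_ideal:
  fixes J :: "('q::finite, 'k::comm_ring_1) mpoly set"
  assumes J: "ideal J (subring_of (coord_ring I n))" "homogeneous J"
  shows "closed_subscheme I n (subscheme_of_ideal J)"
  unfolding closed_subscheme_def subscheme_of_ideal_def
proof (intro conjI ballI allI)
  fix \<sigma> assume "\<sigma> \<in> charts I n"
  have Ji: "J \<subseteq> coord_ring I n" "0 \<in> J" "\<And>p q. p \<in> J \<Longrightarrow> q \<in> J \<Longrightarrow> p + q \<in> J"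
    "\<And>p h. p \<in> J \<Longrightarrow> h \<in> coord_ring I n \<Longrightarrow> h * p \<in> J"
    using J(1) unfolding coord_ring_def ideal_polys_in_iff by blast+
  show "ideal (dehom \<sigma> ` J) (subring_of (chart_ring I n \<sigma>))"
    unfolding chart_ring_def ideal_polys_in_iff
    unfolding chart_ring_def[symmetric]
  proof (intro conjI ballI)
    show "0 \<in> dehom \<sigma> ` J" using Ji(2) by (metis dehom_0 imageI)
    fix p assume "p \<in> dehom \<sigma> ` J"
    then obtain P where P: "P \<in> J" "p = dehom \<sigma> P" by auto
    show "p + q \<in> dehom \<sigma> ` J" if q: "q \<in> dehom \<sigma> ` J" for q
      using P q Ji(3) by (auto simp flip: dehom_add)
    show "h * p \<in> dehom \<sigma> ` J" if h: "h \<in> chart_ring I n \<sigma>" for h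
    proof -
      have "h * p = dehom \<sigma> (h * P)" using P h by (simp add: dehom_mult dehom_chart_ring)
      then show ?thesis using P h Ji(4)[of P h] chart_ring_subset[of I n \<sigma>] by auto
    qed
  qed (use Ji in \<open>auto intro: dehom_coord_ring\<close>)
next
  fix \<sigma> \<tau> a and F :: "('q, 'k) mpoly" assume *: "\<sigma> \<in> charts I n" "\<tau> \<in> charts I n" "F \<in> forms I n a"
  have key: "dehom \<rho> (chart_monomial I \<rho>' ^ N * F) \<in> dehom \<rho> ` J \<longleftrightarrow>
      (\<exists>M. chart_monomial I \<rho> ^ M * (chart_monomial I \<rho>' ^ N * F) \<in> J)"
    if "\<rho> \<in> charts I n" "\<rho>' \<in> charts I n" for \<rho> \<rho>' N
    using dehom_image_iff[OF J that(1) forms_mult[OF chart_monomial_forms[OF that(2)] *(3)]] .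
  show "(\<exists>N. dehom \<sigma> (chart_monomial I \<tau> ^ N * F) \<in> dehom \<sigma> ` J) \<longleftrightarrow>
      (\<exists>N. dehom \<tau> (chart_monomial I \<sigma> ^ N * F) \<in> dehom \<tau> ` J)"
    unfolding key[OF *(1,2)] key[OF *(2,1)] by (metis mult.left_commute)
qed

lemma vanishing_ideal_ideal: "ideal (vanishing_ideal I n X) (subring_of (coord_ring I n))"
  unfolding vanishing_ideal_def coord_ring_def
proof (rule ring.genideal_ideal)
  show "ring (subring_of (polys_in {(i, j). i \<in> I \<and> j \<le> n i}))"
    using cring_polys_in cring.axioms(1) by blast
qed (auto simp: vanishing_forms_def forms_def coord_ring_def subring_of_def)

lemma vanishing_forms_subset: "vanishing_forms I n X \<subseteq> vanishing_ideal I n X"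
  unfolding vanishing_ideal_def coord_ring_def
proof (rule ring.genideal_self)
  show "ring (subring_of (polys_in {(i, j). i \<in> I \<and> j \<le> n i}))"
    using cring_polys_in cring.axioms(1) by blast
qed (auto simp: vanishing_forms_def forms_def coord_ring_def subring_of_def)

lemma vanishing_ideal_minimal:
  assumes "ideal J (subring_of (coord_ring I n))" "vanishing_forms I n X \<subseteq> J"
  shows "vanishing_ideal I n X \<subseteq> J"
  unfolding vanishing_ideal_def
proof (rule ring.genideal_minimal)
  show "ring (subring_of (coord_ring I n))"
    unfolding coord_ring_def using cring_polys_in cring.axioms(1) by blast
qed (use assms in auto)

lemma vanishing_ideal_iff:
  fixes X :: "('q::finite, 'k::comm_ring_1) ideal_family"
  assumes X: "\<And>\<sigma>. \<sigma> \<in> charts I n \<Longrightarrow> ideal (X \<sigma>) (subring_of (chart_ring I n \<sigma>))"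
  shows "p \<in> vanishing_ideal I n X \<longleftrightarrow>
    p \<in> coord_ring I n \<and> (\<forall>a. component a p \<in> vanishing_forms I n X)" (is "_ \<longleftrightarrow> ?R p")
proof
  have Xi: "X \<sigma> \<subseteq> chart_ring I n \<sigma>" "0 \<in> X \<sigma>" "\<And>p q. p \<in> X \<sigma> \<Longrightarrow> q \<in> X \<sigma> \<Longrightarrow> p + q \<in> X \<sigma>"
    "\<And>p h. p \<in> X \<sigma> \<Longrightarrow> h \<in> chart_ring I n \<sigma> \<Longrightarrow> h * p \<in> X \<sigma>" if "\<sigma> \<in> charts I n" for \<sigma>
    using X[OF that] unfolding chart_ring_def ideal_polys_in_iff by blast+
  have vf: "component a p \<in> vanishing_forms I n X \<longleftrightarrow>
      (\<forall>\<sigma>\<in>charts I n. dehom \<sigma> (component a p) \<in> X \<sigma>)" if "p \<in> coord_ring I n" for a p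
    using component_in_forms[OF that, of a] by (auto simp: vanishing_forms_def)
  have radd: "p + q \<in> coord_ring I n" "p * q \<in> coord_ring I n"
    if "p \<in> coord_ring I n" "q \<in> coord_ring I n" for p q :: "('q, 'k) mpoly"
    using that by (auto simp: coord_ring_def intro: polys_in_add polys_in_mult)
  have R_iff: "?R p \<longleftrightarrow> p \<in> coord_ring I n \<and>
      (\<forall>a. \<forall>\<sigma>\<in>charts I n. dehom \<sigma> (component a p) \<in> X \<sigma>)" for p
    using vf by blast
  have add: "?R (p + q)" if "?R p" "?R q" for p q
    using that radd(1)[of p q] unfolding R_iff by (simp add: component_add dehom_add Xi(3))
  have zero: "?R 0" unfolding R_iff by (simp add: coord_ring_def Xi(2))
  have single: "?R (Poly_Mapping.single m c * p)" if "?R p" "Poly_Mapping.single m c \<in> coord_ring I n" for m c p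
    using that radd(2)[of "Poly_Mapping.single m c" p] unfolding R_iff
    by (simp add: component_single_mult dehom_mult Xi(4) dehom_coord_ring)
  have mult: "?R (h * p)" if "?R p" "h \<in> coord_ring I n" for h p
  proof -
    have s: "Poly_Mapping.single m (Poly_Mapping.lookup h m) \<in> coord_ring I n" if "m \<in> Poly_Mapping.keys h" for m
      using that \<open>h \<in> _\<close> by (auto simp: coord_ring_def polys_in_def)
    have "?R (\<Sum>m\<in>A. Poly_Mapping.single m (Poly_Mapping.lookup h m) * p)" if "finite A" "A \<subseteq> Poly_Mapping.keys h" for A
      using that
    proof (induction A rule: finite_induct)
      case empty
      then show ?case using zero by simp
    next
      case (insert m A)
      then show ?case
        using add[OF single[OF \<open>?R p\<close> s[of m]], of "\<Sum>m\<in>A. Poly_Mapping.single m (Poly_Mapping.lookup h m) * p"] by simp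
    qed
    from this[of "Poly_Mapping.keys h"] show ?thesis
      using poly_mapping_sum_single[of h] by (simp flip: sum_distrib_right)
  qed
  have "ideal {p. ?R p} (subring_of (coord_ring I n))"
    unfolding coord_ring_def ideal_polys_in_iff
    unfolding coord_ring_def[symmetric] using add zero mult by blast
  moreover have "vanishing_forms I n X \<subseteq> {p. ?R p}"
  proof
    fix F assume F: "F \<in> vanishing_forms I n X"
    then obtain a where a: "F \<in> forms I n a" by (auto simp: vanishing_forms_def)
    have "component b F \<in> vanishing_forms I n X" for b
      using component_form[OF a, of b] F zero by (cases "b = a") auto
    then show "F \<in> {p. ?R p}" using a by (auto simp: forms_def)
  qed
  ultimately show "?R p" if "p \<in> vanishing_ideal I n X"
    using that vanishing_ideal_minimal by blast
next
  assume R: "?R p"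
  have *: "0 \<in> vanishing_ideal I n X"
    "\<And>p q. p \<in> vanishing_ideal I n X \<Longrightarrow> q \<in> vanishing_ideal I n X \<Longrightarrow> p + q \<in> vanishing_ideal I n X"
    using vanishing_ideal_ideal[of I n X] unfolding coord_ring_def ideal_polys_in_iff by blast+
  have "(\<Sum>a\<in>D. component a p) \<in> vanishing_ideal I n X" if "finite D" for D
    using that by induction (use * R subsetD[OF vanishing_forms_subset[of I n X]] in auto)
  then show "p \<in> vanishing_ideal I n X"
    using sum_component[of "multidegree ` Poly_Mapping.keys p" p] by (metis finite_imageI finite_keys order_refl)
qed

lemma projection_ideal:
  fixes X :: "('q::finite, 'k::comm_ring_1) ideal_family" and i :: 'q
  assumes X: "closed_subscheme UNIV n X"
  defines "J \<equiv> vanishing_ideal UNIV n X \<inter> coord_ring {i} n"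
  shows "ideal J (subring_of (coord_ring {i} n))" "homogeneous J"
proof -
  have sub: "coord_ring {i} n \<subseteq> coord_ring UNIV n"
    by (auto simp: coord_ring_def polys_in_def)
  have *: "0 \<in> vanishing_ideal UNIV n X"
    "\<And>p q. p \<in> vanishing_ideal UNIV n X \<Longrightarrow> q \<in> vanishing_ideal UNIV n X \<Longrightarrow> p + q \<in> vanishing_ideal UNIV n X"
    "\<And>p h. p \<in> vanishing_ideal UNIV n X \<Longrightarrow> h \<in> coord_ring UNIV n \<Longrightarrow> h * p \<in> vanishing_ideal UNIV n X"
    using vanishing_ideal_ideal[of UNIV n X] unfolding coord_ring_def ideal_polys_in_iff by blast+
  show "ideal J (subring_of (coord_ring {i} n))"
    unfolding J_def using * sub
    by (subst coord_ring_def, subst ideal_polys_in_iff)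
       (auto simp flip: coord_ring_def, auto simp: coord_ring_def intro: polys_in_add polys_in_mult)
  have "\<And>\<sigma>. \<sigma> \<in> charts UNIV n \<Longrightarrow> ideal (X \<sigma>) (subring_of (chart_ring UNIV n \<sigma>))"
    using X by (simp add: closed_subscheme_def)
  note iff = vanishing_ideal_iff[OF this]
  show "homogeneous J"
    unfolding homogeneous_def
  proof (intro ballI allI)
    fix p a assume p: "p \<in> J"
    then have "component a p \<in> vanishing_forms UNIV n X" using iff[of p] by (simp add: J_def)
    moreover have "component a p \<in> coord_ring {i} n"
      using p component_in_forms[of p "{i}" n a] by (simp add: J_def forms_def)
    ultimately show "component a p \<in> J"
      using vanishing_forms_subset[of UNIV n X] by (auto simp: J_def)
  qed
qed

text \<open>
  The projection is a closed subscheme of \<open>P^(n i)\<close>, and the ideal that defines it is the full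
  ideal generated by the forms vanishing on it.
\<close>

lemma closed_subscheme_projection:
  "closed_subscheme UNIV n X \<Longrightarrow> closed_subscheme {i} n (projection n i X)"
  unfolding projection_def by (intro closed_subscheme_of_ideal projection_ideal)

lemma vanishing_ideal_projection:
  fixes X :: "('q::finite, 'k::comm_ring_1) ideal_family"
  assumes X: "closed_subscheme UNIV n X"
  shows "vanishing_ideal {i} n (projection n i X) = vanishing_ideal UNIV n X \<inter> coord_ring {i} n"
    (is "_ = ?J")
proof
  note J = projection_ideal[OF X, of i]
  have Xi: "\<And>\<sigma>. \<sigma> \<in> charts UNIV n \<Longrightarrow> ideal (X \<sigma>) (subring_of (chart_ring UNIV n \<sigma>))"
    using X by (simp add: closed_subscheme_def)
  show "vanishing_ideal {i} n (projection n i X) \<subseteq> ?J"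
  proof (rule vanishing_ideal_minimal[OF J(1)], rule subsetI)
    fix F assume F: "F \<in> vanishing_forms {i} n (projection n i X)"
    then obtain a where a: "F \<in> forms {i} n a" by (auto simp: vanishing_forms_def)
    have sub: "forms {i} n b \<subseteq> forms UNIV n b" for b
      by (auto simp: forms_def coord_ring_def polys_in_def)
    have "dehom \<tau> F \<in> X \<tau>" if \<tau>: "\<tau> \<in> charts UNIV n" for \<tau>
    proof -
      define \<sigma> where "\<sigma> = restrict \<tau> {i}"
      have \<sigma>: "\<sigma> \<in> charts {i} n" using \<tau> by (auto simp: \<sigma>_def charts_def)
      then have "dehom \<sigma> F \<in> dehom \<sigma> ` ?J"
        using F by (auto simp: vanishing_forms_def projection_def subscheme_of_ideal_def)
      then obtain N where N: "chart_monomial {i} \<sigma> ^ N * F \<in> ?J"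
        using dehom_image_iff[OF J \<sigma> a] by auto
      have "chart_monomial {i} \<sigma> ^ N * F \<in> forms UNIV n ((\<Sum>k<N. \<Sum>i\<in>{i}. axis i 1) + a)"
        using forms_mult[OF chart_monomial_forms[OF \<sigma>] a] sub by blast
      then have "chart_monomial {i} \<sigma> ^ N * F \<in> vanishing_forms UNIV n X"
        using N vanishing_ideal_iff[OF Xi] component_form by (metis IntD1)
      then have "dehom \<tau> (chart_monomial {i} \<sigma> ^ N * F) \<in> X \<tau>"
        using \<tau> by (auto simp: vanishing_forms_def)
      moreover have "dehom \<tau> (chart_monomial {i} \<sigma> :: ('q, 'k) mpoly) = 1"
        by (rule dehom_chart_monomial) (simp add: \<sigma>_def)
      ultimately show ?thesis by (simp add: dehom_mult dehom_power)
    qed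
    then have "F \<in> vanishing_forms UNIV n X"
      using a sub by (auto simp: vanishing_forms_def)
    then show "F \<in> ?J"
      using vanishing_forms_subset a by (auto simp: forms_def)
  qed
  show "?J \<subseteq> vanishing_ideal {i} n (projection n i X)"
  proof
    fix p assume p: "p \<in> ?J"
    have PX: "\<And>\<sigma>. \<sigma> \<in> charts {i} n \<Longrightarrow>
        ideal (projection n i X \<sigma>) (subring_of (chart_ring {i} n \<sigma>))"
      using closed_subscheme_projection[OF X, of i] by (simp add: closed_subscheme_def)
    have "component a p \<in> vanishing_forms {i} n (projection n i X)" for a
      using p J(2) component_in_forms[of p "{i}" n a]
      by (auto simp: vanishing_forms_def projection_def subscheme_of_ideal_def homogeneous_def)
    then show "p \<in> vanishing_ideal {i} n (projection n i X)"
      using p vanishing_ideal_iff[OF PX] by blast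
  qed
qed

end

theory Submission
  imports Defs "HOL-Computational_Algebra.Polynomial"
begin

text \<open>
  Let \<open>S\<close> be the coordinate ring, \<open>J\<close> the ideal of \<open>X\<close> and \<open>H(a) = dim (S/J)\<^sub>a\<close>.  Everything follows from three
  properties of \<open>H\<close>: it is bounded, and for each \<open>i\<close> and each \<open>k \<ge> 0\<close>
  \<^item> \<open>H(a) \<le> H(a + e\<^sub>i)\<close> for all \<open>a\<close>, and
  \<^item> \<open>H((k+1) e\<^sub>i) = H(k e\<^sub>i)\<close> implies \<open>H(a + e\<^sub>i) = H(a)\<close> for all \<open>a\<close> with \<open>a\<^sub>i \<ge> k\<close>.

  Since \<open>H(k e\<^sub>i)\<close> is the Hilbert function of the projection \<open>Z\<^sub>i\<close>, these properties say that this function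
  increases strictly up to the first \<open>k\<close> with \<open>H((k+1) e\<^sub>i) = H(k e\<^sub>i)\<close> and is constant afterwards, so that this
  \<open>k\<close> is \<open>rin(Z\<^sub>i)\<close>, and that \<open>H\<close> no longer changes in direction \<open>i\<close> once \<open>a\<^sub>i \<ge> rin(Z\<^sub>i)\<close>.  Hence the difference
  function vanishes outside \<open>[0, rem(X)]\<close>.  Conversely, if it vanishes outside \<open>[0, s]\<close>, then \<open>H\<close> does not
  change in direction \<open>i\<close> from \<open>s\<^sub>i\<close> on, and therefore \<open>rin(Z\<^sub>i) \<le> s\<^sub>i\<close>.

  The two displayed properties would be immediate from a linear form \<open>l\<close> in \<open>x\<^sub>i\<^sub>0, x\<^sub>i\<^sub>1, \<dots>\<close> that is not a zero
  divisor modulo \<open>J\<close>: multiplication by \<open>l\<close> embeds \<open>(S/J)\<^sub>a\<close> into the component of degree \<open>a + e\<^sub>i\<close>, and if it is onto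
  in degree \<open>k e\<^sub>i\<close>, it is onto in all degrees \<open>a\<close> with \<open>a\<^sub>i \<ge> k\<close>, because each monomial of degree \<open>a + e\<^sub>i\<close> is
  divisible by one of degree \<open>(k+1) e\<^sub>i\<close>.  Over a finite field there need not be such an \<open>l\<close>.  The linear form
  \<open>\<Sum>\<^sub>j t^j x\<^sub>i\<^sub>j\<close> with a parameter \<open>t\<close> always does the job: a polynomial in \<open>t\<close> that is a zero divisor is annihilated
  by a nonzero element that does not involve \<open>t\<close> (McCoy), but nothing outside \<open>J\<close> is multiplied into \<open>J\<close> by all
  the \<open>x\<^sub>i\<^sub>j\<close>, as one of them is invertible on each chart (\<open>generic_form_cancel\<close>).  Dimensions over \<open>K(t)\<close> are
  compared by counting, over \<open>K\<close>, the polynomials of degree less than \<open>N\<close> in \<open>t\<close> for large \<open>N\<close>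
  (\<open>hilbert_function_mono\<close>, \<open>hilbert_function_stable\<close>).

  Boundedness holds because a form vanishes on \<open>X\<close> iff it does so on the finitely many charts, and because the
  rings of functions on the charts of \<open>X\<close> are finite-dimensional (\<open>finite_codimension\<close>).  For the latter it
  suffices that each variable \<open>x\<close> is algebraic modulo the ideal \<open>I\<close> of \<open>X\<close> in the chart.  Otherwise \<open>x\<close> belongs to a
  maximal set \<open>T\<close> of variables that are algebraically independent modulo \<open>I\<close>, there is a prime ideal \<open>P \<supseteq> I\<close> that
  meets \<open>K[T]\<close> only in \<open>0\<close>, and \<open>P\<close> is maximal as \<open>X\<close> has dimension zero.  All elements of the residue field of
  \<open>P\<close> are algebraic over \<open>K(T)\<close>, and they can be written with powers of a single \<open>f \<in> K[T]\<close> as denominators.  But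
  \<open>1 + x f\<close> does not divide a power of \<open>f\<close>.
\<close>


section \<open>Linear algebra by counting\<close>

text \<open>
  All comparisons of dimensions below are reduced to this form, with finite families in place of subspaces.
\<close>

lemma underdetermined_system:
  fixes a :: "'i \<Rightarrow> 'j \<Rightarrow> 'k::field"
  assumes "finite J" "finite I" "card J < card I"
  shows "\<exists>l. (\<exists>i\<in>I. l i \<noteq> 0) \<and> (\<forall>j\<in>J. (\<Sum>i\<in>I. l i * a i j) = 0)"
  using assms
proof (induction J arbitrary: I a rule: finite_induct)
  case empty
  then have "I \<noteq> {}" by auto
  then show ?case by (intro exI[of _ "\<lambda>_. 1"]) auto
next
  case (insert j J)
  show ?case
  proof (cases "\<forall>i\<in>I. a i j = 0")
    case True
    have "card J < card I" using insert by auto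
    from insert.IH[OF insert.prems(1) this, of a] True show ?thesis by auto
  next
    case False
    then obtain s where s: "s \<in> I" "a s j \<noteq> 0" by auto
    \<comment> \<open>Gaussian elimination: the unknown \<open>s\<close> is eliminated by means of equation \<open>j\<close>\<close>
    define b where "b i k = a i k - a i j / a s j * a s k" for i k
    have "card J < card (I - {s})" using insert s by auto
    from insert.IH[OF _ this, of b] insert.prems(1) obtain l where
      l: "\<exists>i\<in>I - {s}. l i \<noteq> 0" "\<forall>k\<in>J. (\<Sum>i\<in>I - {s}. l i * b i k) = 0" by auto
    define l' where "l' = l(s := - (\<Sum>i\<in>I - {s}. l i * (a i j / a s j)))"
    have split: "(\<Sum>i\<in>I. l' i * a i k) = (\<Sum>i\<in>I - {s}. l i * b i k)" for k
    proof -
      have "(\<Sum>i\<in>I. l' i * a i k) = l' s * a s k + (\<Sum>i\<in>I - {s}. l' i * a i k)"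
        using insert.prems(1) s(1) by (rule sum.remove)
      also have "(\<Sum>i\<in>I - {s}. l' i * a i k) = (\<Sum>i\<in>I - {s}. l i * a i k)"
        by (intro sum.cong) (auto simp: l'_def)
      finally show ?thesis
        by (simp add: l'_def b_def sum_subtractf right_diff_distrib sum_distrib_right mult.assoc)
    qed
    have "b i j = 0" for i using s(2) by (simp add: b_def)
    then have "\<forall>k\<in>insert j J. (\<Sum>i\<in>I. l' i * a i k) = 0"
      using l(2) by (simp add: split)
    moreover have "\<exists>i\<in>I. l' i \<noteq> 0" using l(1) by (auto simp: l'_def)
    ultimately show ?thesis by blast
  qed
qed

context vector_space
begin

text \<open>
  Steinitz' exchange lemma in the quotient by \<open>W\<close>, without forming the quotient.
\<close>

lemma exchange_modulo:
  assumes W: "subspace W" and fin: "finite I" "finite J" and card: "card J < card I"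
    and span: "\<And>i. i \<in> I \<Longrightarrow> x i - (\<Sum>j\<in>J. scale (c i j) (y j)) \<in> W"
  shows "\<exists>l. (\<exists>i\<in>I. l i \<noteq> 0) \<and> (\<Sum>i\<in>I. scale (l i) (x i)) \<in> W"
proof -
  obtain l where l: "\<exists>i\<in>I. l i \<noteq> 0" "\<forall>j\<in>J. (\<Sum>i\<in>I. l i * c i j) = 0"
    using underdetermined_system[OF fin(2,1) card, of c] by auto
  have "(\<Sum>i\<in>I. scale (l i) (\<Sum>j\<in>J. scale (c i j) (y j))) = (\<Sum>j\<in>J. scale (\<Sum>i\<in>I. l i * c i j) (y j))"
    by (simp add: scale_sum_right scale_sum_left) (rule sum.swap)
  also have "\<dots> = 0" using l(2) by simp
  finally have "(\<Sum>i\<in>I. scale (l i) (x i)) = (\<Sum>i\<in>I. scale (l i) (x i - (\<Sum>j\<in>J. scale (c i j) (y j))))"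
    by (simp add: scale_right_diff_distrib sum_subtractf)
  also have "\<dots> \<in> W" using W span by (intro subspace_sum subspace_scale)
  finally show ?thesis using l(1) by blast
qed

text \<open>
  A spanning subset of minimal cardinality is independent, since a nontrivial relation would allow
  one of its elements to be dropped.
\<close>

lemma basis_modulo_exists:
  assumes W: "subspace W" and G: "finite G"
    and span: "\<And>u. u \<in> U \<Longrightarrow> \<exists>c. u - (\<Sum>b\<in>G. scale (c b) b) \<in> W"
  obtains B where "B \<subseteq> G"
    and "\<forall>u\<in>U. \<exists>c. u - (\<Sum>b\<in>B. scale (c b) b) \<in> W"
    and "\<forall>c. (\<Sum>b\<in>B. scale (c b) b) \<in> W \<longrightarrow> (\<forall>b\<in>B. c b = 0)"
proof -
  define spanning where "spanning B \<longleftrightarrow> B \<subseteq> G \<and> (\<forall>u\<in>U. \<exists>c. u - (\<Sum>b\<in>B. scale (c b) b) \<in> W)" for B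
  \<comment> \<open>the cardinality of a smallest spanning subset\<close>
  define m where "m = (LEAST k. \<exists>B. spanning B \<and> card B = k)"
  have "spanning G" using span by (auto simp: spanning_def)
  then have "\<exists>k B. spanning B \<and> card B = k" by blast
  then have "\<exists>B. spanning B \<and> card B = m" unfolding m_def by (rule LeastI_ex)
  then obtain B where B: "spanning B" "card B = m" by blast
  have least: "m \<le> card B'" if "spanning B'" for B'
    unfolding m_def using that by (intro Least_le) blast
  have finB: "finite B" using B(1) G(1) finite_subset by (auto simp: spanning_def)
  show ?thesis
  proof (rule that)
    show "B \<subseteq> G" "\<forall>u\<in>U. \<exists>c. u - (\<Sum>b\<in>B. scale (c b) b) \<in> W"
      using B(1) by (simp_all add: spanning_def)
    show "\<forall>c. (\<Sum>b\<in>B. scale (c b) b) \<in> W \<longrightarrow> (\<forall>b\<in>B. c b = 0)"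
    proof (intro allI impI ballI)
      fix c b0 assume c: "(\<Sum>b\<in>B. scale (c b) b) \<in> W" and b0: "b0 \<in> B"
      show "c b0 = 0"
      proof (rule ccontr)
        assume nz: "c b0 \<noteq> 0"
        have "spanning (B - {b0})"
          unfolding spanning_def
        proof (intro conjI ballI)
          show "B - {b0} \<subseteq> G" using B(1) by (auto simp: spanning_def)
          fix u assume "u \<in> U"
          then obtain d where d: "u - (\<Sum>b\<in>B. scale (d b) b) \<in> W" using B(1) by (auto simp: spanning_def)
          define r where "r = d b0 / c b0"
          have "(u - (\<Sum>b\<in>B. scale (d b) b)) + scale r (\<Sum>b\<in>B. scale (c b) b) \<in> W"
            using W(1) d c by (intro subspace_add subspace_scale)
          also have "(u - (\<Sum>b\<in>B. scale (d b) b)) + scale r (\<Sum>b\<in>B. scale (c b) b)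
              = u - (\<Sum>b\<in>B. scale (d b - r * c b) b)"
            by (simp add: scale_left_diff_distrib sum_subtractf scale_sum_right)
          also have "(\<Sum>b\<in>B. scale (d b - r * c b) b) = (\<Sum>b\<in>B - {b0}. scale (d b - r * c b) b)"
            using finB b0 nz by (subst sum.remove[of _ b0]) (auto simp: r_def)
          finally show "\<exists>c. u - (\<Sum>b\<in>B - {b0}. scale (c b) b) \<in> W"
            by (rule exI[of _ "\<lambda>b. d b - r * c b"])
        qed
        then have "m \<le> card (B - {b0})" by (rule least)
        then show False using B(2) finB b0 by (metis card_Diff1_less not_le)
      qed
    qed
  qed
qed

end

interpretation mpoly_vs: vector_space "\<lambda>(c::'k::field) (p::('q, 'k) mpoly). const c * p"
  by unfold_locales (auto simp: const_def mult_single single_add algebra_simps)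

interpretation poly_vs: vector_space "\<lambda>(c::'k::field) (p::('q, 'k) mpoly poly). smult (const c) p"
  by unfold_locales (auto simp: const_def mult_single single_add smult_add_left smult_add_right)

lemma basis_mod_unique_coeffs:
  fixes U W B :: "('q, 'k::field) mpoly set"
  assumes W: "mpoly_vs.subspace W" and B: "basis_mod U W B"
    and c: "(\<Sum>b\<in>B. const (c b) * b) \<in> W" and b: "b \<in> B"
    and U: "0 \<in> U"
  shows "c b = 0"
proof -
  let ?P = "\<lambda>c. c \<in> B \<rightarrow>\<^sub>E UNIV \<and> 0 - (\<Sum>b\<in>B. const (c b) * b) \<in> W"
  have "\<exists>!c. ?P c" using B U unfolding basis_mod_def by blast
  moreover have "?P (restrict (\<lambda>_. 0) B)"
    using mpoly_vs.subspace_0[OF W] by (auto simp: const_def)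
  moreover have "?P (restrict c B)"
    using mpoly_vs.subspace_neg[OF W c] by auto
  ultimately have "restrict c B = restrict (\<lambda>_. 0) B" by blast
  then show ?thesis using b by (metis restrict_apply')
qed

lemma basis_modI:
  fixes U W B :: "('q, 'k::field) mpoly set"
  assumes W: "mpoly_vs.subspace W" and B: "finite B" "B \<subseteq> U"
    and span: "\<And>u. u \<in> U \<Longrightarrow> \<exists>c. u - (\<Sum>b\<in>B. const (c b) * b) \<in> W"
    and indep: "\<And>c b. (\<Sum>b\<in>B. const (c b) * b) \<in> W \<Longrightarrow> b \<in> B \<Longrightarrow> c b = 0"
  shows "basis_mod U W B"
  unfolding basis_mod_def
proof (intro conjI ballI)
  fix u assume "u \<in> U"
  then obtain c where c: "u - (\<Sum>b\<in>B. const (c b) * b) \<in> W" using span by blast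
  show "\<exists>!c. c \<in> B \<rightarrow>\<^sub>E UNIV \<and> u - (\<Sum>b\<in>B. const (c b) * b) \<in> W"
  proof (rule ex_ex1I)
    show "\<exists>c. c \<in> B \<rightarrow>\<^sub>E UNIV \<and> u - (\<Sum>b\<in>B. const (c b) * b) \<in> W"
      using c by (intro exI[of _ "restrict c B"]) auto
    fix d e
    assume d: "d \<in> B \<rightarrow>\<^sub>E UNIV \<and> u - (\<Sum>b\<in>B. const (d b) * b) \<in> W"
      and e: "e \<in> B \<rightarrow>\<^sub>E UNIV \<and> u - (\<Sum>b\<in>B. const (e b) * b) \<in> W"
    have "(u - (\<Sum>b\<in>B. const (e b) * b)) - (u - (\<Sum>b\<in>B. const (d b) * b)) \<in> W"
      by (rule mpoly_vs.subspace_diff[OF W]) (use d e in auto)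
    also have "(u - (\<Sum>b\<in>B. const (e b) * b)) - (u - (\<Sum>b\<in>B. const (d b) * b))
        = (\<Sum>b\<in>B. const (d b - e b) * b)"
      by (simp add: mpoly_vs.scale_left_diff_distrib sum_subtractf)
    finally have "d b - e b = 0" if "b \<in> B" for b using that by (rule indep)
    then show "d = e" using d e by (intro PiE_ext[of d B _ e]) auto
  qed
qed (use B in auto)

lemma quotient_dim_eqI:
  fixes U W B :: "('q, 'k::field) mpoly set"
  assumes W: "mpoly_vs.subspace W" and U: "0 \<in> U" and B: "basis_mod U W B"
  shows "quotient_dim U W = card B"
proof -
  have le: "card B \<le> card C" if B: "basis_mod U W B" and C: "basis_mod U W C"
    for B C :: "('q, 'k) mpoly set"
  proof (rule ccontr)
    assume "\<not> card B \<le> card C"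
    have "\<forall>b\<in>B. \<exists>c. b - (\<Sum>j\<in>C. const (c j) * j) \<in> W"
      using B C unfolding basis_mod_def by blast
    from bchoice[OF this] obtain c where
      c: "b \<in> B \<Longrightarrow> b - (\<Sum>j\<in>C. const (c b j) * j) \<in> W" for b by blast
    have fin: "finite B" "finite C" 
      using B[unfolded basis_mod_def, THEN conjunct1] C[unfolded basis_mod_def, THEN conjunct1] .
    have "card C < card B" using \<open>\<not> card B \<le> card C\<close> by simp
    from mpoly_vs.exchange_modulo[where x = "\<lambda>b. b" and y = "\<lambda>b. b" and c = c, OF W fin this c]
    obtain l where "\<exists>i\<in>B. l i \<noteq> 0" "(\<Sum>i\<in>B. const (l i) * i) \<in> W" by blast
    then show False using basis_mod_unique_coeffs[OF W B _ _ U] by blast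
  qed
  show ?thesis
    unfolding quotient_dim_def
  proof (rule the_equality)
    show "\<exists>B'. basis_mod U W B' \<and> card B' = card B" using B by blast
    fix d assume "\<exists>B'. basis_mod U W B' \<and> card B' = d"
    then obtain B' where "basis_mod U W B'" "card B' = d" by blast
    then show "d = card B" using le B le_antisym by metis
  qed
qed


section \<open>Difference functions\<close>

text \<open>
  The composition of the one-step differences \<open>F(a) - F(a - e\<^sub>i)\<close> over \<open>i \<in> T\<close>; it interpolates between a single
  step, \<open>T = {i}\<close>, and the full difference function, \<open>T = UNIV\<close>.
\<close>

definition partial_difference :: "'q::finite set \<Rightarrow> (int ^ 'q \<Rightarrow> int) \<Rightarrow> int ^ 'q \<Rightarrow> int" where
  "partial_difference T F a = (\<Sum>S\<in>Pow T. (- 1) ^ card S * F (a - (\<Sum>i\<in>S. axis i 1)))"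

lemma difference_eq_partial:
  fixes F :: "int ^ 'q::finite \<Rightarrow> int"
  shows "difference F = partial_difference UNIV F"
proof
  fix a :: "int ^ 'q"
  let ?f = "\<lambda>S. (- 1) ^ card S * F (a - (\<Sum>i\<in>S. axis i 1))"
  have "partial_difference UNIV F a = (\<Sum>p\<in>card ` (UNIV :: 'q set set). \<Sum>S\<in>{S. card S = p}. ?f S)"
    unfolding partial_difference_def by (simp add: sum.image_gen[of UNIV ?f card])
  also have "card ` (UNIV :: 'q set set) = {0..CARD('q)}"
  proof (intro equalityI subsetI)
    fix p assume "p \<in> {0..CARD('q)}"
    then obtain T :: "'q set" where "card T = p"
      using obtain_subset_with_card_n[of p "UNIV :: 'q set"] by auto
    then show "p \<in> card ` (UNIV :: 'q set set)" by auto
  qed (auto intro!: card_mono)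
  also have "(\<Sum>p\<in>{0..CARD('q)}. \<Sum>S\<in>{S. card S = p}. ?f S)
      = F a + (\<Sum>p = 1..CARD('q). \<Sum>S\<in>{S. card S = p}. ?f S)"
    by (subst sum.atLeast_Suc_atMost) (simp_all add: card_eq_0_iff)
  also have "(\<Sum>p = 1..CARD('q). \<Sum>S\<in>{S. card S = p}. ?f S) =
      (\<Sum>p = 1..CARD('q). (- 1) ^ p * (\<Sum>T\<in>{T. card T = p}. F (a - (\<Sum>i\<in>T. axis i 1))))"
    by (intro sum.cong) (simp_all add: sum_distrib_left)
  finally show "difference F a = partial_difference UNIV F a"
    by (simp add: difference_def)
qed

lemma partial_difference_insert:
  fixes F :: "int ^ 'q::finite \<Rightarrow> int"
  assumes "j \<notin> T"
  shows "partial_difference (insert j T) F a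
    = partial_difference T F a - partial_difference T F (a - axis j 1)"
proof -
  let ?f = "\<lambda>a S. (- 1) ^ card S * F (a - (\<Sum>i\<in>S. axis i 1))"
  have "partial_difference (insert j T) F a = (\<Sum>S\<in>Pow T. ?f a S) + (\<Sum>S\<in>insert j ` Pow T. ?f a S)"
    unfolding partial_difference_def Pow_insert using assms by (intro sum.union_disjoint) auto
  also have "(\<Sum>S\<in>insert j ` Pow T. ?f a S) = (\<Sum>S\<in>Pow T. ?f a (insert j S))"
    using assms by (subst sum.reindex) (auto simp: inj_on_def)
  also have "\<dots> = (\<Sum>S\<in>Pow T. - ?f (a - axis j 1) S)"
  proof (rule sum.cong[OF refl])
    fix S assume "S \<in> Pow T"
    then have "j \<notin> S" using assms by auto
    then show "?f a (insert j S) = - ?f (a - axis j 1) S"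
      by (simp add: algebra_simps)
  qed
  finally show ?thesis by (simp add: partial_difference_def sum_negf)
qed

text \<open>
  The factor for \<open>i\<close> already vanishes at all points that enter, since shifting in other directions does not
  change the \<open>i\<close>-th coordinate.
\<close>

lemma partial_difference_vanishes:
  fixes F :: "int ^ 'q::finite \<Rightarrow> int"
  assumes stable: "\<And>a. r \<le> a $ i \<Longrightarrow> F (a + axis i 1) = F a" and a: "r < a $ i" and i: "i \<in> T"
  shows "partial_difference T F a = 0"
proof -
  have "partial_difference (insert i S) F a = 0" if "finite S" "i \<notin> S" "r < a $ i" for S a
    using that
  proof (induction S arbitrary: a rule: finite_induct)
    case empty
    have "F (a - axis i 1 + axis i 1) = F (a - axis i 1)"
      using empty by (intro stable) (simp add: axis_def)
    then show ?case by (simp add: partial_difference_insert) (simp add: partial_difference_def)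
  next
    case (insert j S)
    have "partial_difference (insert j (insert i S)) F a = 0"
      using insert by (subst partial_difference_insert) (auto simp: axis_def)
    then show ?case by (simp add: insert_commute)
  qed
  from this[of "T - {i}" a] a i show ?thesis by (simp add: insert_absorb)
qed

lemma partial_difference_outside:
  fixes F :: "int ^ 'q::finite \<Rightarrow> int"
  assumes F0: "\<And>a. \<not> 0 \<le> a \<Longrightarrow> F a = 0" and a: "a $ j < 0"
  shows "partial_difference T F a = 0"
proof -
  have "F (a - (\<Sum>i\<in>R. axis i 1)) = 0" for R
  proof (rule F0)
    have "(\<Sum>i\<in>R. axis i (1::int)) $ j \<ge> 0" by (auto simp: axis_def intro!: sum_nonneg)
    then have "(a - (\<Sum>i\<in>R. axis i 1)) $ j < 0" using a by simp
    then show "\<not> 0 \<le> a - (\<Sum>i\<in>R. axis i 1)" unfolding less_eq_vec_def by (auto simp: not_le)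
  qed
  then show ?thesis by (simp add: partial_difference_def)
qed

text \<open>
  The difference function determines \<open>F\<close> by summation, one direction \<open>j \<noteq> i\<close> at a time: if a difference in
  direction \<open>j\<close> vanishes, the function is unchanged by shifts along \<open>j\<close>, and far enough along it is zero.
\<close>

lemma stable_of_difference_vanishes:
  fixes F :: "int ^ 'q::finite \<Rightarrow> int"
  assumes F0: "\<And>a. \<not> 0 \<le> a \<Longrightarrow> F a = 0"
    and vanish: "\<And>a. r < a $ i \<Longrightarrow> difference F a = 0" and a: "r < a $ i"
  shows "F a = F (a - axis i 1)"
proof -
  have descend: "\<forall>a. r < a $ i \<longrightarrow> partial_difference (insert i S) F a = 0"
    if "finite T" "i \<notin> S" "i \<notin> T" "T \<inter> S = {}"
      "\<forall>a. r < a $ i \<longrightarrow> partial_difference (insert i (S \<union> T)) F a = 0" for S T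
    using that
  proof (induction T arbitrary: S rule: finite_induct)
    case (insert j T)
    have shift: "insert j S \<union> T = S \<union> insert j T" by auto
    have upper: "\<forall>a. r < a $ i \<longrightarrow> partial_difference (insert i (insert j S)) F a = 0"
      by (rule insert.IH) (use insert.prems(1-3) insert.hyps insert.prems(4)[folded shift] in \<open>assumption | blast\<close>)+
    have jS: "j \<notin> insert i S" using insert.prems by auto
    have step: "partial_difference (insert i S) F a = partial_difference (insert i S) F (a - axis j 1)"
      if "r < a $ i" for a
      using upper that partial_difference_insert[OF jS, of F a] by (simp add: insert_commute)
    show ?case
    proof (intro allI impI)
      fix a assume ra: "r < a $ i"
      have iter: "partial_difference (insert i S) F a
          = partial_difference (insert i S) F (a - axis j (int N))" for N
      proof (induction N)
        case (Suc N)
        have "i \<noteq> j" using jS by auto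
        then have "r < (a - axis j (int N)) $ i" using ra by (simp add: axis_def)
        from step[OF this] Suc show ?case by (simp add: axis_add algebra_simps)
      next
        case 0
        have "axis j (int 0) = (0 :: int ^ 'q)" by (simp add: axis_eq_0_iff)
        then show ?case by (simp only: diff_0_right)
      qed
      have "(a - axis j (int (nat (a $ j + 1)))) $ j < 0"
        by (simp add: axis_def)
      from partial_difference_outside[OF F0 this] show "partial_difference (insert i S) F a = 0"
        by (subst iter[of "nat (a $ j + 1)"])
    qed
  qed simp
  have "\<forall>a. r < a $ i \<longrightarrow> partial_difference (insert i {}) F a = 0"
  proof (rule descend[of "- {i}"])
    have "insert i ({} \<union> - {i}) = UNIV" by auto
    then show "\<forall>a. r < a $ i \<longrightarrow> partial_difference (insert i ({} \<union> - {i})) F a = 0"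
      using vanish by (simp only: difference_eq_partial) simp
  qed auto
  then show ?thesis
    using a by (simp add: partial_difference_insert) (simp add: partial_difference_def)
qed


section \<open>Leading monomials\<close>

definition var_enum :: "nat \<Rightarrow> 'q::finite \<times> nat" where
  "var_enum = from_nat_into UNIV"

lemma bij_var_enum: "bij (var_enum :: nat \<Rightarrow> 'q::finite \<times> nat)"
proof -
  have "infinite (UNIV :: ('q \<times> nat) set)" by (simp add: finite_prod)
  then show ?thesis
    unfolding var_enum_def by (intro bij_betw_from_nat_into) auto
qed

text \<open>
  Monomials are ordered through an enumeration of the variables, which carries them to finitely supported functions
  on \<open>nat\<close> with their lexicographic order.
\<close>

definition lex_rank :: "'q::finite monomial \<Rightarrow> nat \<Rightarrow>\<^sub>0 nat" where
  "lex_rank m = Poly_Mapping.map_key var_enum m"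

lemma lookup_lex_rank: "Poly_Mapping.lookup (lex_rank m) k = Poly_Mapping.lookup m (var_enum k)"
  unfolding lex_rank_def map_key.rep_eq[OF bij_is_inj[OF bij_var_enum]] by simp

lemma lex_rank_add: "lex_rank (m + m') = lex_rank m + lex_rank m'"
  by (rule poly_mapping_eqI) (simp add: lookup_lex_rank lookup_add)

lemma lex_rank_inj:
  fixes m m' :: "'q::finite monomial"
  shows "lex_rank m = lex_rank m' \<longleftrightarrow> m = m'"
proof
  assume eq: "lex_rank m = lex_rank m'"
  show "m = m'"
  proof (rule poly_mapping_eqI)
    fix v :: "'q \<times> nat"
    obtain k where "v = var_enum k" using bij_is_surj[OF bij_var_enum] by (metis surjD)
    then show "Poly_Mapping.lookup m v = Poly_Mapping.lookup m' v"
      using eq by (metis lookup_lex_rank)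
  qed
qed simp

lemma lex_rank_0 [simp]: "lex_rank 0 = 0"
  by (rule poly_mapping_eqI) (simp add: lookup_lex_rank)

lemma lex_rank_pos: "m \<noteq> 0 \<Longrightarrow> 0 < lex_rank m"
proof -
  assume "m \<noteq> 0"
  then have "lex_rank m \<noteq> 0" by (metis lex_rank_0 lex_rank_inj)
  moreover have "\<not> lex_rank m < 0" by (simp add: less_poly_mapping.rep_eq less_fun_def)
  ultimately show "0 < lex_rank m" by (metis not_less_iff_gr_or_eq)
qed

definition is_leading :: "'q::finite monomial \<Rightarrow> ('q, 'k::zero) mpoly \<Rightarrow> bool" where
  "is_leading m p \<longleftrightarrow> m \<in> Poly_Mapping.keys p \<and> (\<forall>m'\<in>Poly_Mapping.keys p. lex_rank m' \<le> lex_rank m)"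

lemma leading_exists:
  assumes "p \<noteq> 0"
  obtains m where "is_leading m p"
proof -
  have "finite (lex_rank ` Poly_Mapping.keys p)" "lex_rank ` Poly_Mapping.keys p \<noteq> {}"
    using assms by auto
  then have "Max (lex_rank ` Poly_Mapping.keys p) \<in> lex_rank ` Poly_Mapping.keys p" by (rule Max_in)
  then obtain m where m: "m \<in> Poly_Mapping.keys p" "Max (lex_rank ` Poly_Mapping.keys p) = lex_rank m" by blast
  then have "is_leading m p"
    unfolding is_leading_def using Max_ge[of "lex_rank ` Poly_Mapping.keys p"] by force
  then show ?thesis by (rule that)
qed

text \<open>
  No other pair of monomials contributes to this coefficient, since the order is strictly compatible with addition.
\<close>

lemma lookup_mult_leading:
  fixes p q :: "('q::finite, 'k::comm_ring_1) mpoly"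
  assumes m: "is_leading m p" and m': "is_leading m' q"
  shows "Poly_Mapping.lookup (p * q) (m + m') = Poly_Mapping.lookup p m * Poly_Mapping.lookup q m'"
proof -
  let ?t = "\<lambda>a b. Poly_Mapping.single (a + b) (Poly_Mapping.lookup p a * Poly_Mapping.lookup q b)"
  have "p * q = (\<Sum>a\<in>Poly_Mapping.keys p. Poly_Mapping.single a (Poly_Mapping.lookup p a)) *
      (\<Sum>b\<in>Poly_Mapping.keys q. Poly_Mapping.single b (Poly_Mapping.lookup q b))"
    by (simp flip: poly_mapping_sum_single)
  also have "\<dots> = (\<Sum>a\<in>Poly_Mapping.keys p. \<Sum>b\<in>Poly_Mapping.keys q. ?t a b)"
    by (simp add: sum_product mult_single)
  finally have "Poly_Mapping.lookup (p * q) (m + m') =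
      (\<Sum>a\<in>Poly_Mapping.keys p. \<Sum>b\<in>Poly_Mapping.keys q. Poly_Mapping.lookup (?t a b) (m + m'))"
    by (simp add: lookup_sum)
  also have "\<dots> = (\<Sum>a\<in>Poly_Mapping.keys p. \<Sum>b\<in>Poly_Mapping.keys q.
      if a = m then (if b = m' then Poly_Mapping.lookup p m * Poly_Mapping.lookup q m' else 0) else 0)"
  proof (intro sum.cong refl)
    fix a b assume a: "a \<in> Poly_Mapping.keys p" and b: "b \<in> Poly_Mapping.keys q"
    have le: "lex_rank a \<le> lex_rank m" "lex_rank b \<le> lex_rank m'"
      using a b m m' by (auto simp: is_leading_def)
    have "a + b \<noteq> m + m'" if "a \<noteq> m \<or> b \<noteq> m'"
    proof
      assume "a + b = m + m'"
      then have eq: "lex_rank a + lex_rank b = lex_rank m + lex_rank m'" by (metis lex_rank_add)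
      have "lex_rank a < lex_rank m \<or> lex_rank b < lex_rank m'"
        using that le lex_rank_inj by (metis order_le_less)
      then have "lex_rank a + lex_rank b < lex_rank m + lex_rank m'"
        using le by (metis add_less_le_mono add_le_less_mono)
      then show False using eq by simp
    qed
    then show "Poly_Mapping.lookup (?t a b) (m + m') =
        (if a = m then (if b = m' then Poly_Mapping.lookup p m * Poly_Mapping.lookup q m' else 0) else 0)"
      by (auto simp: lookup_single when_def)
  qed
  also have "\<dots> = Poly_Mapping.lookup p m * Poly_Mapping.lookup q m'"
    using m m' by (simp add: is_leading_def if_distrib[of "\<lambda>f. sum f _"] sum.If_cases)
  finally show ?thesis .
qed

lemma mpoly_mult_nonzero:
  fixes p q :: "('q::finite, 'k::field) mpoly"
  assumes "p \<noteq> 0" "q \<noteq> 0"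
  shows "p * q \<noteq> 0"
proof -
  obtain m m' where m: "is_leading m p" "is_leading m' q"
    using assms leading_exists by metis
  then have "Poly_Mapping.lookup p m \<noteq> 0" "Poly_Mapping.lookup q m' \<noteq> 0"
    by (auto simp: is_leading_def in_keys_iff)
  then have "Poly_Mapping.lookup (p * q) (m + m') \<noteq> 0" by (simp add: lookup_mult_leading[OF m])
  then show ?thesis by auto
qed

lemma mpoly_prod_nonzero:
  fixes f :: "'a \<Rightarrow> ('q::finite, 'k::field) mpoly"
  shows "(\<And>a. a \<in> A \<Longrightarrow> f a \<noteq> 0) \<Longrightarrow> prod f A \<noteq> 0"
  by (induction A rule: infinite_finite_induct) (simp_all add: mpoly_mult_nonzero)

lemma lookup_var_mult_0:
  fixes f :: "('q, 'k::comm_ring_1) mpoly"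
  shows "Poly_Mapping.lookup (var x * f) 0 = 0"
proof (rule ccontr)
  assume "Poly_Mapping.lookup (var x * f) 0 \<noteq> 0"
  then have "0 \<in> Poly_Mapping.keys (var x * f)" by (simp add: in_keys_iff)
  then obtain a b where ab: "0 = a + b" "a \<in> Poly_Mapping.keys (var x :: ('q, 'k) mpoly)" using keys_mult by blast
  then have "a = Poly_Mapping.single x 1" by (simp add: var_def split: if_splits)
  then have "Poly_Mapping.lookup (a + b) x \<noteq> 0" by (simp add: lookup_add)
  then show False using ab(1) by (metis lookup_zero)
qed

lemma one_plus_var_mult_nonzero: "1 + var x * f \<noteq> (0 :: ('q, 'k::comm_ring_1) mpoly)"
proof
  assume "1 + var x * f = 0"
  then have "Poly_Mapping.lookup (1 + var x * f) 0 = 0" by simp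
  then show False by (simp add: lookup_add lookup_var_mult_0)
qed

text \<open>
  The leading monomial of \<open>(1 + x f) g\<close> is that of \<open>x f g\<close>, which is divisible by \<open>x\<close>.
\<close>

lemma one_plus_var_mult_not_unit:
  fixes f :: "('q::finite, 'k::field) mpoly"
  assumes "f \<noteq> 0"
  shows "\<not> 1 + var x * f dvd 1"
proof
  assume "1 + var x * f dvd 1"
  then obtain g where g: "1 = (1 + var x * f) * g" by (rule dvdE)
  have "Poly_Mapping.lookup (var x :: ('q, 'k) mpoly) (Poly_Mapping.single x 1) = 1"
    by (simp add: var_def)
  then have "var x \<noteq> (0 :: ('q, 'k) mpoly)" by auto
  then have nz: "var x * f \<noteq> 0" using assms by (rule mpoly_mult_nonzero)
  then obtain m where m: "is_leading m (var x * f)" by (rule leading_exists)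
  have "g \<noteq> 0" using g by auto
  then obtain m' where m': "is_leading m' g" by (rule leading_exists)
  have m0: "m \<noteq> 0" using m lookup_var_mult_0[of x f] by (auto simp: is_leading_def in_keys_iff)
  then have rank: "lex_rank m' < lex_rank (m + m')"
    using add_strict_right_mono[OF lex_rank_pos[OF m0], of "lex_rank m'"] by (simp add: lex_rank_add)
  then have "Poly_Mapping.lookup g (m + m') = 0"
    using m' by (force simp: is_leading_def in_keys_iff)
  moreover have "m + m' \<noteq> 0"
  proof
    assume "m + m' = 0"
    then have "lex_rank m' < 0" using rank by simp
    then show False by (simp add: less_poly_mapping.rep_eq less_fun_def)
  qed
  then have "Poly_Mapping.lookup (1 :: ('q, 'k) mpoly) (m + m') = 0"
    by (simp add: lookup_one when_def)
  moreover have "1 = g + var x * f * g" using g by (simp add: distrib_right)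
  then have "Poly_Mapping.lookup 1 (m + m') = Poly_Mapping.lookup g (m + m') +
      Poly_Mapping.lookup (var x * f * g) (m + m')"
    by (metis lookup_add)
  ultimately have "Poly_Mapping.lookup (var x * f) m * Poly_Mapping.lookup g m' = 0"
    by (simp add: lookup_mult_leading[OF m m'])
  then show False using m m' by (auto simp: is_leading_def in_keys_iff)
qed


section \<open>Prime ideals\<close>

lemma ideal_extend:
  fixes P :: "('q, 'k::comm_ring_1) mpoly set"
  assumes P: "ideal P (subring_of (polys_in V))" and a: "a \<in> polys_in V"
  shows "ideal {p + a * h |p h. p \<in> P \<and> h \<in> polys_in V} (subring_of (polys_in V))" (is "ideal ?Q _")
    and "P \<subseteq> {p + a * h |p h. p \<in> P \<and> h \<in> polys_in V}"
    and "a \<in> {p + a * h |p h. p \<in> P \<and> h \<in> polys_in V}"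
proof -
  have Pi: "P \<subseteq> polys_in V" "0 \<in> P" "\<And>p q. p \<in> P \<Longrightarrow> q \<in> P \<Longrightarrow> p + q \<in> P"
    "\<And>p h. p \<in> P \<Longrightarrow> h \<in> polys_in V \<Longrightarrow> h * p \<in> P"
    using P unfolding ideal_polys_in_iff by blast+
  show PQ: "P \<subseteq> ?Q"
  proof
    fix p assume "p \<in> P"
    then have "p = p + a * 0 \<and> p \<in> P \<and> 0 \<in> polys_in V" by simp
    then show "p \<in> ?Q" by blast
  qed
  show "a \<in> ?Q"
  proof -
    have "a = 0 + a * 1 \<and> 0 \<in> P \<and> 1 \<in> polys_in V" using Pi(2) by simp
    then show ?thesis by blast
  qed
  show "ideal ?Q (subring_of (polys_in V))"
    unfolding ideal_polys_in_iff
  proof (intro conjI ballI)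
    show "?Q \<subseteq> polys_in V" using Pi(1) a by (auto intro!: polys_in_add polys_in_mult)
    show "0 \<in> ?Q" using PQ Pi(2) by blast
    fix u assume "u \<in> ?Q"
    then obtain p h where u: "u = p + a * h" "p \<in> P" "h \<in> polys_in V" by blast
    show "u + v \<in> ?Q" if v: "v \<in> ?Q" for v
    proof -
      from v obtain p' h' where v': "v = p' + a * h'" "p' \<in> P" "h' \<in> polys_in V" by blast
      have "u + v = (p + p') + a * (h + h')" using u v' by (simp add: algebra_simps)
      moreover have "p + p' \<in> P" "h + h' \<in> polys_in V" using u v' Pi(3) polys_in_add by blast+
      ultimately show ?thesis by blast
    qed
    show "r * u \<in> ?Q" if r: "r \<in> polys_in V" for r
    proof -
      have "r * u = r * p + a * (r * h)" using u by (simp add: algebra_simps)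
      moreover have "r * p \<in> P" "r * h \<in> polys_in V" using u r Pi(4) polys_in_mult by blast+
      ultimately show ?thesis by blast
    qed
  qed
qed

text \<open>
  By Zorn's lemma there is a maximal ideal among those disjoint from the multiplicative set \<open>S\<close>.  It is prime: if
  neither \<open>a\<close> nor \<open>b\<close> belongs to it, adjoining either of them yields an element of \<open>S\<close>, and the product of these
  elements would lie in \<open>S\<close> and in the ideal if \<open>a b\<close> did.
\<close>

lemma prime_ideal_avoiding:
  fixes I :: "('q, 'k::comm_ring_1) mpoly set"
  assumes I: "ideal I (subring_of (polys_in V))" and S1: "1 \<in> S"
    and Smult: "\<And>s t. s \<in> S \<Longrightarrow> t \<in> S \<Longrightarrow> s * t \<in> S" and disj: "I \<inter> S = {}"
  obtains P where "primeideal P (subring_of (polys_in V))" "I \<subseteq> P" "P \<inter> S = {}"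
proof -
  let ?A = "{Q. ideal Q (subring_of (polys_in V)) \<and> I \<subseteq> Q \<and> Q \<inter> S = {}}"
  have "\<exists>M\<in>?A. \<forall>Q\<in>?A. M \<subseteq> Q \<longrightarrow> Q = M"
  proof (rule subset_Zorn_nonempty)
    show "?A \<noteq> {}" using I disj by blast
    fix C assume C0: "C \<noteq> {}" and C: "subset.chain ?A C"
    have CA: "C \<subseteq> ?A" using C by (simp add: subset_chain_def)
    have tot: "Q \<subseteq> R \<or> R \<subseteq> Q" if "Q \<in> C" "R \<in> C" for Q R
      using C that by (auto simp: subset_chain_def)
    have Ci: "Q \<subseteq> polys_in V" "0 \<in> Q" "\<And>p q. p \<in> Q \<Longrightarrow> q \<in> Q \<Longrightarrow> p + q \<in> Q"
      "\<And>p h. p \<in> Q \<Longrightarrow> h \<in> polys_in V \<Longrightarrow> h * p \<in> Q" if "Q \<in> C" for Q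
      using CA that unfolding ideal_polys_in_iff by blast+
    have "ideal (\<Union>C) (subring_of (polys_in V))"
      unfolding ideal_polys_in_iff
    proof (intro conjI ballI)
      show "\<Union>C \<subseteq> polys_in V" using Ci(1) by blast
      show "0 \<in> \<Union>C" using C0 Ci(2) by blast
      fix p assume "p \<in> \<Union>C"
      then obtain Q where Q: "Q \<in> C" "p \<in> Q" by blast
      show "p + q \<in> \<Union>C" if "q \<in> \<Union>C" for q
      proof -
        from that obtain R where R: "R \<in> C" "q \<in> R" by blast
        from tot[OF Q(1) R(1)] show ?thesis
        proof
          assume "Q \<subseteq> R"
          then show ?thesis using Ci(3)[OF R(1)] Q R by blast
        next
          assume "R \<subseteq> Q"
          then show ?thesis using Ci(3)[OF Q(1)] Q R by blast
        qed
      qed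
      show "h * p \<in> \<Union>C" if "h \<in> polys_in V" for h using Ci(4)[OF Q(1)] Q that by blast
    qed
    moreover have "I \<subseteq> \<Union>C" using C0 CA by blast
    moreover have "\<Union>C \<inter> S = {}" using CA by blast
    ultimately show "\<Union>C \<in> ?A" by blast
  qed
  then obtain P where PA: "P \<in> ?A" and Pmax: "\<forall>Q\<in>?A. P \<subseteq> Q \<longrightarrow> Q = P" by (rule bexE)
  have P: "ideal P (subring_of (polys_in V))" "I \<subseteq> P" "P \<inter> S = {}" using PA by simp_all
  have max: "Q = P" if "ideal Q (subring_of (polys_in V))" "P \<subseteq> Q" "Q \<inter> S = {}" for Q
  proof -
    have "Q \<in> ?A" using that P(2) by simp
    with Pmax that(2) show ?thesis by simp
  qed
  have Pi: "P \<subseteq> polys_in V" "0 \<in> P" "\<And>p q. p \<in> P \<Longrightarrow> q \<in> P \<Longrightarrow> p + q \<in> P"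
    "\<And>p h. p \<in> P \<Longrightarrow> h \<in> polys_in V \<Longrightarrow> h * p \<in> P"
    using P(1) unfolding ideal_polys_in_iff by blast+
  have meets: "\<exists>p h. p \<in> P \<and> h \<in> polys_in V \<and> p + a * h \<in> S" if a: "a \<in> polys_in V" "a \<notin> P" for a
  proof (rule ccontr)
    assume "\<not> ?thesis"
    then have "{p + a * h |p h. p \<in> P \<and> h \<in> polys_in V} \<inter> S = {}" by blast
    note max[OF ideal_extend(1,2)[OF P(1) a(1)] this]
    with ideal_extend(3)[OF P(1) a(1)] a(2) show False by simp
  qed
  have "primeideal P (subring_of (polys_in V))"
  proof (rule primeidealI[OF P(1) cring_polys_in])
    show "carrier (subring_of (polys_in V)) \<noteq> P"
      using P(3) S1 polys_in_1 by (auto simp: subring_of_def)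
    fix a b :: "('q, 'k) mpoly"
    assume "a \<in> carrier (subring_of (polys_in V))" "b \<in> carrier (subring_of (polys_in V))"
      and "a \<otimes>\<^bsub>subring_of (polys_in V)\<^esub> b \<in> P"
    then have ab: "a \<in> polys_in V" "b \<in> polys_in V" "a * b \<in> P" by (auto simp: subring_of_def)
    show "a \<in> P \<or> b \<in> P"
    proof (rule ccontr)
      assume not: "\<not> (a \<in> P \<or> b \<in> P)"
      obtain p h where 1: "p \<in> P" "h \<in> polys_in V" "p + a * h \<in> S" using meets ab not by blast
      obtain q k where 2: "q \<in> P" "k \<in> polys_in V" "q + b * k \<in> S" using meets ab not by blast
      have "(p + a * h) * (q + b * k) = (q + b * k) * p + ((a * h) * q + (h * k) * (a * b))"
        by (simp add: algebra_simps)
      moreover have "(q + b * k) * p \<in> P"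
        using 1 2 ab Pi by (intro Pi(4) polys_in_add polys_in_mult) auto
      moreover have "(a * h) * q \<in> P" "(h * k) * (a * b) \<in> P"
        using 1 2 ab by (auto intro!: Pi(4) polys_in_mult)
      ultimately have "(p + a * h) * (q + b * k) \<in> P" using Pi(3) by presburger
      then show False using Smult[OF 1(3) 2(3)] P(3) by blast
    qed
  qed
  then show ?thesis using that P by blast
qed


section \<open>Reduction modulo an ideal\<close>

text \<open>
  For a subring \<open>A\<close> and an ideal \<open>P\<close> this is the \<open>A\<close>-module generated by \<open>B\<close> and \<open>P\<close>.
\<close>

definition span_over :: "('q, 'k::comm_ring_1) mpoly set \<Rightarrow> ('q, 'k) mpoly set \<Rightarrow> ('q, 'k) mpoly set \<Rightarrow>
    ('q, 'k) mpoly set" where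
  "span_over A B P = {u. \<exists>c. (\<forall>b\<in>B. c b \<in> A) \<and> u - (\<Sum>b\<in>B. c b * b) \<in> P}"

lemma span_overI: "(\<And>b. b \<in> B \<Longrightarrow> c b \<in> A) \<Longrightarrow> u - (\<Sum>b\<in>B. c b * b) \<in> P \<Longrightarrow> u \<in> span_over A B P"
  unfolding span_over_def by blast

lemma span_overE:
  assumes "u \<in> span_over A B P"
  obtains c where "\<forall>b\<in>B. c b \<in> A" "u - (\<Sum>b\<in>B. c b * b) \<in> P"
proof -
  from assms obtain c where "(\<forall>b\<in>B. c b \<in> A) \<and> u - (\<Sum>b\<in>B. c b * b) \<in> P"
    unfolding span_over_def by (elim CollectE exE)
  then show ?thesis by (intro that[of c]) simp_all
qed

lemma span_over_mult_in:
  fixes u :: "('q, 'k::comm_ring_1) mpoly"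
  assumes u: "u \<in> span_over A B P" and B: "\<And>b. b \<in> B \<Longrightarrow> d * b \<in> N"
    and N: "0 \<in> N" "\<And>x y. x \<in> N \<Longrightarrow> y \<in> N \<Longrightarrow> x + y \<in> N" "\<And>a x. a \<in> A \<Longrightarrow> x \<in> N \<Longrightarrow> a * x \<in> N"
    and P: "\<And>p. p \<in> P \<Longrightarrow> d * p \<in> N"
  shows "d * u \<in> N"
proof -
  obtain c where c: "\<forall>b\<in>B. c b \<in> A" "u - (\<Sum>b\<in>B. c b * b) \<in> P" using u by (rule span_overE)
  have "(\<Sum>b\<in>C. c b * (d * b)) \<in> N" if "C \<subseteq> B" for C
    using that by (induction C rule: infinite_finite_induct) (auto intro!: N B c(1)[rule_format])
  then have "d * (u - (\<Sum>b\<in>B. c b * b)) + (\<Sum>b\<in>B. c b * (d * b)) \<in> N"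
    by (intro N(2) P c) auto
  also have "d * (u - (\<Sum>b\<in>B. c b * b)) + (\<Sum>b\<in>B. c b * (d * b)) = d * u"
    by (simp add: right_diff_distrib sum_distrib_left mult.left_commute)
  finally show ?thesis .
qed

lemma span_over_closed:
  fixes P :: "('q, 'k::comm_ring_1) mpoly set"
  assumes P: "ideal P (subring_of (polys_in V))" and T: "T \<subseteq> V"
  shows "P \<subseteq> span_over (polys_in T) B P"
    and "x \<in> span_over (polys_in T) B P \<Longrightarrow> y \<in> span_over (polys_in T) B P \<Longrightarrow>
      x + y \<in> span_over (polys_in T) B P"
    and "a \<in> polys_in T \<Longrightarrow> x \<in> span_over (polys_in T) B P \<Longrightarrow> a * x \<in> span_over (polys_in T) B P"
    and "finite B \<Longrightarrow> B \<subseteq> span_over (polys_in T) B P"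
proof -
  have Pi: "0 \<in> P" "\<And>p q. p \<in> P \<Longrightarrow> q \<in> P \<Longrightarrow> p + q \<in> P"
    "\<And>p h. p \<in> P \<Longrightarrow> h \<in> polys_in V \<Longrightarrow> h * p \<in> P"
    using P unfolding ideal_polys_in_iff by blast+
  have TV: "polys_in T \<subseteq> polys_in V" using T by (auto simp: polys_in_def)
  show "P \<subseteq> span_over (polys_in T) B P"
  proof
    fix p assume "p \<in> P"
    then show "p \<in> span_over (polys_in T) B P" by (intro span_overI[of _ "\<lambda>_. 0"]) auto
  qed
  show "x + y \<in> span_over (polys_in T) B P"
    if x: "x \<in> span_over (polys_in T) B P" and y: "y \<in> span_over (polys_in T) B P"
  proof -
    obtain c where c: "\<forall>b\<in>B. c b \<in> polys_in T" "x - (\<Sum>b\<in>B. c b * b) \<in> P"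
      using x by (rule span_overE)
    obtain d where d: "\<forall>b\<in>B. d b \<in> polys_in T" "y - (\<Sum>b\<in>B. d b * b) \<in> P"
      using y by (rule span_overE)
    show ?thesis
    proof (rule span_overI)
      show "c b + d b \<in> polys_in T" if "b \<in> B" for b using c(1) d(1) that by (simp add: polys_in_add)
      have "x + y - (\<Sum>b\<in>B. (c b + d b) * b) = (x - (\<Sum>b\<in>B. c b * b)) + (y - (\<Sum>b\<in>B. d b * b))"
        by (simp add: distrib_right sum.distrib)
      then show "x + y - (\<Sum>b\<in>B. (c b + d b) * b) \<in> P" using Pi(2)[OF c(2) d(2)] by (simp only:)
    qed
  qed
  show "a * x \<in> span_over (polys_in T) B P" if a: "a \<in> polys_in T" and x: "x \<in> span_over (polys_in T) B P"
  proof -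
    obtain c where c: "\<forall>b\<in>B. c b \<in> polys_in T" "x - (\<Sum>b\<in>B. c b * b) \<in> P"
      using x by (rule span_overE)
    show ?thesis
    proof (rule span_overI)
      show "a * c b \<in> polys_in T" if "b \<in> B" for b using c(1) a that by (simp add: polys_in_mult)
      have "a * x - (\<Sum>b\<in>B. a * c b * b) = a * (x - (\<Sum>b\<in>B. c b * b))"
        by (simp add: right_diff_distrib sum_distrib_left mult.assoc)
      then show "a * x - (\<Sum>b\<in>B. a * c b * b) \<in> P" using Pi(3)[OF c(2)] a TV by auto
    qed
  qed
  show "B \<subseteq> span_over (polys_in T) B P" if "finite B"
  proof
    fix b assume b: "b \<in> B"
    show "b \<in> span_over (polys_in T) B P"
    proof (rule span_overI)
      show "(if b' = b then 1 else 0) \<in> polys_in T" for b' by simp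
      have "(\<Sum>b'\<in>B. (if b' = b then 1 else 0) * b') = b"
        using that b by (simp add: if_distrib[of "\<lambda>z. z * _"] sum.delta cong: if_cong)
      then show "b - (\<Sum>b'\<in>B. (if b' = b then 1 else 0) * b') \<in> P" using Pi(1) by simp
    qed
  qed
qed

lemma single_eq_const_mult_prod:
  fixes c :: "'k::comm_ring_1" and m :: "'q monomial"
  shows "Poly_Mapping.single m c = const c * (\<Prod>v\<in>Poly_Mapping.keys m. var v ^ Poly_Mapping.lookup m v)"
proof -
  have "(\<Prod>v\<in>Poly_Mapping.keys m. var v ^ Poly_Mapping.lookup m v) =
      (Poly_Mapping.single (\<Sum>v\<in>Poly_Mapping.keys m. Poly_Mapping.single v (Poly_Mapping.lookup m v)) 1 :: ('q, 'k) mpoly)"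
    unfolding var_power by (rule prod_single)
  also have "(\<Sum>v\<in>Poly_Mapping.keys m. Poly_Mapping.single v (Poly_Mapping.lookup m v)) = m"
    by (rule poly_mapping_sum_single[symmetric])
  finally show ?thesis by (simp add: const_def mult_single)
qed

lemma polys_in_induct [consumes 1, case_names const add var]:
  fixes p :: "('q, 'k::comm_ring_1) mpoly"
  assumes p: "p \<in> polys_in V" and const: "\<And>c. Q (const c)"
    and add: "\<And>p q. p \<in> polys_in V \<Longrightarrow> q \<in> polys_in V \<Longrightarrow> Q p \<Longrightarrow> Q q \<Longrightarrow> Q (p + q)"
    and var: "\<And>v p. v \<in> V \<Longrightarrow> p \<in> polys_in V \<Longrightarrow> Q p \<Longrightarrow> Q (var v * p)"
  shows "Q p"
proof -
  have const_in: "const c \<in> polys_in V" for c :: 'k by (auto simp: const_def polys_in_def)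
  have pow: "var v ^ k * u \<in> polys_in V \<and> Q (var v ^ k * u)" if "v \<in> V" "u \<in> polys_in V \<and> Q u" for v k u
    using that by (induction k) (auto simp: mult.assoc intro!: var polys_in_mult polys_in_var)
  have mono: "(\<Prod>v\<in>K. var v ^ e v) * const c \<in> polys_in V \<and> Q ((\<Prod>v\<in>K. var v ^ e v) * const c)"
    if "finite K" "K \<subseteq> V" for K c and e :: "_ \<Rightarrow> nat"
    using that
  proof (induction K rule: finite_induct)
    case empty
    then show ?case using const const_in by simp
  next
    case (insert v K)
    then show ?case using pow[of v "(\<Prod>v\<in>K. var v ^ e v) * const c" "e v"] by (simp add: mult.assoc)
  qed
  have single: "Poly_Mapping.single m c \<in> polys_in V \<and> Q (Poly_Mapping.single m c)"
    if "m \<in> Poly_Mapping.keys p" for m c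
    using mono[of "Poly_Mapping.keys m" "Poly_Mapping.lookup m" c] p that
    by (auto simp: single_eq_const_mult_prod mult.commute polys_in_def)
  have "(\<Sum>m\<in>K. Poly_Mapping.single m (Poly_Mapping.lookup p m)) \<in> polys_in V \<and>
      Q (\<Sum>m\<in>K. Poly_Mapping.single m (Poly_Mapping.lookup p m))"
    if "finite K" "K \<subseteq> Poly_Mapping.keys p" for K
    using that
  proof (induction K rule: finite_induct)
    case empty
    then show ?case using const[of 0] by (simp add: const_def)
  next
    case (insert m K)
    then show ?case using single[of m "Poly_Mapping.lookup p m"] by (auto intro: add polys_in_add)
  qed
  from this[of "Poly_Mapping.keys p"] show ?thesis by (simp flip: poly_mapping_sum_single)
qed

definition coeff_in :: "'q \<times> nat \<Rightarrow> nat \<Rightarrow> ('q, 'k::comm_ring_1) mpoly \<Rightarrow> ('q, 'k) mpoly" where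
  "coeff_in y k p = (\<Sum>m\<in>{m \<in> Poly_Mapping.keys p. Poly_Mapping.lookup m y = k}.
     Poly_Mapping.single (m - Poly_Mapping.single y k) (Poly_Mapping.lookup p m))"

lemma remove_var_add:
  fixes m :: "'a \<Rightarrow>\<^sub>0 nat"
  assumes "k \<le> Poly_Mapping.lookup m y"
  shows "m - Poly_Mapping.single y k + Poly_Mapping.single y k = m"
proof (rule poly_mapping_eqI)
  fix v
  show "Poly_Mapping.lookup (m - Poly_Mapping.single y k + Poly_Mapping.single y k) v = Poly_Mapping.lookup m v"
    using assms by (cases "v = y") (simp_all add: lookup_add minus_poly_mapping.rep_eq lookup_single)
qed

lemma sum_coeff_in:
  assumes "\<And>m. m \<in> Poly_Mapping.keys p \<Longrightarrow> Poly_Mapping.lookup m y \<le> s"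
  shows "p = (\<Sum>k\<le>s. coeff_in y k p * var y ^ k)"
proof -
  have "(\<Sum>k\<le>s. coeff_in y k p * var y ^ k) =
      (\<Sum>k\<le>s. \<Sum>m\<in>{m \<in> Poly_Mapping.keys p. Poly_Mapping.lookup m y = k}. Poly_Mapping.single m (Poly_Mapping.lookup p m))"
    unfolding coeff_in_def var_power sum_distrib_right
    by (intro sum.cong refl) (auto simp: mult_single remove_var_add)
  also have "\<dots> = (\<Sum>m\<in>Poly_Mapping.keys p. Poly_Mapping.single m (Poly_Mapping.lookup p m))"
    by (rule sum.group) (use assms in auto)
  finally show ?thesis by (simp flip: poly_mapping_sum_single)
qed

lemma coeff_in_polys:
  assumes "p \<in> polys_in (insert y T)"
  shows "coeff_in y k p \<in> polys_in T"
  unfolding coeff_in_def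
proof (rule polys_in_sum)
  fix m assume m: "m \<in> {m \<in> Poly_Mapping.keys p. Poly_Mapping.lookup m y = k}"
  then have "Poly_Mapping.keys m \<subseteq> insert y T" using assms by (auto simp: polys_in_def)
  moreover have "Poly_Mapping.keys (m - Poly_Mapping.single y k) = Poly_Mapping.keys m - {y}"
    using m by (auto simp: in_keys_iff minus_poly_mapping.rep_eq lookup_single when_def split: if_splits)
  ultimately show "Poly_Mapping.single (m - Poly_Mapping.single y k) (Poly_Mapping.lookup p m) \<in> polys_in T"
    by (auto simp: polys_in_def)
qed

lemma coeff_in_nonzero:
  assumes "m \<in> Poly_Mapping.keys p"
  shows "coeff_in y (Poly_Mapping.lookup m y) p \<noteq> 0"
proof -
  let ?k = "Poly_Mapping.lookup m y"
  let ?M = "{m' \<in> Poly_Mapping.keys p. Poly_Mapping.lookup m' y = ?k}"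
  have "Poly_Mapping.lookup (coeff_in y ?k p) (m - Poly_Mapping.single y ?k)
      = (\<Sum>m'\<in>?M. if m' = m then Poly_Mapping.lookup p m else 0)"
    unfolding coeff_in_def lookup_sum
  proof (rule sum.cong[OF refl])
    fix m' assume m': "m' \<in> ?M"
    have "m' = m" if eq: "m' - Poly_Mapping.single y ?k = m - Poly_Mapping.single y ?k"
    proof -
      have "m' = m' - Poly_Mapping.single y ?k + Poly_Mapping.single y ?k"
        using m' by (intro remove_var_add[symmetric]) simp
      also have "\<dots> = m" unfolding eq by (rule remove_var_add) simp
      finally show ?thesis .
    qed
    then show "Poly_Mapping.lookup (Poly_Mapping.single (m' - Poly_Mapping.single y ?k) (Poly_Mapping.lookup p m'))
        (m - Poly_Mapping.single y ?k) = (if m' = m then Poly_Mapping.lookup p m else 0)"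
      by (auto simp: lookup_single when_def)
  qed
  also have "\<dots> = Poly_Mapping.lookup p m" using assms by (simp add: sum.delta)
  finally show ?thesis using assms by (auto simp: in_keys_iff)
qed

text \<open>
  Each variable \<open>y\<close> outside \<open>T\<close> satisfies an equation modulo \<open>P\<close> whose leading coefficient lies in \<open>K[T]\<close>.  With the
  product \<open>f\<close> of these leading coefficients as denominator, all monomials can be rewritten as combinations of the
  finitely many ones whose exponents are bounded by the degrees of the equations.
\<close>

lemma reduction_modulo_algebraic:
  fixes P :: "('q::finite, 'k::field) mpoly set"
  assumes V: "finite V" and T: "T \<subseteq> V" and P: "ideal P (subring_of (polys_in V))"
    and alg: "\<And>y. y \<in> V - T \<Longrightarrow> \<exists>F. F \<in> P \<and> F \<noteq> 0 \<and> F \<in> polys_in (insert y T)"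
  obtains f B where "f \<noteq> 0" "f \<in> polys_in T" "finite B" "1 \<in> B"
    "\<And>u. u \<in> polys_in V \<Longrightarrow> \<exists>M. f ^ M * u \<in> span_over (polys_in T) B P"
proof -
  have Pi: "P \<subseteq> polys_in V" "0 \<in> P" "\<And>p q. p \<in> P \<Longrightarrow> q \<in> P \<Longrightarrow> p + q \<in> P"
    "\<And>p h. p \<in> P \<Longrightarrow> h \<in> polys_in V \<Longrightarrow> h * p \<in> P"
    using P unfolding ideal_polys_in_iff by blast+
  have TV: "polys_in T \<subseteq> polys_in V" using T by (auto simp: polys_in_def)
  have "\<forall>y\<in>V - T. \<exists>F. F \<in> P \<and> F \<noteq> 0 \<and> F \<in> polys_in (insert y T)" using alg by blast
  from bchoice[OF this] obtain F where
    F: "\<And>y. y \<in> V - T \<Longrightarrow> F y \<in> P" "\<And>y. y \<in> V - T \<Longrightarrow> F y \<noteq> 0"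
      "\<And>y. y \<in> V - T \<Longrightarrow> F y \<in> polys_in (insert y T)" by blast
  define s where "s y = Max ((\<lambda>m. Poly_Mapping.lookup m y) ` Poly_Mapping.keys (F y))" for y
  define lc where "lc y = coeff_in y (s y) (F y)" for y
  \<comment> \<open>the common denominator; \<open>E\<close> consists of the exponents bounded by the degrees of the equations\<close>
  define f where "f = (\<Prod>y\<in>V - T. lc y)"
  define E where "E = {e :: 'q monomial. Poly_Mapping.keys e \<subseteq> V - T \<and> (\<forall>v\<in>V - T. Poly_Mapping.lookup e v \<le> s v)}"
  define B where "B = (\<lambda>e. Poly_Mapping.single e (1::'k)) ` E"
  define N where "N = span_over (polys_in T) B P"
  have lc_T: "lc y \<in> polys_in T" if "y \<in> V - T" for y
    unfolding lc_def using F(3)[OF that] by (rule coeff_in_polys)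
  have s_max: "Poly_Mapping.lookup m y \<le> s y" if "m \<in> Poly_Mapping.keys (F y)" for m y
    unfolding s_def using that by (intro Max_ge) auto
  have lc_nz: "lc y \<noteq> 0" if "y \<in> V - T" for y
  proof -
    have "(\<lambda>m. Poly_Mapping.lookup m y) ` Poly_Mapping.keys (F y) \<noteq> {}" using F(2)[OF that] by auto
    then have "s y \<in> (\<lambda>m. Poly_Mapping.lookup m y) ` Poly_Mapping.keys (F y)"
      unfolding s_def by (intro Max_in) auto
    then obtain m where "m \<in> Poly_Mapping.keys (F y)" "s y = Poly_Mapping.lookup m y" by blast
    then show ?thesis unfolding lc_def using coeff_in_nonzero by metis
  qed
  have f_T: "f \<in> polys_in T" unfolding f_def using lc_T by (rule polys_in_prod)
  have f_nz: "f \<noteq> 0" unfolding f_def using lc_nz by (rule mpoly_prod_nonzero)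
  have "finite E"
  proof -
    have "finite (\<Pi>\<^sub>E v\<in>V - T. {..s v})" using V by (intro finite_PiE) auto
    moreover have "(\<lambda>e. restrict (Poly_Mapping.lookup e) (V - T)) ` E \<subseteq> (\<Pi>\<^sub>E v\<in>V - T. {..s v})"
      unfolding image_subset_iff restrict_PiE_iff by (simp add: E_def)
    moreover have "inj_on (\<lambda>e. restrict (Poly_Mapping.lookup e) (V - T)) E"
    proof (rule inj_onI)
      fix e e' assume e: "e \<in> E" "e' \<in> E"
        and eq: "restrict (Poly_Mapping.lookup e) (V - T) = restrict (Poly_Mapping.lookup e') (V - T)"
      show "e = e'"
      proof (rule poly_mapping_eqI)
        fix v
        show "Poly_Mapping.lookup e v = Poly_Mapping.lookup e' v"
        proof (cases "v \<in> V - T")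
          case True
          then show ?thesis using eq by (metis restrict_apply')
        next
          case False
          then have "v \<notin> Poly_Mapping.keys e" "v \<notin> Poly_Mapping.keys e'" using e by (auto simp: E_def)
          then show ?thesis by (simp add: in_keys_iff)
        qed
      qed
    qed
    ultimately show ?thesis by (metis finite_subset finite_imageD)
  qed
  then have finB: "finite B" by (simp add: B_def)
  have "0 \<in> E" by (simp add: E_def)
  then have B1: "1 \<in> B" unfolding B_def by (metis image_eqI single_one)
  note N_closed = span_over_closed[OF P T, where B = B, folded N_def]
  have N0: "0 \<in> N" using N_closed(1) Pi(2) by blast
  have Nsum: "sum g K \<in> N" if "\<And>k. k \<in> K \<Longrightarrow> g k \<in> N" for g :: "nat \<Rightarrow> _" and K
    using that by (induction K rule: infinite_finite_induct) (auto intro: N0 N_closed(2))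
  have m1: "- 1 \<in> polys_in T" by (rule polys_in_uminus) simp
  have shift: "lc y * var y * b \<in> N" if y: "y \<in> V - T" and b: "b \<in> B" for y b
  proof -
    obtain e where e: "e \<in> E" "b = Poly_Mapping.single e 1" using b by (auto simp: B_def)
    have e_supp: "Poly_Mapping.lookup e v = 0" if "v \<notin> V - T" for v
      using e(1) that by (auto simp: E_def simp flip: not_in_keys_iff_lookup_eq_zero)
    \<comment> \<open>the part of the monomial that does not involve \<open>y\<close>\<close>
    define e0 where "e0 = e - Poly_Mapping.single y (Poly_Mapping.lookup e y)"
    have e0: "Poly_Mapping.lookup e0 v = (if v = y then 0 else Poly_Mapping.lookup e v)" for v
      by (simp add: e0_def minus_poly_mapping.rep_eq lookup_single when_def)
    define b0 where "b0 = Poly_Mapping.single e0 (1::'k)"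
    have b_eq: "b = var y ^ Poly_Mapping.lookup e y * b0"
      using remove_var_add[of "Poly_Mapping.lookup e y" e y]
      by (simp add: e(2) b0_def e0_def var_power mult_single add.commute)
    have low: "var y ^ k * b0 \<in> B" if "k \<le> s y" for k
    proof -
      have "Poly_Mapping.keys (Poly_Mapping.single y k + e0) \<subseteq> V - T"
        using e_supp y by (force simp: in_keys_iff lookup_add lookup_single when_def e0 split: if_splits)
      then have "Poly_Mapping.single y k + e0 \<in> E"
        using e(1) y that by (auto simp: E_def lookup_add lookup_single when_def e0)
      then show ?thesis by (auto simp: B_def b0_def var_power mult_single)
    qed
    have ey: "Poly_Mapping.lookup e y \<le> s y" using e(1) y by (auto simp: E_def)
    show ?thesis
    proof (cases "Poly_Mapping.lookup e y = s y")
      case False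
      then have "var y * b \<in> B" using low[of "Suc (Poly_Mapping.lookup e y)"] ey
        by (simp add: b_eq mult.assoc)
      then have "lc y * (var y * b) \<in> N" using N_closed(3,4) finB lc_T[OF y] by blast
      then show ?thesis by (simp add: mult.assoc)
    next
      case True
      let ?C = "\<lambda>k. coeff_in y k (F y)"
      have move: "t = a - u" if "a = u + t" for a t u :: "('q, 'k) mpoly" using that by simp
      have "F y = (\<Sum>k\<le>s y. ?C k * var y ^ k)" using s_max by (rule sum_coeff_in)
      also have "\<dots> = (\<Sum>k<s y. ?C k * var y ^ k) + lc y * var y ^ s y"
        by (simp add: lc_def lessThan_Suc_atMost[symmetric])
      finally have top: "lc y * var y ^ s y = F y - (\<Sum>k<s y. ?C k * var y ^ k)"
        by (rule move)
      have low_terms: "(\<Sum>k<s y. ?C k * var y ^ k) * (var y * b0) = (\<Sum>k<s y. ?C k * (var y ^ Suc k * b0))"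
        unfolding sum_distrib_right by (intro sum.cong) (simp_all add: ac_simps)
      have "lc y * var y * b = (lc y * var y ^ s y) * (var y * b0)"
        by (simp add: b_eq True ac_simps)
      also have "\<dots> = (var y * b0) * F y + - 1 * (\<Sum>k<s y. ?C k * (var y ^ Suc k * b0))"
        unfolding top left_diff_distrib low_terms by (simp add: mult.commute)
      finally have split: "lc y * var y * b = (var y * b0) * F y + - 1 * (\<Sum>k<s y. ?C k * (var y ^ Suc k * b0))" .
      have high: "(var y * b0) * F y \<in> N"
      proof -
        have "Poly_Mapping.keys e0 \<subseteq> V" using e_supp by (force simp: e0 in_keys_iff split: if_splits)
        then have "b0 \<in> polys_in V" by (simp add: b0_def polys_in_single)
        then have "var y * b0 \<in> polys_in V" using y by (intro polys_in_mult polys_in_var) auto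
        then show ?thesis using F(1)[OF y] Pi(4) N_closed(1) by blast
      qed
      have "(\<Sum>k<s y. ?C k * (var y ^ Suc k * b0)) \<in> N"
      proof (rule Nsum)
        fix k assume "k \<in> {..<s y}"
        then have "var y ^ Suc k * b0 \<in> N" using low[of "Suc k"] N_closed(4)[OF finB] by auto
        then show "?C k * (var y ^ Suc k * b0) \<in> N"
          using coeff_in_polys[OF F(3)[OF y]] N_closed(3) by blast
      qed
      from N_closed(2)[OF high N_closed(3)[OF m1 this]] show ?thesis unfolding split .
    qed
  qed
  have f_shift: "f * var y * u \<in> N" if y: "y \<in> V - T" and u: "u \<in> N" for y u
  proof -
    have f_eq: "f = (\<Prod>v\<in>V - T - {y}. lc v) * lc y"
      unfolding f_def using V y by (subst prod.remove[of _ y]) (auto simp: mult.commute)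
    have rest: "(\<Prod>v\<in>V - T - {y}. lc v) \<in> polys_in T" using lc_T by (intro polys_in_prod) auto
    have "lc y * var y * u \<in> N"
    proof (rule span_over_mult_in)
      show "u \<in> span_over (polys_in T) B P" using u by (simp add: N_def)
      show "lc y * var y * p \<in> N" if "p \<in> P" for p
      proof -
        have "lc y * var y \<in> polys_in V" using lc_T[OF y] TV y by (intro polys_in_mult polys_in_var) auto
        then show ?thesis using Pi(4) N_closed(1) that by blast
      qed
    qed (use shift[OF y] N0 N_closed in auto)
    from N_closed(3)[OF rest this] show ?thesis unfolding f_eq by (simp only: mult.assoc)
  qed
  have "\<exists>M. f ^ M * u \<in> N" if "u \<in> polys_in V" for u
    using that
  proof (induction u rule: polys_in_induct)
    case (const c)
    have "const c \<in> polys_in T" by (auto simp: const_def polys_in_def)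
    then have "const c * 1 \<in> N" using N_closed(3) N_closed(4)[OF finB] B1 by blast
    then show ?case by (intro exI[of _ 0]) simp
  next
    case (add p q)
    then obtain M M' where M: "f ^ M * p \<in> N" "f ^ M' * q \<in> N" by blast
    have "f ^ M' * (f ^ M * p) + f ^ M * (f ^ M' * q) \<in> N"
      by (rule N_closed(2)[OF N_closed(3)[OF _ M(1)] N_closed(3)[OF _ M(2)]]) (intro polys_in_power f_T)+
    then show ?case by (intro exI[of _ "M + M'"]) (simp add: power_add algebra_simps)
  next
    case (var v p)
    then obtain M where M: "f ^ M * p \<in> N" by blast
    show ?case
    proof (cases "v \<in> T")
      case True
      then have "var v * (f ^ M * p) \<in> N" using N_closed(3)[OF polys_in_var M] by blast
      then show ?thesis by (intro exI[of _ M]) (simp add: ac_simps)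
    next
      case False
      then have "f * var v * (f ^ M * p) \<in> N" using f_shift[of v] M var(1) by blast
      then show ?thesis by (intro exI[of _ "Suc M"]) (simp add: ac_simps)
    qed
  qed
  then show ?thesis unfolding N_def by (rule that[OF f_nz f_T finB B1])
qed


section \<open>Zero-dimensional ideals have finite codimension\<close>

lemma one_minus_dvd_one_minus_power: "(1 - y :: 'a::comm_ring_1) dvd 1 - y ^ K"
proof (induction K)
  case (Suc K)
  have "1 - y ^ Suc K = (1 - y) + y * (1 - y ^ K)" by (simp add: algebra_simps)
  then show ?case using Suc by (metis dvd_add dvd_mult dvd_refl)
qed simp

text \<open>
  Modulo \<open>1 + x f\<close> the element \<open>f\<close> is invertible, with inverse \<open>-x\<close>; if a power of it is also zero, the quotient
  ring is trivial.
\<close>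

lemma dvd_one_of_dvd_power:
  fixes f x :: "'a::comm_ring_1"
  assumes "1 + x * f dvd f ^ K"
  shows "1 + x * f dvd 1"
proof -
  have "1 + x * f dvd (- x) ^ K * f ^ K" using assms by (rule dvd_mult)
  also have "(- x) ^ K * f ^ K = (- (x * f)) ^ K" by (simp flip: power_mult_distrib)
  finally have "1 + x * f dvd (- (x * f)) ^ K" .
  moreover have "1 + x * f dvd 1 - (- (x * f)) ^ K"
    using one_minus_dvd_one_minus_power[of "- (x * f)" K] by simp
  ultimately have "1 + x * f dvd (1 - (- (x * f)) ^ K) + (- (x * f)) ^ K" by (intro dvd_add)
  then show ?thesis by simp
qed

definition independent_over :: "('q, 'k::comm_ring_1) mpoly set \<Rightarrow> ('q, 'k) mpoly set \<Rightarrow> ('q, 'k) mpoly set \<Rightarrow> bool" where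
  "independent_over A B P \<longleftrightarrow>
     (\<forall>c. (\<forall>b\<in>B. c b \<in> A) \<longrightarrow> (\<Sum>b\<in>B. c b * b) \<in> P \<longrightarrow> (\<forall>b\<in>B. c b = 0))"

text \<open>
  This provides a basis, containing \<open>1\<close>, of a vector space over the fraction field of \<open>K[T]\<close>, expressed without
  fractions.  Having \<open>1\<close> in the basis makes it possible to read off the elements of \<open>K(T)\<close> from their
  coordinates.
\<close>

lemma maximal_independent_subset_over:
  fixes P :: "('q, 'k::comm_ring_1) mpoly set"
  assumes B: "finite B" "1 \<in> B" and P: "ideal P (subring_of (polys_in V))" and T: "T \<subseteq> V"
    and TP: "\<And>c. c \<in> polys_in T \<Longrightarrow> c \<in> P \<Longrightarrow> c = 0"
  obtains B' where "B' \<subseteq> B" "1 \<in> B'" "independent_over (polys_in T) B' P"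
    "\<And>b. b \<in> B \<Longrightarrow> \<exists>d. d \<noteq> 0 \<and> d \<in> polys_in T \<and> d * b \<in> span_over (polys_in T) B' P"
proof -
  define \<I> where "\<I> = {C. C \<subseteq> B \<and> 1 \<in> C \<and> independent_over (polys_in T) C P}"
  have fin: "finite \<I>" using B(1) by (simp add: \<I>_def)
  have "{1} \<in> \<I>" using B(2) TP by (auto simp: independent_over_def \<I>_def)
  then have ne: "\<I> \<noteq> {}" by blast
  obtain C where C_in: "C \<in> \<I>" and Cmax: "\<forall>D\<in>\<I>. C \<subseteq> D \<longrightarrow> C = D"
    using finite_has_maximal[OF fin ne] by blast
  have C: "C \<subseteq> B" "1 \<in> C" and indep: "independent_over (polys_in T) C P"
    using C_in by (simp_all add: \<I>_def)
  have finC: "finite C" using C(1) B(1) by (rule finite_subset)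
  note closed = span_over_closed[OF P T, where B = C]
  have "\<exists>d. d \<noteq> 0 \<and> d \<in> polys_in T \<and> d * b \<in> span_over (polys_in T) C P" if b: "b \<in> B" for b
  proof (cases "b \<in> C")
    case True
    then have "b \<in> span_over (polys_in T) C P" using closed(4)[OF finC] by blast
    then show ?thesis by (intro exI[of _ 1]) simp
  next
    case False
    then have "insert b C \<notin> \<I>" using Cmax by blast
    then have "\<not> independent_over (polys_in T) (insert b C) P" using C b by (simp add: \<I>_def)
    then obtain c where c: "\<forall>b\<in>insert b C. c b \<in> polys_in T" "(\<Sum>b\<in>insert b C. c b * b) \<in> P"
      and nz: "\<not> (\<forall>b\<in>insert b C. c b = 0)"
      unfolding independent_over_def not_all not_imp by (elim exE conjE)
    have sum: "c b * b + (\<Sum>b\<in>C. c b * b) \<in> P" using c(2) False finC by simp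
    have "c b \<noteq> 0"
    proof
      assume "c b = 0"
      then have "(\<Sum>b\<in>C. c b * b) \<in> P" using sum by simp
      then have "\<forall>b\<in>C. c b = 0" using indep c(1) unfolding independent_over_def by simp
      then show False using nz \<open>c b = 0\<close> by simp
    qed
    moreover have "c b * b \<in> span_over (polys_in T) C P"
    proof (rule span_overI)
      show "- c b' \<in> polys_in T" if "b' \<in> C" for b' using c(1) that by (intro polys_in_uminus) simp
      show "c b * b - (\<Sum>b\<in>C. - c b * b) \<in> P" using sum by (simp add: sum_negf)
    qed
    ultimately show ?thesis using c(1) by blast
  qed
  then show ?thesis using C indep by (intro that[of C])
qed

text \<open>
  A form of Zariski's lemma: a finitely generated algebra over a field that is itself a field is algebraic.  The
  inverse of \<open>g = 1 + x e\<close> modulo \<open>P\<close> has a power of \<open>e\<close> as denominator; comparing coordinates at the basis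
  element \<open>1\<close> shows that \<open>g\<close> divides this power in \<open>K[T]\<close>.
\<close>

lemma variable_algebraic_modulo:
  fixes I :: "('q::finite, 'k::field) mpoly set"
  assumes V: "finite V" and I: "ideal I (subring_of (polys_in V))" and x: "x \<in> V"
    and dim0: "\<And>P Q. primeideal P (subring_of (polys_in V)) \<Longrightarrow> primeideal Q (subring_of (polys_in V)) \<Longrightarrow>
      I \<subseteq> P \<Longrightarrow> P \<subseteq> Q \<Longrightarrow> P = Q"
  shows "\<exists>F. F \<in> I \<and> F \<noteq> 0 \<and> F \<in> polys_in {x}"
proof (rule ccontr)
  assume "\<not> ?thesis"
  then have x_free: "F = 0" if "F \<in> I" "F \<in> polys_in {x}" for F using that by blast
  define \<T> where "\<T> = {T. T \<subseteq> V \<and> x \<in> T \<and> (\<forall>F\<in>I. F \<in> polys_in T \<longrightarrow> F = 0)}"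
  have fin: "finite \<T>" using V by (simp add: \<T>_def)
  have "{x} \<in> \<T>" using x x_free by (simp add: \<T>_def)
  then have ne: "\<T> \<noteq> {}" by blast
  obtain T where T: "T \<in> \<T>" and Tmax: "\<forall>U\<in>\<T>. T \<subseteq> U \<longrightarrow> T = U"
    using finite_has_maximal[OF fin ne] by blast
  have TV: "T \<subseteq> V" and xT: "x \<in> T" and T_free: "\<And>F. F \<in> I \<Longrightarrow> F \<in> polys_in T \<Longrightarrow> F = 0"
    using T by (simp_all add: \<T>_def)
  have alg: "\<exists>F. F \<in> I \<and> F \<noteq> 0 \<and> F \<in> polys_in (insert y T)" if y: "y \<in> V - T" for y
  proof (rule ccontr)
    assume "\<not> ?thesis"
    then have "insert y T \<in> \<T>" using TV xT y by (auto simp: \<T>_def)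
    then have "T = insert y T" using Tmax by blast
    then show False using y by blast
  qed
  let ?S = "polys_in T - {0 :: ('q, 'k) mpoly}"
  have S_mult: "s * t \<in> ?S" if "s \<in> ?S" "t \<in> ?S" for s t
    using that by (simp add: polys_in_mult mpoly_mult_nonzero)
  have S_disj: "I \<inter> ?S = {}" using T_free by blast
  obtain P where P: "primeideal P (subring_of (polys_in V))" "I \<subseteq> P" "P \<inter> ?S = {}"
    using prime_ideal_avoiding[OF I _ S_mult S_disj] by auto
  have Pid: "ideal P (subring_of (polys_in V))" using P(1) by (simp add: primeideal.axioms)
  have Pi: "P \<subseteq> polys_in V" "0 \<in> P" "\<And>p q. p \<in> P \<Longrightarrow> q \<in> P \<Longrightarrow> p + q \<in> P"
    "\<And>p h. p \<in> P \<Longrightarrow> h \<in> polys_in V \<Longrightarrow> h * p \<in> P"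
    using Pid unfolding ideal_polys_in_iff by blast+
  have P_free: "c = 0" if "c \<in> polys_in T" "c \<in> P" for c using P(3) that by blast
  have TVp: "c \<in> polys_in V" if "c \<in> polys_in T" for c using TV that by (auto simp: polys_in_def)
  have algP: "\<exists>F. F \<in> P \<and> F \<noteq> 0 \<and> F \<in> polys_in (insert y T)" if "y \<in> V - T" for y
    using alg[OF that] P(2) by blast
  obtain f B where f: "f \<noteq> 0" "f \<in> polys_in T" and B: "finite B" "1 \<in> B"
    and reduce: "\<And>u. u \<in> polys_in V \<Longrightarrow> \<exists>M. f ^ M * u \<in> span_over (polys_in T) B P"
    using reduction_modulo_algebraic[OF V TV Pid algP] by blast
  obtain C where C: "C \<subseteq> B" "1 \<in> C" "independent_over (polys_in T) C P"
    and dep: "\<And>b. b \<in> B \<Longrightarrow> \<exists>d. d \<noteq> 0 \<and> d \<in> polys_in T \<and> d * b \<in> span_over (polys_in T) C P"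
    using maximal_independent_subset_over[OF B Pid TV P_free] by blast
  have finC: "finite C" using C(1) B(1) finite_subset by blast
  note closed = span_over_closed[OF Pid TV, where B = C]
  have "\<forall>b\<in>B. \<exists>d. d \<noteq> 0 \<and> d \<in> polys_in T \<and> d * b \<in> span_over (polys_in T) C P" using dep by blast
  from bchoice[OF this] obtain d where d: "\<And>b. b \<in> B \<Longrightarrow> d b \<noteq> 0" "\<And>b. b \<in> B \<Longrightarrow> d b \<in> polys_in T"
    "\<And>b. b \<in> B \<Longrightarrow> d b * b \<in> span_over (polys_in T) C P" by blast
  \<comment> \<open>a common denominator for expressing all of \<open>B\<close> in terms of \<open>C\<close>\<close>
  define D where "D = prod d B"
  have D: "D \<noteq> 0" "D \<in> polys_in T"
    unfolding D_def using mpoly_prod_nonzero[OF d(1)] polys_in_prod[OF d(2)] by simp_all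
  have Db: "D * b \<in> span_over (polys_in T) C P" if b: "b \<in> B" for b
  proof -
    have "D * b = prod d (B - {b}) * (d b * b)"
      unfolding D_def using B(1) b by (subst prod.remove[of _ b]) (simp_all add: ac_simps)
    moreover have "prod d (B - {b}) \<in> polys_in T" using d by (intro polys_in_prod) auto
    ultimately show ?thesis using closed(3) d(3)[OF b] by simp
  qed
  define e where "e = f * D"
  have e: "e \<noteq> 0" "e \<in> polys_in T" unfolding e_def using f D by (simp_all add: mpoly_mult_nonzero polys_in_mult)
  \<comment> \<open>nonzero modulo \<open>P\<close>, hence invertible, but coprime to the denominators \<open>e\<^sup>M\<close>\<close>
  define g where "g = 1 + var x * e"
  have g_T: "g \<in> polys_in T" unfolding g_def using e xT by (intro polys_in_add polys_in_mult polys_in_var) auto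
  have g_nz: "g \<noteq> 0" unfolding g_def by (rule one_plus_var_mult_nonzero)
  have g_nP: "g \<notin> P" using P_free[OF g_T] g_nz by blast
  define Q where "Q = {p + g * h |p h. p \<in> P \<and> h \<in> polys_in V}"
  note Q = ideal_extend[OF Pid TVp[OF g_T], folded Q_def]
  have "1 \<in> Q"
  proof (rule ccontr)
    assume "1 \<notin> Q"
    then have "Q \<inter> {1} = {}" by blast
    then obtain R where R: "primeideal R (subring_of (polys_in V))" "Q \<subseteq> R"
      using prime_ideal_avoiding[OF Q(1), of "{1}"] by auto
    have "P \<subseteq> R" using Q(2) R(2) by (rule subset_trans)
    then have "P = R" using dim0[OF P(1) R(1) P(2)] by blast
    then show False using Q(3) R(2) g_nP by blast
  qed
  then obtain p h where ph: "1 = p + g * h" "p \<in> P" "h \<in> polys_in V"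
    unfolding Q_def by (elim CollectE exE conjE)
  obtain M where "f ^ M * h \<in> span_over (polys_in T) B P" using reduce ph(3) by blast
  then have "D * (f ^ M * h) \<in> span_over (polys_in T) C P"
  proof (rule span_over_mult_in)
    show "D * p \<in> span_over (polys_in T) C P" if "p \<in> P" for p
      using Pi(4)[OF that TVp[OF D(2)]] closed(1) by blast
  qed (use Db closed Pi(2) in auto)
  then obtain c where c: "\<forall>b\<in>C. c b \<in> polys_in T" "D * (f ^ M * h) - (\<Sum>b\<in>C. c b * b) \<in> P"
    by (rule span_overE)
  let ?c = "\<lambda>b. (if b = 1 then D * f ^ M else 0) - g * c b"
  have DfM: "D * f ^ M \<in> polys_in T" using D f by (intro polys_in_mult polys_in_power)
  have "g * (D * (f ^ M * h) - (\<Sum>b\<in>C. c b * b)) + (D * f ^ M) * p \<in> P"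
    using Pi(3)[OF Pi(4)[OF c(2) TVp[OF g_T]] Pi(4)[OF ph(2) TVp[OF DfM]]] .
  also have "g * (D * (f ^ M * h) - (\<Sum>b\<in>C. c b * b)) + (D * f ^ M) * p
      = (D * f ^ M) * (p + g * h) - (\<Sum>b\<in>C. g * c b * b)"
    by (simp add: sum_distrib_left algebra_simps)
  also have "\<dots> = D * f ^ M - (\<Sum>b\<in>C. g * c b * b)" by (simp flip: ph(1))
  also have "\<dots> = (\<Sum>b\<in>C. (if b = 1 then D * f ^ M else 0) * b) - (\<Sum>b\<in>C. g * c b * b)"
    using finC C(2) by (simp add: if_distrib[of "\<lambda>z. z * _"] sum.delta cong: if_cong)
  also have "\<dots> = (\<Sum>b\<in>C. ?c b * b)" by (simp only: left_diff_distrib sum_subtractf)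
  finally have in_P: "(\<Sum>b\<in>C. ?c b * b) \<in> P" .
  have "?c b \<in> polys_in T" if "b \<in> C" for b
  proof -
    have "(if b = 1 then D * f ^ M else 0) \<in> polys_in T" using DfM by simp
    moreover have "- (g * c b) \<in> polys_in T" using c(1) g_T that by (intro polys_in_uminus polys_in_mult) auto
    ultimately have "(if b = 1 then D * f ^ M else 0) + - (g * c b) \<in> polys_in T" by (rule polys_in_add)
    then show ?thesis by simp
  qed
  then have "\<forall>b\<in>C. ?c b \<in> polys_in T" by blast
  with C(3) in_P have "\<forall>b\<in>C. ?c b = 0" unfolding independent_over_def by (elim allE[of _ ?c]) blast
  from bspec[OF this C(2)] have denominator: "D * f ^ M = g * c 1" by simp
  have "e ^ Suc M = (D * f ^ M) * (f * D ^ M)"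
    unfolding e_def power_mult_distrib power_Suc by (simp only: ac_simps)
  also have "\<dots> = g * (c 1 * (f * D ^ M))" unfolding denominator by (simp only: mult.assoc)
  finally have "1 + var x * e dvd e ^ Suc M" unfolding g_def by (rule dvdI)
  then have "1 + var x * e dvd 1" by (rule dvd_one_of_dvd_power)
  then show False using one_plus_var_mult_not_unit[OF e(1)] by blast
qed

text \<open>
  With \<open>T = {}\<close> the denominators are nonzero constants, so that the bounded monomials span the whole quotient.
\<close>

lemma finite_codimension:
  fixes I :: "('q::finite, 'k::field) mpoly set"
  assumes V: "finite V" and I: "ideal I (subring_of (polys_in V))"
    and dim0: "\<And>P Q. primeideal P (subring_of (polys_in V)) \<Longrightarrow> primeideal Q (subring_of (polys_in V)) \<Longrightarrow>
      I \<subseteq> P \<Longrightarrow> P \<subseteq> Q \<Longrightarrow> P = Q"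
  obtains B where "finite B" "\<And>u. u \<in> polys_in V \<Longrightarrow> \<exists>c. u - (\<Sum>b\<in>B. const (c b) * b) \<in> I"
proof -
  have Ii: "\<And>p h. p \<in> I \<Longrightarrow> h \<in> polys_in V \<Longrightarrow> h * p \<in> I"
    using I unfolding ideal_polys_in_iff by blast
  have constant_poly: "\<exists>k. p = const k" if p: "p \<in> polys_in {}" for p :: "('q, 'k) mpoly"
  proof -
    have "p = Poly_Mapping.single 0 (Poly_Mapping.lookup p 0)"
    proof (rule poly_mapping_eqI)
      fix m
      show "Poly_Mapping.lookup p m = Poly_Mapping.lookup (Poly_Mapping.single 0 (Poly_Mapping.lookup p 0)) m"
      proof (cases "m = 0")
        case False
        then have "m \<notin> Poly_Mapping.keys p" using p by (auto simp: polys_in_def)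
        then show ?thesis using False by (simp add: in_keys_iff lookup_single when_def)
      qed simp
    qed
    then show ?thesis unfolding const_def by blast
  qed
  have alg: "\<exists>F. F \<in> I \<and> F \<noteq> 0 \<and> F \<in> polys_in (insert y {})" if "y \<in> V - {}" for y
    using variable_algebraic_modulo[OF V I _ dim0] that by blast
  obtain f B where f: "f \<noteq> 0" "f \<in> polys_in {}" and B: "finite B" "1 \<in> B"
    and reduce: "\<And>u. u \<in> polys_in V \<Longrightarrow> \<exists>M. f ^ M * u \<in> span_over (polys_in {}) B I"
    using reduction_modulo_algebraic[OF V empty_subsetI I alg] by blast
  obtain k where k: "f = const k" using constant_poly[OF f(2)] by blast
  have k0: "k \<noteq> 0" using f(1) k by (auto simp: const_def)
  have const_pow: "const k ^ M = (const (k ^ M) :: ('q, 'k) mpoly)" for M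
    by (induction M) (simp_all add: const_mult, simp add: const_def)
  have "\<exists>c. u - (\<Sum>b\<in>B. const (c b) * b) \<in> I" if u: "u \<in> polys_in V" for u
  proof -
    obtain M where "f ^ M * u \<in> span_over (polys_in {}) B I" using reduce[OF u] by blast
    then obtain c where c: "\<forall>b\<in>B. c b \<in> polys_in {}" "f ^ M * u - (\<Sum>b\<in>B. c b * b) \<in> I"
      by (rule span_overE)
    have "\<forall>b\<in>B. \<exists>r. c b = const r" using c(1) constant_poly by blast
    from bchoice[OF this] obtain r where r: "\<forall>b\<in>B. c b = const (r b)" by blast
    let ?i = "const (inverse (k ^ M)) :: ('q, 'k) mpoly"
    have inv: "?i * f ^ M = 1"
      using k0 by (simp add: k const_pow flip: const_mult) (simp add: const_def)
    have "?i \<in> polys_in V" by (auto simp: const_def polys_in_def)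
    then have "?i * (f ^ M * u - (\<Sum>b\<in>B. c b * b)) \<in> I" using Ii c(2) by blast
    also have "?i * (f ^ M * u - (\<Sum>b\<in>B. c b * b)) = (?i * f ^ M) * u - (\<Sum>b\<in>B. ?i * c b * b)"
      by (simp add: right_diff_distrib sum_distrib_left mult.assoc)
    also have "(\<Sum>b\<in>B. ?i * c b * b) = (\<Sum>b\<in>B. const (inverse (k ^ M) * r b) * b)"
      using r by (intro sum.cong) (simp_all add: const_mult)
    finally show ?thesis unfolding inv by auto
  qed
  then show ?thesis by (rule that[OF B(1)])
qed


section \<open>Forms modulo the vanishing ideal\<close>

lemma const_add: "const (c + d) = const c + const d"
  by (simp add: const_def single_add)

lemma const_0 [simp]: "const 0 = 0"
  by (simp add: const_def)

lemma const_1 [simp]: "const 1 = 1"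
  by (simp add: const_def)

lemma const_sum: "const (sum f A) = (\<Sum>a\<in>A. const (f a))"
  by (induction A rule: infinite_finite_induct) (simp_all add: const_add)

lemma const_in_polys [simp]: "const c \<in> polys_in V"
  by (auto simp: const_def polys_in_def)

lemma const_mult_form: "F \<in> forms I n a \<Longrightarrow> const c * F \<in> forms I n a"
proof -
  assume F: "F \<in> forms I n a"
  have "const c \<in> forms I n 0"
    by (auto simp: forms_def coord_ring_def const_def polys_in_def)
  from forms_mult[OF this F] show ?thesis by simp
qed

lemma forms_subspace: "mpoly_vs.subspace (forms I n a :: ('q::finite, 'k::field) mpoly set)"
  by (rule mpoly_vs.subspaceI) (simp_all add: forms_add const_mult_form)

lemma multidegree_nth: "multidegree m $ i = (\<Sum>v\<in>Poly_Mapping.keys m. if fst v = i then int (Poly_Mapping.lookup m v) else 0)"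
  by (auto simp: multidegree_def axis_def intro!: sum.cong)

lemma lookup_le_multidegree: "int (Poly_Mapping.lookup m v) \<le> multidegree m $ fst v"
proof (cases "v \<in> Poly_Mapping.keys m")
  case True
  have "(if fst v = fst v then int (Poly_Mapping.lookup m v) else 0) \<le> multidegree m $ fst v"
    unfolding multidegree_nth using True by (intro member_le_sum) auto
  then show ?thesis by simp
next
  case False
  have "0 \<le> multidegree m $ fst v" unfolding multidegree_nth by (intro sum_nonneg) auto
  then show ?thesis using False by (simp add: in_keys_iff)
qed

lemma multidegree_nonneg: "0 \<le> multidegree m"
  by (auto simp: less_eq_vec_def multidegree_nth intro!: sum_nonneg)

lemma forms_eq_0:
  assumes "F \<in> forms I n a" "\<not> 0 \<le> a"
  shows "F = 0"
proof (rule ccontr)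
  assume "F \<noteq> 0"
  then have "Poly_Mapping.keys F \<noteq> {}" by simp
  then obtain m where "m \<in> Poly_Mapping.keys F" by blast
  then have "multidegree m = a" using assms(1) by (simp add: forms_def)
  then show False using assms(2) multidegree_nonneg by metis
qed

definition monomials_of :: "('q::finite \<Rightarrow> nat) \<Rightarrow> int ^ 'q \<Rightarrow> 'q monomial set" where
  "monomials_of n a = {m. Poly_Mapping.keys m \<subseteq> {(i, j). j \<le> n i} \<and> multidegree m = a}"

lemma finite_monomials_of: "finite (monomials_of n a)"
proof -
  let ?V = "SIGMA i:UNIV. {..n i}"
  let ?D = "\<Pi>\<^sub>E v\<in>?V. {..nat (a $ fst v)}"
  have "finite ?D" by (intro finite_PiE) auto
  moreover have "(\<lambda>m. restrict (Poly_Mapping.lookup m) ?V) ` monomials_of n a \<subseteq> ?D"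
  proof (rule image_subsetI)
    fix m assume m: "m \<in> monomials_of n a"
    show "restrict (Poly_Mapping.lookup m) ?V \<in> ?D"
      unfolding restrict_PiE_iff
    proof
      fix v
      show "Poly_Mapping.lookup m v \<in> {..nat (a $ fst v)}"
        using lookup_le_multidegree[of m v] m by (simp add: monomials_of_def)
    qed
  qed
  moreover have "inj_on (\<lambda>m. restrict (Poly_Mapping.lookup m) ?V) (monomials_of n a)"
  proof (rule inj_onI)
    fix m m' assume m: "m \<in> monomials_of n a" "m' \<in> monomials_of n a"
      and eq: "restrict (Poly_Mapping.lookup m) ?V = restrict (Poly_Mapping.lookup m') ?V"
    show "m = m'"
    proof (rule poly_mapping_eqI)
      fix v
      show "Poly_Mapping.lookup m v = Poly_Mapping.lookup m' v"
      proof (cases "v \<in> ?V")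
        case True
        then show ?thesis using fun_cong[OF eq, of v] by simp
      next
        case False
        then have "v \<notin> Poly_Mapping.keys m" "v \<notin> Poly_Mapping.keys m'"
          using m by (auto simp: monomials_of_def)
        then show ?thesis by (simp add: in_keys_iff)
      qed
    qed
  qed
  ultimately show ?thesis by (metis finite_subset finite_imageD)
qed

lemma forms_keys: "F \<in> forms UNIV n a \<Longrightarrow> Poly_Mapping.keys F \<subseteq> monomials_of n a"
  by (force simp: forms_def coord_ring_def polys_in_def monomials_of_def)

lemma single_in_forms: "m \<in> monomials_of n a \<Longrightarrow> Poly_Mapping.single m c \<in> forms UNIV n a"
  by (auto simp: forms_def coord_ring_def polys_in_def monomials_of_def)

text \<open>
  Take any \<open>t\<close> of the variables \<open>x\<^sub>i\<^sub>j\<close> of the monomial, counted with multiplicity.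
\<close>

lemma split_monomial:
  fixes m :: "'q::finite monomial"
  assumes "int t \<le> multidegree m $ i"
  obtains m1 m2 where "m = m1 + m2" "multidegree m1 = axis i (int t)"
proof -
  have "\<exists>m1 m2. m = m1 + m2 \<and> multidegree m1 = axis i (int t)"
    using assms
  proof (induction t)
    case 0
    show ?case by (intro exI[of _ 0] exI[of _ m]) (simp add: axis_eq_0_iff)
  next
    case (Suc t)
    then obtain m1 m2 where m: "m = m1 + m2" "multidegree m1 = axis i (int t)" by auto
    have "multidegree m $ i = int t + multidegree m2 $ i" using m by (simp add: multidegree_add axis_def)
    then have nz: "multidegree m2 $ i \<noteq> 0" using Suc.prems by simp
    have "\<exists>v\<in>Poly_Mapping.keys m2. fst v = i"
    proof (rule ccontr)
      assume "\<not> ?thesis"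
      then have "multidegree m2 $ i = 0" unfolding multidegree_nth by (intro sum.neutral) simp
      then show False using nz by simp
    qed
    then obtain v where v: "v \<in> Poly_Mapping.keys m2" "fst v = i" by blast
    have m2: "m2 - Poly_Mapping.single v 1 + Poly_Mapping.single v 1 = m2"
      using v(1) by (intro remove_var_add) (simp add: in_keys_iff Suc_le_eq)
    have "m = (m1 + Poly_Mapping.single v 1) + (m2 - Poly_Mapping.single v 1)"
      unfolding m(1) by (subst m2[symmetric]) (simp only: ac_simps)
    moreover have "multidegree (m1 + Poly_Mapping.single v 1) = axis i (int (Suc t))"
      using m(2) v(2) by (simp add: multidegree_add add.commute flip: axis_add)
    ultimately show ?case by blast
  qed
  then show ?thesis using that by blast
qed

locale closed_product_subscheme =
  fixes n :: "'q::finite \<Rightarrow> nat" and X :: "('q, 'k::field) ideal_family"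
  assumes closed: "closed_subscheme UNIV n X"
begin

definition J :: "('q, 'k) mpoly set" where
  "J = vanishing_ideal UNIV n X"

abbreviation S :: "int ^ 'q \<Rightarrow> ('q, 'k) mpoly set" where
  "S \<equiv> forms UNIV n"

abbreviation R :: "('q, 'k) mpoly set" where
  "R \<equiv> coord_ring UNIV n"

abbreviation H :: "int ^ 'q \<Rightarrow> int" where
  "H \<equiv> hilbert_function UNIV n X"

lemma chart_ideal: "\<sigma> \<in> charts UNIV n \<Longrightarrow> ideal (X \<sigma>) (subring_of (chart_ring UNIV n \<sigma>))"
  using closed by (simp add: closed_subscheme_def)

lemma X_closed:
  assumes "\<sigma> \<in> charts UNIV n"
  shows "0 \<in> X \<sigma>" "p \<in> X \<sigma> \<Longrightarrow> q \<in> X \<sigma> \<Longrightarrow> p + q \<in> X \<sigma>"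
    "p \<in> X \<sigma> \<Longrightarrow> h \<in> chart_ring UNIV n \<sigma> \<Longrightarrow> h * p \<in> X \<sigma>"
proof -
  have "X \<sigma> \<subseteq> chart_ring UNIV n \<sigma> \<and> 0 \<in> X \<sigma> \<and> (\<forall>p\<in>X \<sigma>. \<forall>q\<in>X \<sigma>. p + q \<in> X \<sigma>) \<and>
      (\<forall>p\<in>X \<sigma>. \<forall>h\<in>chart_ring UNIV n \<sigma>. h * p \<in> X \<sigma>)"
    using chart_ideal[OF assms] unfolding chart_ring_def ideal_polys_in_iff .
  then show "0 \<in> X \<sigma>" "p \<in> X \<sigma> \<Longrightarrow> q \<in> X \<sigma> \<Longrightarrow> p + q \<in> X \<sigma>"
    "p \<in> X \<sigma> \<Longrightarrow> h \<in> chart_ring UNIV n \<sigma> \<Longrightarrow> h * p \<in> X \<sigma>" by simp_all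
qed

lemma J_closed:
  shows "J \<subseteq> R" "0 \<in> J" "p \<in> J \<Longrightarrow> q \<in> J \<Longrightarrow> p + q \<in> J" "p \<in> J \<Longrightarrow> h \<in> R \<Longrightarrow> h * p \<in> J"
proof -
  have "J \<subseteq> R \<and> 0 \<in> J \<and> (\<forall>p\<in>J. \<forall>q\<in>J. p + q \<in> J) \<and> (\<forall>p\<in>J. \<forall>h\<in>R. h * p \<in> J)"
    using vanishing_ideal_ideal[of UNIV n X, folded J_def]
    unfolding coord_ring_def ideal_polys_in_iff .
  then show "J \<subseteq> R" "0 \<in> J" "p \<in> J \<Longrightarrow> q \<in> J \<Longrightarrow> p + q \<in> J" "p \<in> J \<Longrightarrow> h \<in> R \<Longrightarrow> h * p \<in> J"
    by simp_all
qed

lemma const_in_R: "const c \<in> R"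
  by (simp add: coord_ring_def)

lemma var_in_R: "j \<le> n i \<Longrightarrow> var (i, j) \<in> R"
  by (simp add: coord_ring_def polys_in_var)

lemma R_mult: "p \<in> R \<Longrightarrow> q \<in> R \<Longrightarrow> p * q \<in> R"
  by (simp add: coord_ring_def polys_in_mult)

lemma forms_in_R: "F \<in> S a \<Longrightarrow> F \<in> R"
  by (simp add: forms_def)

lemma J_subspace: "mpoly_vs.subspace J"
  by (rule mpoly_vs.subspaceI) (auto intro: J_closed const_in_R)

lemma J_sum: "(\<And>a. a \<in> A \<Longrightarrow> f a \<in> J) \<Longrightarrow> sum f A \<in> J"
  by (rule mpoly_vs.subspace_sum[OF J_subspace])

lemma J_form_iff:
  assumes "F \<in> S a"
  shows "F \<in> J \<longleftrightarrow> (\<forall>\<sigma>\<in>charts UNIV n. dehom \<sigma> F \<in> X \<sigma>)"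
proof -
  note iff = vanishing_ideal_iff[of UNIV n X F, OF chart_ideal, folded J_def]
  have "F \<in> J \<longleftrightarrow> F \<in> vanishing_forms UNIV n X"
  proof
    assume "F \<in> J"
    then have "component a F \<in> vanishing_forms UNIV n X" using iff by blast
    then show "F \<in> vanishing_forms UNIV n X" by (simp add: component_form[OF assms])
  next
    assume "F \<in> vanishing_forms UNIV n X"
    then show "F \<in> J" unfolding J_def using vanishing_forms_subset by blast
  qed
  also have "\<dots> \<longleftrightarrow> (\<forall>\<sigma>\<in>charts UNIV n. dehom \<sigma> F \<in> X \<sigma>)"
    unfolding vanishing_forms_def using assms by blast
  finally show ?thesis .
qed

text \<open>
  On the chart given by \<open>\<sigma>\<close> the variable \<open>x\<^bsub>i \<sigma>(i)\<^esub>\<close> becomes \<open>1\<close>, so that a form and its product with this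
  variable restrict to the same function.
\<close>

lemma J_saturated:
  assumes p: "p \<in> R" and xp: "\<And>j. j \<le> n i \<Longrightarrow> var (i, j) * p \<in> J"
  shows "p \<in> J"
proof -
  note iff = vanishing_ideal_iff[OF chart_ideal, folded J_def]
  have "component a p \<in> vanishing_forms UNIV n X" for a
  proof -
    have a: "component a p \<in> S a" using component_in_forms[OF p] .
    have "dehom \<sigma> (component a p) \<in> X \<sigma>" if \<sigma>: "\<sigma> \<in> charts UNIV n" for \<sigma>
    proof -
      have le: "\<sigma> i \<le> n i" using \<sigma> by (auto simp: charts_def)
      have "component (axis i 1 + a) (var (i, \<sigma> i) * p) = var (i, \<sigma> i) * component a p"
        unfolding var_def by (simp add: component_single_mult)
      then have "var (i, \<sigma> i) * component a p \<in> vanishing_forms UNIV n X"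
        using iff[of "var (i, \<sigma> i) * p"] xp[OF le] by metis
      then have "dehom \<sigma> (var (i, \<sigma> i) * component a p) \<in> X \<sigma>"
        using \<sigma> by (simp add: vanishing_forms_def)
      then show ?thesis by (simp add: dehom_mult dehom_var)
    qed
    then show ?thesis using a by (auto simp: vanishing_forms_def)
  qed
  then show ?thesis using iff[of p] p by blast
qed

lemma forms_basis_modulo:
  obtains B where "finite B" "B \<subseteq> S a" "H a = int (card B)"
    "\<forall>u\<in>S a. \<exists>c. u - (\<Sum>b\<in>B. const (c b) * b) \<in> J"
    "\<forall>c. (\<Sum>b\<in>B. const (c b) * b) \<in> J \<longrightarrow> (\<forall>b\<in>B. c b = 0)"
proof -
  let ?W = "J \<inter> S a"
  define G where "G = (\<lambda>m. Poly_Mapping.single m (1::'k)) ` monomials_of n a"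
  have finG: "finite G" by (simp add: G_def finite_monomials_of)
  have GS: "G \<subseteq> S a" by (auto simp: G_def intro: single_in_forms)
  have W: "mpoly_vs.subspace ?W" by (rule mpoly_vs.subspace_inter[OF J_subspace forms_subspace])
  have span: "\<exists>c. u - (\<Sum>b\<in>G. const (c b) * b) \<in> ?W" if u: "u \<in> S a" for u
  proof -
    let ?c = "\<lambda>b. Poly_Mapping.lookup u (the_inv_into (monomials_of n a) (\<lambda>m. Poly_Mapping.single m 1) b)"
    have inj: "inj_on (\<lambda>m. Poly_Mapping.single m (1::'k)) (monomials_of n a)"
      by (rule inj_onI) (metis keys_single one_neq_zero singleton_inject)
    have "u = (\<Sum>m\<in>monomials_of n a. Poly_Mapping.single m (Poly_Mapping.lookup u m))"
      by (subst poly_mapping_sum_single, rule sum.mono_neutral_left)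
        (use forms_keys[OF u] in \<open>auto simp: finite_monomials_of in_keys_iff\<close>)
    also have "\<dots> = (\<Sum>m\<in>monomials_of n a. const (Poly_Mapping.lookup u m) * Poly_Mapping.single m 1)"
      by (simp add: const_def mult_single)
    also have "\<dots> = (\<Sum>b\<in>G. const (?c b) * b)"
      unfolding G_def by (subst sum.reindex[OF inj]) (simp add: the_inv_into_f_f[OF inj])
    finally have eq: "u = (\<Sum>b\<in>G. const (?c b) * b)" .
    have "u - (\<Sum>b\<in>G. const (?c b) * b) \<in> ?W"
      using J_closed(2) by (simp flip: eq)
    then show ?thesis by (rule exI[of _ ?c])
  qed
  obtain B where B: "B \<subseteq> G"
    and Bspan: "\<forall>u\<in>S a. \<exists>c. u - (\<Sum>b\<in>B. const (c b) * b) \<in> ?W"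
    and Bindep: "\<forall>c. (\<Sum>b\<in>B. const (c b) * b) \<in> ?W \<longrightarrow> (\<forall>b\<in>B. c b = 0)"
    by (rule mpoly_vs.basis_modulo_exists[where U = "S a" and W = ?W and G = G, OF W finG span])
  have finB: "finite B" using B finG by (rule finite_subset)
  have BS: "B \<subseteq> S a" using B GS by (rule subset_trans)
  have basis: "basis_mod (S a) ?W B"
    by (rule basis_modI[OF W finB BS]) (erule Bspan[rule_format], rule Bindep[rule_format])
  have "H a = int (card B)"
    unfolding hilbert_function_def using quotient_dim_eqI[OF W forms_0 basis] by (simp add: J_def)
  then show ?thesis
  proof (rule that[OF finB BS])
    show "\<forall>u\<in>S a. \<exists>c. u - (\<Sum>b\<in>B. const (c b) * b) \<in> J"
    proof
      fix u assume "u \<in> S a"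
      from bspec[OF Bspan this] obtain c where "u - (\<Sum>b\<in>B. const (c b) * b) \<in> ?W" by (rule exE)
      then show "\<exists>c. u - (\<Sum>b\<in>B. const (c b) * b) \<in> J" by (intro exI[of _ c]) simp
    qed
    show "\<forall>c. (\<Sum>b\<in>B. const (c b) * b) \<in> J \<longrightarrow> (\<forall>b\<in>B. c b = 0)"
    proof (intro allI impI)
      fix c assume c: "(\<Sum>b\<in>B. const (c b) * b) \<in> J"
      have "(\<Sum>b\<in>B. const (c b) * b) \<in> S a"
        using BS by (intro forms_sum const_mult_form) blast
      with c have "(\<Sum>b\<in>B. const (c b) * b) \<in> ?W" by (rule IntI)
      from Bindep[THEN spec, THEN mp, OF this] show "\<forall>b\<in>B. c b = 0" .
    qed
  qed
qed

lemma hilbert_function_outside: "\<not> 0 \<le> a \<Longrightarrow> H a = 0"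
proof -
  assume a: "\<not> 0 \<le> a"
  obtain B where B: "finite B" "B \<subseteq> S a" "H a = int (card B)"
    and indep: "\<forall>c. (\<Sum>b\<in>B. const (c b) * b) \<in> J \<longrightarrow> (\<forall>b\<in>B. c b = 0)"
    by (rule forms_basis_modulo)
  have zero: "b = 0" if "b \<in> B" for b using that B(2) a forms_eq_0 by blast
  have "B = {}"
  proof (rule ccontr)
    assume "B \<noteq> {}"
    then obtain b where b: "b \<in> B" by blast
    have "(\<Sum>b\<in>B. const (1::'k) * b) = 0" using zero by (intro sum.neutral) simp
    then have "(1::'k) = 0" using indep[rule_format, of "\<lambda>_. 1", OF _ b] J_closed(2) by simp
    then show False by simp
  qed
  then show ?thesis using B(3) by simp
qed

end


section \<open>Zero divisors with a parameter\<close>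

text \<open>
  McCoy's theorem for the linear polynomial \<open>l = \<Sum>\<^sub>j x\<^sub>j t^j\<close>.  Suppose that \<open>l G\<close> is zero modulo \<open>J\<close>, and let \<open>M\<close> be the
  degree of \<open>G\<close> modulo \<open>J\<close>.  Once \<open>x\<^sub>i G\<close> is known to be zero for all \<open>i > j\<close>, the coefficient of \<open>t^(j+M)\<close> in \<open>l G\<close>
  is \<open>x\<^sub>j\<close> times the leading coefficient of \<open>G\<close>.  So \<open>x\<^sub>j G\<close> has smaller degree and is still annihilated by \<open>l\<close>; by
  induction it is zero.  Thus all \<open>x\<^sub>j G\<close> are zero, and so is \<open>G\<close>.
\<close>

lemma McCoy_linear:
  fixes J A :: "'r::comm_ring_1 set" and x :: "nat \<Rightarrow> 'r" and G :: "'r poly"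
  assumes J0: "0 \<in> J" and Jadd: "\<And>p q. p \<in> J \<Longrightarrow> q \<in> J \<Longrightarrow> p + q \<in> J"
    and Jmult: "\<And>p h. p \<in> J \<Longrightarrow> h \<in> A \<Longrightarrow> h * p \<in> J"
    and Jdiff: "\<And>p q. p + q \<in> J \<Longrightarrow> q \<in> J \<Longrightarrow> p \<in> J"
    and A0: "0 \<in> A" and Amult: "\<And>p q. p \<in> A \<Longrightarrow> q \<in> A \<Longrightarrow> p * q \<in> A"
    and x: "\<And>j. x j \<in> A"
    and sat: "\<And>p. p \<in> A \<Longrightarrow> (\<And>j. j \<le> n \<Longrightarrow> x j * p \<in> J) \<Longrightarrow> p \<in> J"
    and GA: "\<And>k. coeff G k \<in> A"
    and kill: "\<And>k. coeff ((\<Sum>j\<le>n. monom (x j) j) * G) k \<in> J"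
  shows "coeff G k \<in> J"
proof -
  let ?l = "\<Sum>j\<le>n. monom (x j) j"
  have Jsum: "sum f K \<in> J" if "\<And>k. k \<in> K \<Longrightarrow> f k \<in> J" for f :: "nat \<Rightarrow> 'r" and K
    using that by (induction K rule: infinite_finite_induct) (auto intro: J0 Jadd)
  have coeff_l: "coeff (?l * G) k = (\<Sum>j\<le>n. if j \<le> k then x j * coeff G (k - j) else 0)" for G k
    unfolding sum_distrib_right coeff_sum coeff_monom_mult by (intro sum.cong) auto
  have main: "\<forall>k. coeff G k \<in> J"
    if "\<forall>k\<ge>M. coeff G k \<in> J" "\<forall>k. coeff G k \<in> A" "\<forall>k. coeff (?l * G) k \<in> J" for M G
    using that
  proof (induction M arbitrary: G)
    case (Suc M)
    have xG: "\<forall>k. x j * coeff G k \<in> J" if "j \<le> n" for j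
      using that
    proof (induction "n - j" arbitrary: j rule: less_induct)
      case less
      have high: "x i * coeff G k \<in> J" if "j < i" "i \<le> n" for i k
        using less.hyps[of i] that less.prems by auto
      have "coeff (?l * G) (j + M) \<in> J" using Suc.prems(3) by blast
      also have "coeff (?l * G) (j + M) = x j * coeff G M
          + (\<Sum>i\<in>{..n} - {j}. if i \<le> j + M then x i * coeff G (j + M - i) else 0)"
        unfolding coeff_l using less.prems by (subst sum.remove[of _ j]) auto
      finally have "x j * coeff G M \<in> J"
      proof (rule Jdiff)
        show "(\<Sum>i\<in>{..n} - {j}. if i \<le> j + M then x i * coeff G (j + M - i) else 0) \<in> J"
        proof (rule Jsum)
          fix i assume i: "i \<in> {..n} - {j}"
          show "(if i \<le> j + M then x i * coeff G (j + M - i) else 0) \<in> J"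
          proof (cases "j < i")
            case False
            then have "j + M - i \<ge> Suc M" using i by auto
            then show ?thesis using Suc.prems(1) Jmult x J0 by auto
          qed (use i high J0 in auto)
        qed
      qed
      then have top: "x j * coeff G M \<in> J" .
      have "\<forall>k. coeff (smult (x j) G) k \<in> J"
      proof (rule Suc.IH)
        show "\<forall>k\<ge>M. coeff (smult (x j) G) k \<in> J"
        proof (intro allI impI)
          fix k assume "M \<le> k"
          then consider "k = M" | "Suc M \<le> k" by linarith
          then show "coeff (smult (x j) G) k \<in> J"
            using top Suc.prems(1) Jmult[OF _ x] by cases simp_all
        qed
        show "\<forall>k. coeff (smult (x j) G) k \<in> A" using Suc.prems(2) Amult[OF x] by simp
        show "\<forall>k. coeff (?l * smult (x j) G) k \<in> J"
          using Suc.prems(3) Jmult[OF _ x] by (simp only: mult_smult_right coeff_smult) blast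
      qed
      then show ?case by simp
    qed
    show ?case
    proof
      fix k
      show "coeff G k \<in> J" using sat[of "coeff G k"] Suc.prems(2) xG by simp
    qed
  qed auto
  have "\<forall>k\<ge>Suc (degree G). coeff G k \<in> J" using J0 by (simp add: coeff_eq_0)
  from main[OF this] show ?thesis using GA kill by simp
qed


section \<open>Growth of the Hilbert function\<close>

context closed_product_subscheme
begin

text \<open>
  \<open>Jt\<close> and \<open>St a\<close> are the extensions of \<open>J\<close> and \<open>S a\<close> by the parameter \<open>t\<close>, the variable of the outer polynomial ring.
\<close>

definition Jt :: "('q, 'k) mpoly poly set" where
  "Jt = {G. \<forall>k. coeff G k \<in> J}"

definition St :: "int ^ 'q \<Rightarrow> ('q, 'k) mpoly poly set" where
  "St a = {G. \<forall>k. coeff G k \<in> S a}"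

definition generic_form :: "'q \<Rightarrow> ('q, 'k) mpoly poly" where
  "generic_form i = (\<Sum>j\<le>n i. monom (var (i, j)) j)"

lemma Jt_subspace: "poly_vs.subspace Jt"
  by (rule poly_vs.subspaceI) (simp_all add: Jt_def J_closed const_in_R)

lemma Jt_mult:
  assumes G: "G \<in> Jt" and P: "\<And>k. coeff P k \<in> R"
  shows "P * G \<in> Jt"
proof -
  have "coeff (P * G) k \<in> J" for k
    unfolding coeff_mult using G P by (intro J_sum J_closed(4)) (simp_all add: Jt_def)
  then show ?thesis by (simp add: Jt_def)
qed

lemma St_add: "G \<in> St a \<Longrightarrow> G' \<in> St a \<Longrightarrow> G + G' \<in> St a"
  by (simp add: St_def forms_add)

lemma St_mult:
  assumes "P \<in> St a" "G \<in> St b"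
  shows "P * G \<in> St (a + b)"
proof -
  have "coeff (P * G) k \<in> S (a + b)" for k
    unfolding coeff_mult using assms by (intro forms_sum forms_mult) (simp_all add: St_def)
  then show ?thesis by (simp add: St_def)
qed

lemma St_monom: "F \<in> S a \<Longrightarrow> monom F k \<in> St a"
  by (simp add: St_def)

lemma St_in_R: "G \<in> St a \<Longrightarrow> coeff G k \<in> R"
  unfolding St_def using forms_in_R by blast

lemma coeff_generic_form: "coeff (generic_form i) k = (if k \<le> n i then var (i, k) else 0)"
  by (simp add: generic_form_def coeff_sum sum.delta)

lemma generic_form_St: "generic_form i \<in> St (axis i 1)"
proof -
  have "var (i, j) \<in> S (axis i 1)" if "j \<le> n i" for j
    using forms_var_power[of i UNIV j n 1] that by simp
  then show ?thesis by (simp add: St_def coeff_generic_form)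
qed

text \<open>
  McCoy's theorem applies because \<open>J\<close> is saturated with respect to the variables \<open>x\<^sub>i\<^sub>j\<close> for each single \<open>i\<close>.
\<close>

lemma generic_form_cancel:
  assumes G: "G \<in> St a" and lG: "generic_form i * G \<in> Jt"
  shows "G \<in> Jt"
proof -
  let ?x = "\<lambda>j. if j \<le> n i then var (i, j) else (0 :: ('q, 'k) mpoly)"
  have l_eq: "generic_form i = (\<Sum>j\<le>n i. monom (?x j) j)"
    unfolding generic_form_def by (intro sum.cong) auto
  have "coeff G k \<in> J" for k
  proof (rule McCoy_linear[where J = J and A = R and x = ?x and n = "n i" and G = G])
    show "p \<in> J" if "p + q \<in> J" "q \<in> J" for p q
      using mpoly_vs.subspace_diff[OF J_subspace that] by simp
    show "p \<in> J" if p: "p \<in> R" and xp: "\<And>j. j \<le> n i \<Longrightarrow> ?x j * p \<in> J" for p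
    proof (rule J_saturated[OF p])
      show "var (i, j) * p \<in> J" if "j \<le> n i" for j using xp[OF that] that by simp
    qed
    show "?x j \<in> R" for j using var_in_R const_in_R[of 0] by simp
    show "coeff ((\<Sum>j\<le>n i. monom (?x j) j) * G) k \<in> J" for k
      using lG unfolding l_eq Jt_def by blast
    show "0 \<in> R" using const_in_R[of 0] by simp
  qed (simp_all add: J_closed R_mult St_in_R[OF G])
  then show ?thesis by (simp add: Jt_def)
qed

text \<open>
  If \<open>B\<close> is a basis of the forms of degree \<open>a\<close> modulo \<open>J\<close>, these combinations of the elements \<open>b t^k\<close> represent each
  element of \<open>St a\<close> of degree less than \<open>N\<close> in \<open>t\<close> exactly once modulo \<open>Jt\<close>.
\<close>

definition combination :: "('q, 'k) mpoly set \<Rightarrow> nat \<Rightarrow> (('q, 'k) mpoly \<times> nat \<Rightarrow> 'k) \<Rightarrow> ('q, 'k) mpoly poly" where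
  "combination B N c = (\<Sum>p\<in>B \<times> {..<N}. smult (const (c p)) (monom (fst p) (snd p)))"

lemma coeff_combination:
  "coeff (combination B N c) k = (if k < N then \<Sum>b\<in>B. const (c (b, k)) * b else 0)"
proof -
  have "coeff (combination B N c) k = (\<Sum>p\<in>B \<times> {..<N}. if snd p = k then const (c p) * fst p else 0)"
    unfolding combination_def coeff_sum by (intro sum.cong) (auto simp: coeff_smult)
  also have "\<dots> = (\<Sum>b\<in>B. \<Sum>j<N. if j = k then const (c (b, j)) * b else 0)"
    by (simp only: sum.cartesian_product' fst_conv snd_conv)
  also have "\<dots> = (if k < N then \<Sum>b\<in>B. const (c (b, k)) * b else 0)"
    by (simp add: sum.delta)
  finally show ?thesis .
qed

lemma combination_independent:
  assumes indep: "\<forall>c. (\<Sum>b\<in>B. const (c b) * b) \<in> J \<longrightarrow> (\<forall>b\<in>B. c b = 0)"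
    and c: "combination B N c \<in> Jt" and p: "p \<in> B \<times> {..<N}"
  shows "c p = 0"
proof -
  obtain b k where p_eq: "p = (b, k)" by (cases p)
  have "coeff (combination B N c) k \<in> J" using c unfolding Jt_def by blast
  then have "(\<Sum>b\<in>B. const (c (b, k)) * b) \<in> J" using p by (simp add: coeff_combination p_eq)
  from indep[THEN spec[of _ "\<lambda>b. c (b, k)"], THEN mp, OF this] show ?thesis using p p_eq by simp
qed

lemma combination_spanning:
  assumes span: "\<forall>u\<in>S a. \<exists>c. u - (\<Sum>b\<in>B. const (c b) * b) \<in> J"
    and G: "G \<in> St a" "\<And>k. N \<le> k \<Longrightarrow> coeff G k = 0"
  shows "\<exists>c. G - combination B N c \<in> Jt"
proof -
  have "\<forall>k. \<exists>c. coeff G k - (\<Sum>b\<in>B. const (c b) * b) \<in> J"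
  proof
    fix k
    have "coeff G k \<in> S a" using G(1) by (simp add: St_def)
    from bspec[OF span this] show "\<exists>c. coeff G k - (\<Sum>b\<in>B. const (c b) * b) \<in> J" .
  qed
  from choice[OF this] obtain c where c: "\<forall>k. coeff G k - (\<Sum>b\<in>B. const (c k b) * b) \<in> J" by (rule exE)
  have "coeff (G - combination B N (\<lambda>(b, k). c k b)) k \<in> J" for k
    using spec[OF c, of k] G(2)[of k] J_closed(2) by (simp add: coeff_combination)
  then show ?thesis unfolding Jt_def by blast
qed

lemma combination_St:
  assumes "B \<subseteq> S a"
  shows "combination B N c \<in> St a"
proof -
  have "(\<Sum>b\<in>B. const (c (b, k)) * b) \<in> S a" for k
    using assms by (intro forms_sum const_mult_form) blast
  then show ?thesis by (simp add: St_def coeff_combination)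
qed

lemma generic_form_combination:
  "generic_form i * combination B N c
    = (\<Sum>p\<in>B \<times> {..<N}. smult (const (c p)) (generic_form i * monom (fst p) (snd p)))"
  unfolding combination_def sum_distrib_left mult_smult_right by (rule refl)

lemma le_of_mult_le_add:
  fixes h h' c :: nat
  assumes "\<And>N. h * N \<le> h' * (N + c)"
  shows "h \<le> h'"
proof (rule ccontr)
  assume "\<not> h \<le> h'"
  then have "Suc h' * (h' * c + 1) \<le> h * (h' * c + 1)" by (intro mult_right_mono) auto
  also have "\<dots> \<le> h' * (h' * c + 1 + c)" by (rule assms)
  finally show False by (simp add: algebra_simps)
qed

lemma coeff_generic_mult_monom_eq_0:
  assumes "k < N" "N + n i \<le> m"
  shows "coeff (generic_form i * monom b k) m = 0"
proof -
  have "coeff (monom b k * generic_form i) m = 0"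
    using assms by (simp add: coeff_monom_mult coeff_generic_form)
  then show ?thesis by (simp only: mult.commute)
qed

text \<open>
  Multiplication by the generic form is injective modulo \<open>J\<close> and raises the degree in \<open>t\<close> by at most \<open>n i\<close>, so that
  \<open>H(a) N \<le> H(a + e\<^sub>i) (N + n i)\<close> for all \<open>N\<close>.
\<close>

theorem hilbert_function_mono: "H a \<le> H (a + axis i 1)"
proof -
  obtain B where B: "finite B" "B \<subseteq> S a" "H a = int (card B)"
    and indep: "\<forall>c. (\<Sum>b\<in>B. const (c b) * b) \<in> J \<longrightarrow> (\<forall>b\<in>B. c b = 0)"
    by (rule forms_basis_modulo)
  obtain B' where B': "finite B'" "B' \<subseteq> S (a + axis i 1)" "H (a + axis i 1) = int (card B')"
    and span: "\<forall>u\<in>S (a + axis i 1). \<exists>c. u - (\<Sum>b\<in>B'. const (c b) * b) \<in> J"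
    by (rule forms_basis_modulo)
  have "card B * N \<le> card B' * (N + n i)" for N
  proof (rule ccontr)
    assume "\<not> card B * N \<le> card B' * (N + n i)"
    then have card: "card (B' \<times> {..<N + n i}) < card (B \<times> {..<N})"
      by (simp add: card_cartesian_product)
    have fin: "finite (B \<times> {..<N})" "finite (B' \<times> {..<N + n i})" using B(1) B'(1) by simp_all
    have "\<forall>p\<in>B \<times> {..<N}. \<exists>c. generic_form i * monom (fst p) (snd p) - combination B' (N + n i) c \<in> Jt"
    proof
      fix p assume p: "p \<in> B \<times> {..<N}"
      have "fst p \<in> S a" using p B(2) by auto
      then have "generic_form i * monom (fst p) (snd p) \<in> St (a + axis i 1)"
        using St_mult[OF generic_form_St St_monom] by (simp add: add.commute)
      then show "\<exists>c. generic_form i * monom (fst p) (snd p) - combination B' (N + n i) c \<in> Jt"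
        using p by (intro combination_spanning[OF span] coeff_generic_mult_monom_eq_0) auto
    qed
    from bchoice[OF this] obtain c where c: "\<And>p. p \<in> B \<times> {..<N} \<Longrightarrow>
        generic_form i * monom (fst p) (snd p) - combination B' (N + n i) (c p) \<in> Jt" by blast
    from poly_vs.exchange_modulo[where x = "\<lambda>p. generic_form i * monom (fst p) (snd p)"
        and y = "\<lambda>p. monom (fst p) (snd p)" and c = c, OF Jt_subspace fin card c[unfolded combination_def]]
    obtain l where l: "\<exists>p\<in>B \<times> {..<N}. l p \<noteq> 0" "generic_form i * combination B N l \<in> Jt"
      unfolding generic_form_combination by blast
    have "combination B N l \<in> Jt" using combination_St[OF B(2)] l(2) by (rule generic_form_cancel)
    then show False using l(1) combination_independent[OF indep] by blast
  qed
  then have "card B \<le> card B'" by (rule le_of_mult_le_add)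
  then show ?thesis using B(3) B'(3) by simp
qed

definition scalar :: "'k poly \<Rightarrow> ('q, 'k) mpoly poly" where
  "scalar d = map_poly const d"

lemma coeff_scalar: "coeff (scalar d) k = const (coeff d k)"
  by (simp add: scalar_def coeff_map_poly)

lemma scalar_mult: "scalar (d * e) = scalar d * scalar e"
  by (rule poly_eqI) (simp add: coeff_scalar coeff_mult const_sum const_mult)

lemma scalar_St: "scalar d \<in> St 0"
proof -
  have "const c * 1 \<in> S 0" for c :: 'k by (rule const_mult_form) simp
  then show ?thesis by (simp add: St_def coeff_scalar)
qed

text \<open>
  Up to a denominator in \<open>K[t]\<close>, each form of degree \<open>a + e\<^sub>i\<close> is a multiple of the generic form modulo \<open>J\<close>; that is,
  multiplication by the generic form is onto over \<open>K(t)\<close>.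
\<close>

definition generically_divisible :: "'q \<Rightarrow> int ^ 'q \<Rightarrow> bool" where
  "generically_divisible i a \<longleftrightarrow> (\<forall>F\<in>S (a + axis i 1). \<exists>d G. d \<noteq> 0 \<and> G \<in> St a \<and>
     scalar d * [:F:] - generic_form i * G \<in> Jt)"

text \<open>
  An injective map between spaces of equal dimension is onto.  In terms of degrees in \<open>t\<close>: for \<open>h = H(a)\<close>, the \<open>h N\<close>
  multiples of the generic form together with \<open>h n\<^sub>i + 1\<close> multiples \<open>F t^k\<close> exceed the dimension \<open>h (N + n\<^sub>i)\<close> of the space
  they lie in.  In the resulting relation the part with \<open>F\<close> cannot be trivial, as the generic form is not a zero
  divisor.
\<close>

lemma generically_divisible_of_eq:
  assumes eq: "H (a + axis i 1) = H a"
  shows "generically_divisible i a"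
  unfolding generically_divisible_def
proof
  fix F assume F: "F \<in> S (a + axis i 1)"
  obtain B where B: "finite B" "B \<subseteq> S a" "H a = int (card B)"
    and indep: "\<forall>c. (\<Sum>b\<in>B. const (c b) * b) \<in> J \<longrightarrow> (\<forall>b\<in>B. c b = 0)"
    by (rule forms_basis_modulo)
  obtain B' where B': "finite B'" "B' \<subseteq> S (a + axis i 1)" "H (a + axis i 1) = int (card B')"
    and span: "\<forall>u\<in>S (a + axis i 1). \<exists>c. u - (\<Sum>b\<in>B'. const (c b) * b) \<in> J"
    by (rule forms_basis_modulo)
  \<comment> \<open>the number of powers of \<open>t\<close> that multiply \<open>F\<close>; it also serves for the multiples of the generic form\<close>
  define N where "N = card B * n i + 1"
  have cardB: "card B' = card B" using eq B(3) B'(3) by simp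
  let ?L = "B \<times> {..<N}" and ?K = "{..<N}" and ?M = "B' \<times> {..<N + n i}"
  define x where "x = case_sum (\<lambda>p. generic_form i * monom (fst p) (snd p)) (\<lambda>k. monom F k)"
  have fin: "finite (?L <+> ?K)" "finite ?M" using B(1) B'(1) by simp_all
  have card: "card ?M < card (?L <+> ?K)"
    using B(1) by (simp add: card_Plus card_cartesian_product cardB N_def algebra_simps)
  have "\<forall>p\<in>?L <+> ?K. \<exists>c. x p - combination B' (N + n i) c \<in> Jt"
  proof
    fix p assume "p \<in> ?L <+> ?K"
    then show "\<exists>c. x p - combination B' (N + n i) c \<in> Jt"
    proof (rule PlusE)
      fix r assume r: "r \<in> ?L" "p = Inl r"
      have "fst r \<in> S a" using r(1) B(2) by auto
      then have "generic_form i * monom (fst r) (snd r) \<in> St (a + axis i 1)"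
        using St_mult[OF generic_form_St St_monom] by (simp add: add.commute)
      then have "\<exists>c. generic_form i * monom (fst r) (snd r) - combination B' (N + n i) c \<in> Jt"
        using r(1) by (intro combination_spanning[OF span] coeff_generic_mult_monom_eq_0) auto
      then show ?thesis by (simp add: x_def r(2))
    next
      fix k assume k: "k \<in> ?K" "p = Inr k"
      have "\<exists>c. monom F k - combination B' (N + n i) c \<in> Jt"
        using k(1) by (intro combination_spanning[OF span] St_monom[OF F]) auto
      then show ?thesis by (simp add: x_def k(2))
    qed
  qed
  from bchoice[OF this] obtain c where
    c: "\<And>p. p \<in> ?L <+> ?K \<Longrightarrow> x p - combination B' (N + n i) (c p) \<in> Jt" by blast
  from poly_vs.exchange_modulo[where x = x
      and y = "\<lambda>p. monom (fst p) (snd p)" and c = c, OF Jt_subspace fin card c[unfolded combination_def]]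
  obtain l where l: "\<exists>p\<in>?L <+> ?K. l p \<noteq> 0" "(\<Sum>p\<in>?L <+> ?K. smult (const (l p)) (x p)) \<in> Jt"
    by blast
  define d where "d = (\<Sum>k<N. monom (l (Inr k)) k)"
  define G where "G = combination B N (\<lambda>p. l (Inl p))"
  have coeff_d: "coeff d k = (if k < N then l (Inr k) else 0)" for k
    by (simp add: d_def coeff_sum sum.delta)
  have "(\<Sum>p\<in>?L <+> ?K. smult (const (l p)) (x p)) =
      (\<Sum>p\<in>?L. smult (const (l (Inl p))) (x (Inl p))) + (\<Sum>k<N. smult (const (l (Inr k))) (x (Inr k)))"
    using B(1) by (simp add: sum.Plus)
  also have "(\<Sum>p\<in>?L. smult (const (l (Inl p))) (x (Inl p))) = generic_form i * G"
    unfolding G_def generic_form_combination x_def by simp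
  also have "(\<Sum>k<N. smult (const (l (Inr k))) (x (Inr k))) = scalar d * [:F:]"
  proof (rule poly_eqI)
    fix m
    have "coeff (\<Sum>k<N. smult (const (l (Inr k))) (x (Inr k))) m =
        (\<Sum>k<N. if k = m then const (l (Inr k)) * F else 0)"
      unfolding coeff_sum x_def by (intro sum.cong) auto
    also have "\<dots> = coeff (scalar d * [:F:]) m"
      by (simp add: sum.delta coeff_scalar coeff_d mult.commute[of F])
    finally show "coeff (\<Sum>k<N. smult (const (l (Inr k))) (x (Inr k))) m = coeff (scalar d * [:F:]) m" .
  qed
  finally have in_Jt: "generic_form i * G + scalar d * [:F:] \<in> Jt" using l(2) by simp
  have G_St: "G \<in> St a" unfolding G_def by (rule combination_St[OF B(2)])
  have d0: "d \<noteq> 0"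
  proof
    assume "d = 0"
    then have r0: "l (Inr k) = 0" if "k < N" for k using coeff_d[of k] that by simp
    have "generic_form i * G \<in> Jt" using in_Jt \<open>d = 0\<close> by (simp add: scalar_def)
    then have "G \<in> Jt" by (rule generic_form_cancel[OF G_St])
    then have l0: "l (Inl p) = 0" if "p \<in> ?L" for p
      using combination_independent[OF indep _ that] unfolding G_def by blast
    show False using l(1) r0 l0 by auto
  qed
  have "- p \<in> S a" if "p \<in> S a" for p using mpoly_vs.subspace_neg[OF forms_subspace that] .
  then have "- G \<in> St a" using G_St by (simp add: St_def)
  moreover have "scalar d * [:F:] - generic_form i * - G \<in> Jt"
    using in_Jt by (simp add: add.commute)
  ultimately show "\<exists>d G. d \<noteq> 0 \<and> G \<in> St a \<and> scalar d * [:F:] - generic_form i * G \<in> Jt"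
    using d0 by (intro exI[of _ d] exI[of _ "- G"] conjI)
qed

text \<open>
  A monomial of degree \<open>a + e\<^sub>i\<close> is a multiple of one of degree \<open>(k+1) e\<^sub>i\<close>, for which the claim is known.
\<close>

lemma generically_divisible_extend:
  assumes k: "0 \<le> k" and div: "generically_divisible i (axis i k)" and a: "k \<le> a $ i"
  shows "generically_divisible i a"
  unfolding generically_divisible_def
proof
  fix F assume F: "F \<in> S (a + axis i 1)"
  let ?D = "\<lambda>F. \<exists>d G. d \<noteq> 0 \<and> G \<in> St a \<and> scalar d * [:F:] - generic_form i * G \<in> Jt"
  have zero: "?D 0"
    by (intro exI[of _ 1] exI[of _ 0]) (simp add: St_def Jt_def J_closed)
  have add: "?D (F1 + F2)" if D1: "?D F1" and D2: "?D F2" for F1 F2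
  proof -
    obtain d1 G1 where 1: "d1 \<noteq> 0" "G1 \<in> St a" "scalar d1 * [:F1:] - generic_form i * G1 \<in> Jt"
      using D1 by (elim exE conjE)
    obtain d2 G2 where 2: "d2 \<noteq> 0" "G2 \<in> St a" "scalar d2 * [:F2:] - generic_form i * G2 \<in> Jt"
      using D2 by (elim exE conjE)
    have "scalar d2 * (scalar d1 * [:F1:] - generic_form i * G1)
        + scalar d1 * (scalar d2 * [:F2:] - generic_form i * G2) \<in> Jt"
      using 1(3) 2(3) St_in_R[OF scalar_St] by (intro poly_vs.subspace_add[OF Jt_subspace] Jt_mult)
    also have "scalar d2 * (scalar d1 * [:F1:] - generic_form i * G1)
        + scalar d1 * (scalar d2 * [:F2:] - generic_form i * G2)
        = scalar (d1 * d2) * [:F1 + F2:] - generic_form i * (scalar d2 * G1 + scalar d1 * G2)"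
    proof -
      have "[:F1 + F2:] = [:F1:] + [:F2:]" by simp
      then show ?thesis by (simp only: scalar_mult) (simp only: algebra_simps)
    qed
    finally have in_Jt: "scalar (d1 * d2) * [:F1 + F2:] - generic_form i * (scalar d2 * G1 + scalar d1 * G2) \<in> Jt" .
    have "scalar d2 * G1 + scalar d1 * G2 \<in> St a"
      using St_add[OF St_mult[OF scalar_St 1(2)] St_mult[OF scalar_St 2(2)]] by simp
    moreover have "d1 * d2 \<noteq> 0" using 1 2 by simp
    ultimately show ?thesis using in_Jt
      by (intro exI[of _ "d1 * d2"] exI[of _ "scalar d2 * G1 + scalar d1 * G2"] conjI)
  qed
  have single: "?D (Poly_Mapping.single m c)" if m: "m \<in> monomials_of n (a + axis i 1)" for m c
  proof -
    have "int (nat (k + 1)) \<le> multidegree m $ i"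
      using m a k by (simp add: monomials_of_def axis_def)
    then obtain m1 m2 where m12: "m = m1 + m2" "multidegree m1 = axis i (int (nat (k + 1)))"
      by (rule split_monomial)
    have deg1: "multidegree m1 = axis i k + axis i 1" using m12(2) k by (simp flip: axis_add)
    have "multidegree m = a + axis i 1" using m by (simp add: monomials_of_def)
    then have deg2: "multidegree m2 = a - axis i k"
      using deg1 m12(1) by (simp add: multidegree_add algebra_simps)
    have "Poly_Mapping.keys m1 \<subseteq> Poly_Mapping.keys m" "Poly_Mapping.keys m2 \<subseteq> Poly_Mapping.keys m"
      by (auto simp: m12(1) in_keys_iff lookup_add)
    then have m1: "m1 \<in> monomials_of n (axis i k + axis i 1)" and m2: "m2 \<in> monomials_of n (a - axis i k)"
      using m deg1 deg2 by (auto simp: monomials_of_def)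
    let ?F1 = "Poly_Mapping.single m1 (1::'k)" and ?F2 = "Poly_Mapping.single m2 c"
    obtain d G where dG: "d \<noteq> 0" "G \<in> St (axis i k)" "scalar d * [:?F1:] - generic_form i * G \<in> Jt"
      using div single_in_forms[OF m1] unfolding generically_divisible_def by blast
    have F2: "[:?F2:] \<in> St (a - axis i k)"
      using St_monom[OF single_in_forms[OF m2], of c 0] by (simp add: monom_0)
    have "[:?F2:] * (scalar d * [:?F1:] - generic_form i * G) \<in> Jt"
      using dG(3) St_in_R[OF F2] by (rule Jt_mult)
    also have "[:?F2:] * (scalar d * [:?F1:] - generic_form i * G)
        = scalar d * ([:?F1:] * [:?F2:]) - generic_form i * ([:?F2:] * G)"
      by (simp only: algebra_simps)
    also have "[:?F1:] * [:?F2:] = [:Poly_Mapping.single m c:]"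
      by (simp add: mult_single m12(1) add.commute)
    finally have "scalar d * [:Poly_Mapping.single m c:] - generic_form i * ([:?F2:] * G) \<in> Jt" .
    moreover have "[:?F2:] * G \<in> St a" using St_mult[OF F2 dG(2)] by simp
    ultimately show ?thesis using dG(1)
      by (intro exI[of _ d] exI[of _ "[:?F2:] * G"] conjI)
  qed
  have "?D (\<Sum>m\<in>K. Poly_Mapping.single m (Poly_Mapping.lookup F m))" if "finite K" "K \<subseteq> Poly_Mapping.keys F" for K
    using that
  proof (induction K rule: finite_induct)
    case empty
    then show ?case using zero by simp
  next
    case (insert m K)
    have "m \<in> monomials_of n (a + axis i 1)" using insert.prems forms_keys[OF F] by blast
    from add[OF single[OF this] insert.IH] insert.prems show ?case by (simp add: insert.hyps)
  qed
  from this[of "Poly_Mapping.keys F"] show "?D F" by (simp flip: poly_mapping_sum_single)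
qed

text \<open>
  The multiples \<open>d\<^sub>b b t^k\<close>, \<open>k < N\<close>, of a basis in degree \<open>a + e\<^sub>i\<close> are independent and are combinations of the
  generic form times a basis in degree \<open>a\<close>.  The shift \<open>D\<close> in the degree of \<open>t\<close> does not depend on \<open>N\<close>, whence the
  inequality in the limit.
\<close>

lemma hilbert_function_le_of_generically_divisible:
  assumes div: "generically_divisible i a"
  shows "H (a + axis i 1) \<le> H a"
proof -
  obtain B where B: "finite B" "B \<subseteq> S a" "H a = int (card B)"
    and span: "\<forall>u\<in>S a. \<exists>c. u - (\<Sum>b\<in>B. const (c b) * b) \<in> J"
    by (rule forms_basis_modulo)
  obtain B' where B': "finite B'" "B' \<subseteq> S (a + axis i 1)" "H (a + axis i 1) = int (card B')"
    and indep: "\<forall>c. (\<Sum>b\<in>B'. const (c b) * b) \<in> J \<longrightarrow> (\<forall>b\<in>B'. c b = 0)"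
    by (rule forms_basis_modulo)
  have "\<forall>b\<in>B'. \<exists>dG. fst dG \<noteq> 0 \<and> snd dG \<in> St a \<and> scalar (fst dG) * [:b:] - generic_form i * snd dG \<in> Jt"
  proof
    fix b assume "b \<in> B'"
    then have "b \<in> S (a + axis i 1)" using B'(2) by blast
    with div obtain d G where "d \<noteq> 0 \<and> G \<in> St a \<and> scalar d * [:b:] - generic_form i * G \<in> Jt"
      unfolding generically_divisible_def by blast
    then show "\<exists>dG. fst dG \<noteq> 0 \<and> snd dG \<in> St a \<and> scalar (fst dG) * [:b:] - generic_form i * snd dG \<in> Jt"
      by (intro exI[of _ "(d, G)"]) simp
  qed
  from bchoice[OF this] obtain dG where dG: "\<forall>b\<in>B'. fst (dG b) \<noteq> 0 \<and> snd (dG b) \<in> St a \<and>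
      scalar (fst (dG b)) * [:b:] - generic_form i * snd (dG b) \<in> Jt" by (rule exE)
  define d where "d b = fst (dG b)" for b
  define G where "G b = snd (dG b)" for b
  have d0: "d b \<noteq> 0" and G_St: "G b \<in> St a" and eq: "scalar (d b) * [:b:] - generic_form i * G b \<in> Jt"
    if "b \<in> B'" for b
    using dG that by (simp_all add: d_def G_def)
  define D where "D = Suc (\<Sum>b\<in>B'. degree (G b))"
  have degG: "degree (G b) < D" if "b \<in> B'" for b
    unfolding D_def using B'(1) that by (auto simp: less_Suc_eq_le intro: member_le_sum)
  have "card B' * N \<le> card B * (N + D)" for N
  proof (rule ccontr)
    assume "\<not> card B' * N \<le> card B * (N + D)"
    then have card: "card (B \<times> {..<N + D}) < card (B' \<times> {..<N})"
      by (simp add: card_cartesian_product)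
    have fin: "finite (B' \<times> {..<N})" "finite (B \<times> {..<N + D})" using B(1) B'(1) by simp_all
    define x where "x p = monom 1 (snd p) * (scalar (d (fst p)) * [:fst p:])" for p :: "('q, 'k) mpoly \<times> nat"
    have "\<forall>p\<in>B' \<times> {..<N}. \<exists>c. x p - generic_form i * combination B (N + D) c \<in> Jt"
    proof
      fix p assume p: "p \<in> B' \<times> {..<N}"
      obtain b k where bk: "p = (b, k)" "b \<in> B'" "k < N" using p by (cases p) auto
      have monom_R: "coeff (monom (1 :: ('q, 'k) mpoly) k) m \<in> R" for m
        using const_in_R[of 0] const_in_R[of 1] by simp
      have "monom 1 k \<in> St 0" by (simp add: St_def)
      from St_mult[OF this G_St[OF bk(2)]] have tG: "monom 1 k * G b \<in> St a" by simp
      have "coeff (monom 1 k * G b) m = 0" if "N + D \<le> m" for m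
        using that degG[OF bk(2)] bk(3) by (simp add: coeff_monom_mult coeff_eq_0)
      then obtain c where c: "monom 1 k * G b - combination B (N + D) c \<in> Jt"
        using combination_spanning[OF span tG] by blast
      have "monom 1 k * (scalar (d b) * [:b:] - generic_form i * G b)
          + generic_form i * (monom 1 k * G b - combination B (N + D) c) \<in> Jt"
        using eq[OF bk(2)] c monom_R St_in_R[OF generic_form_St]
        by (intro poly_vs.subspace_add[OF Jt_subspace] Jt_mult)
      also have "monom 1 k * (scalar (d b) * [:b:] - generic_form i * G b)
          + generic_form i * (monom 1 k * G b - combination B (N + D) c)
          = x p - generic_form i * combination B (N + D) c"
        unfolding x_def bk(1) fst_conv snd_conv by (simp only: algebra_simps)
      finally show "\<exists>c. x p - generic_form i * combination B (N + D) c \<in> Jt" by (rule exI[of _ c])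
    qed
    from bchoice[OF this] obtain c where
      c: "\<And>p. p \<in> B' \<times> {..<N} \<Longrightarrow> x p - generic_form i * combination B (N + D) (c p) \<in> Jt" by blast
    from poly_vs.exchange_modulo[where x = x and y = "\<lambda>p. generic_form i * monom (fst p) (snd p)"
        and c = c, OF Jt_subspace fin card c[unfolded generic_form_combination]]
    obtain l where l: "\<exists>p\<in>B' \<times> {..<N}. l p \<noteq> 0" "(\<Sum>p\<in>B' \<times> {..<N}. smult (const (l p)) (x p)) \<in> Jt"
      by blast
    define e where "e b = d b * (\<Sum>k<N. monom (l (b, k)) k)" for b
    have "(\<Sum>p\<in>B' \<times> {..<N}. smult (const (l p)) (x p)) = (\<Sum>b\<in>B'. scalar (e b) * [:b:])"
    proof -
      have "(\<Sum>k<N. smult (const (l (b, k))) (x (b, k))) = scalar (e b) * [:b:]" for b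
      proof -
        have "smult (const (l (b, k))) (x (b, k)) = scalar (d b) * scalar (monom (l (b, k)) k) * [:b:]" for k
          by (rule poly_eqI) (simp add: x_def scalar_def map_poly_monom coeff_monom_mult
              mult.commute[of "map_poly const (d b)"] mult.assoc)
        then have "(\<Sum>k<N. smult (const (l (b, k))) (x (b, k))) = scalar (d b) * (\<Sum>k<N. scalar (monom (l (b, k)) k)) * [:b:]"
          by (simp only: sum_distrib_left sum_distrib_right)
        also have "(\<Sum>k<N. scalar (monom (l (b, k)) k)) = scalar (\<Sum>k<N. monom (l (b, k)) k)"
          by (rule poly_eqI) (simp only: coeff_sum coeff_scalar const_sum)
        finally show ?thesis by (simp only: e_def scalar_mult)
      qed
      then show ?thesis by (simp add: sum.cartesian_product' del: mult_pCons_right)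
    qed
    then have sum_Jt: "(\<Sum>b\<in>B'. scalar (e b) * [:b:]) \<in> Jt" using l(2) by simp
    have e0: "e b = 0" if b: "b \<in> B'" for b
    proof (rule poly_eqI)
      fix m
      have "coeff (\<Sum>b\<in>B'. scalar (e b) * [:b:]) m \<in> J" using sum_Jt unfolding Jt_def by blast
      then have "(\<Sum>b\<in>B'. const (coeff (e b) m) * b) \<in> J"
        by (simp add: coeff_sum coeff_scalar mult.commute)
      from indep[THEN spec[of _ "\<lambda>b. coeff (e b) m"], THEN mp, OF this] b
      show "coeff (e b) m = coeff 0 m" by simp
    qed
    have "l (b, k) = 0" if b: "b \<in> B'" and k: "k < N" for b k
    proof -
      have "(\<Sum>k<N. monom (l (b, k)) k) = 0" using e0[OF b] d0[OF b] by (simp add: e_def)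
      then have "coeff (\<Sum>k<N. monom (l (b, k)) k) k = 0" by simp
      then show ?thesis using k by (simp add: coeff_sum sum.delta)
    qed
    then show False using l(1) by auto
  qed
  then have "card B' \<le> card B" by (rule le_of_mult_le_add)
  then show ?thesis using B(3) B'(3) by simp
qed

theorem hilbert_function_stable:
  assumes "0 \<le> k" "H (axis i k + axis i 1) = H (axis i k)" "k \<le> a $ i"
  shows "H (a + axis i 1) = H a"
  using hilbert_function_mono[of a i]
    hilbert_function_le_of_generically_divisible[OF
      generically_divisible_extend[OF assms(1) generically_divisible_of_eq[OF assms(2)] assms(3)]]
  by simp

end


section \<open>The regularity index and relevant domains\<close>

lemma dehom_const_mult: "dehom \<sigma> (const c * p) = const c * dehom \<sigma> p"
proof -
  have "dehom_monomial \<sigma> 0 = 0" by (rule poly_mapping_eqI) (simp add: lookup_dehom_monomial)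
  then have "dehom \<sigma> (const c) = const c" by (simp add: const_def dehom_single)
  then show ?thesis by (simp add: dehom_mult)
qed

text \<open>
  A monomial of degree \<open>k e\<^sub>i\<close> only involves the variables \<open>x\<^sub>i\<^sub>j\<close>.
\<close>

lemma forms_axis: "forms {i} n (axis i k) = forms UNIV n (axis i k)"
proof
  show "forms {i} n (axis i k) \<subseteq> forms UNIV n (axis i k)"
    by (auto simp: forms_def coord_ring_def polys_in_def)
  show "forms UNIV n (axis i k) \<subseteq> forms {i} n (axis i k)"
  proof
    fix F assume F: "F \<in> forms UNIV n (axis i k)"
    have "Poly_Mapping.keys m \<subseteq> {(i', j). i' \<in> {i} \<and> j \<le> n i'}" if m: "m \<in> Poly_Mapping.keys F" for m
    proof
      fix v assume v: "v \<in> Poly_Mapping.keys m"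
      have "multidegree m = axis i k" using F m by (simp add: forms_def)
      then have "int (Poly_Mapping.lookup m v) \<le> axis i k $ fst v"
        using lookup_le_multidegree[of m v] by simp
      moreover have "Poly_Mapping.lookup m v \<noteq> 0" using v by (simp add: in_keys_iff)
      ultimately have "fst v = i" by (auto simp: axis_def split: if_splits)
      moreover have "snd v \<le> n (fst v)" using F m v by (force simp: forms_def coord_ring_def polys_in_def)
      ultimately show "v \<in> {(i', j). i' \<in> {i} \<and> j \<le> n i'}" by auto
    qed
    then show "F \<in> forms {i} n (axis i k)" using F by (simp add: forms_def coord_ring_def polys_in_def)
  qed
qed

context closed_product_subscheme
begin

lemma finite_charts: "finite (charts UNIV n)"
  unfolding charts_def by (intro finite_PiE) auto

text \<open>
  A strict inclusion of primes containing \<open>X \<sigma>\<close> would be a chain of length one.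
\<close>

lemma chart_finite_codimension:
  assumes dim: "has_dimension UNIV n X 0" and \<sigma>: "\<sigma> \<in> charts UNIV n"
  shows "\<exists>B. finite B \<and> (\<forall>u\<in>chart_ring UNIV n \<sigma>. \<exists>c. u - (\<Sum>b\<in>B. const (c b) * b) \<in> X \<sigma>)"
proof -
  let ?V = "{(i, j). i \<in> UNIV \<and> j \<le> n i \<and> j \<noteq> \<sigma> i}"
  have "?V \<subseteq> (SIGMA i:UNIV. {..n i})" by auto
  then have V: "finite ?V" by (rule finite_subset) auto
  have I: "ideal (X \<sigma>) (subring_of (polys_in ?V))"
    using chart_ideal[OF \<sigma>] unfolding chart_ring_def .
  have dim0: "P = Q"
    if PQ: "primeideal P (subring_of (polys_in ?V))" "primeideal Q (subring_of (polys_in ?V))" "X \<sigma> \<subseteq> P" "P \<subseteq> Q"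
    for P Q
  proof (rule ccontr)
    assume "P \<noteq> Q"
    \<comment> \<open>the chain \<open>P \<subset> Q\<close>, indexed as in the definition of dimension\<close>
    define C where "C k = (if k = 0 then P else Q)" for k :: nat
    have "\<forall>k\<le>1. primeideal (C k) (subring_of (chart_ring UNIV n \<sigma>)) \<and> X \<sigma> \<subseteq> C k"
      using PQ by (auto simp: C_def chart_ring_def)
    moreover have "\<forall>k<1. C k \<subset> C (Suc k)" using PQ \<open>P \<noteq> Q\<close> by (auto simp: C_def)
    ultimately have "1 \<in> chain_lengths UNIV n X" unfolding chain_lengths_def using \<sigma> by blast
    then show False using dim by (auto simp: has_dimension_def)
  qed
  obtain B where B: "finite B" "\<And>u. u \<in> polys_in ?V \<Longrightarrow> \<exists>c. u - (\<Sum>b\<in>B. const (c b) * b) \<in> X \<sigma>"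
    using finite_codimension[OF V I dim0] by blast
  then show ?thesis unfolding chart_ring_def by (intro exI[of _ B] conjI ballI)
qed

text \<open>
  The forms of degree \<open>a\<close> modulo \<open>J\<close> embed into the product of the finite-dimensional rings of the charts.
\<close>

lemma hilbert_function_bounded:
  assumes dim: "has_dimension UNIV n X 0"
  shows "\<exists>C. \<forall>a. H a \<le> int C"
proof -
  have "\<forall>\<sigma>\<in>charts UNIV n. \<exists>B. finite B \<and>
      (\<forall>u\<in>chart_ring UNIV n \<sigma>. \<exists>c. u - (\<Sum>b\<in>B. const (c b) * b) \<in> X \<sigma>)"
    using chart_finite_codimension[OF dim] by (rule ballI)
  from bchoice[OF this] obtain E where E: "\<forall>\<sigma>\<in>charts UNIV n. finite (E \<sigma>) \<and>
      (\<forall>u\<in>chart_ring UNIV n \<sigma>. \<exists>c. u - (\<Sum>b\<in>E \<sigma>. const (c b) * b) \<in> X \<sigma>)" by (rule exE)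
  let ?M = "SIGMA \<sigma>:charts UNIV n. E \<sigma>"
  have finM: "finite ?M" using finite_charts E by (intro finite_SigmaI) simp_all
  have "H a \<le> int (card ?M)" for a
  proof (rule ccontr)
    assume "\<not> H a \<le> int (card ?M)"
    moreover obtain B where B: "finite B" "B \<subseteq> S a" "H a = int (card B)"
      and indep: "\<forall>c. (\<Sum>b\<in>B. const (c b) * b) \<in> J \<longrightarrow> (\<forall>b\<in>B. c b = 0)"
      by (rule forms_basis_modulo)
    ultimately have card: "card ?M < card B" by simp
    have "\<forall>p\<in>B \<times> charts UNIV n. \<exists>c. dehom (snd p) (fst p) - (\<Sum>e\<in>E (snd p). const (c e) * e) \<in> X (snd p)"
    proof
      fix p assume p: "p \<in> B \<times> charts UNIV n"
      then have "fst p \<in> R" using B(2) forms_in_R by auto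
      then have "dehom (snd p) (fst p) \<in> chart_ring UNIV n (snd p)" by (rule dehom_coord_ring)
      moreover have "snd p \<in> charts UNIV n" using p by auto
      ultimately show "\<exists>c. dehom (snd p) (fst p) - (\<Sum>e\<in>E (snd p). const (c e) * e) \<in> X (snd p)"
        using E by simp
    qed
    from bchoice[OF this] obtain c where c: "\<forall>p\<in>B \<times> charts UNIV n.
        dehom (snd p) (fst p) - (\<Sum>e\<in>E (snd p). const (c p e) * e) \<in> X (snd p)" by (rule exE)
    obtain l where l: "\<exists>b\<in>B. l b \<noteq> 0" "\<forall>q\<in>?M. (\<Sum>b\<in>B. l b * c (b, fst q) (snd q)) = 0"
      using underdetermined_system[OF finM B(1) card, of "\<lambda>b q. c (b, fst q) (snd q)"] by blast
    let ?F = "\<Sum>b\<in>B. const (l b) * b"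
    have F: "?F \<in> S a" using B(2) by (intro forms_sum const_mult_form) blast
    have "dehom \<sigma> ?F \<in> X \<sigma>" if \<sigma>: "\<sigma> \<in> charts UNIV n" for \<sigma>
    proof -
      have "(\<Sum>b\<in>B. const (l b) * (\<Sum>e\<in>E \<sigma>. const (c (b, \<sigma>) e) * e))
          = (\<Sum>e\<in>E \<sigma>. const (\<Sum>b\<in>B. l b * c (b, \<sigma>) e) * e)"
        unfolding const_sum const_mult sum_distrib_left sum_distrib_right mult.assoc by (rule sum.swap)
      also have "\<dots> = 0" using l(2) \<sigma> by (intro sum.neutral) auto
      finally have "dehom \<sigma> ?F = (\<Sum>b\<in>B. const (l b) * (dehom \<sigma> b - (\<Sum>e\<in>E \<sigma>. const (c (b, \<sigma>) e) * e)))"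
        by (simp add: dehom_sum dehom_const_mult right_diff_distrib sum_subtractf)
      also have "\<dots> \<in> X \<sigma>"
      proof -
        have "const (l b) * (dehom \<sigma> b - (\<Sum>e\<in>E \<sigma>. const (c (b, \<sigma>) e) * e)) \<in> X \<sigma>" if b: "b \<in> B" for b
        proof (rule X_closed(3)[OF \<sigma>])
          show "dehom \<sigma> b - (\<Sum>e\<in>E \<sigma>. const (c (b, \<sigma>) e) * e) \<in> X \<sigma>"
            using bspec[OF c, of "(b, \<sigma>)"] b \<sigma> by simp
        qed (simp add: chart_ring_def)
        then show ?thesis
          by (induction B rule: infinite_finite_induct) (simp_all add: X_closed[OF \<sigma>])
      qed
      finally show ?thesis .
    qed
    then have "?F \<in> J" using J_form_iff[OF F] by blast
    from indep[THEN spec, THEN mp, OF this] l(1) show False by blast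
  qed
  then show ?thesis by blast
qed

text \<open>
  In degree \<open>k e\<^sub>i\<close> the coordinate ring and the ideal of the projection agree with those of \<open>X\<close>.
\<close>

lemma hilbert_function_projection:
  "hilbert_function {i} n (projection n i X) (axis i k) = H (axis i k)"
proof -
  have "forms UNIV n (axis i k) \<subseteq> (coord_ring {i} n :: ('q, 'k) mpoly set)"
    using forms_axis[of i n k] by (auto simp: forms_def)
  then show ?thesis
    unfolding hilbert_function_def vanishing_ideal_projection[OF closed] forms_axis
    by (simp add: Int_assoc Int_absorb1)
qed

lemma regularity_index_eq:
  fixes r :: int
  assumes r: "0 \<le> r" "H (axis i (r + 1)) = H (axis i r)"
    and below: "\<And>k. 0 \<le> k \<Longrightarrow> k < r \<Longrightarrow> H (axis i (k + 1)) \<noteq> H (axis i k)"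
  shows "regularity_index n i (projection n i X) = r"
proof -
  have mono1: "H (axis i k) \<le> H (axis i (k + 1))" for k
    using hilbert_function_mono[of "axis i k" i] by (simp add: axis_add)
  have mono: "H (axis i k) \<le> H (axis i l)" if "k \<le> l" for k l
    using that by (induction l rule: int_ge_induct) (auto intro: order_trans mono1)
  have step: "H (axis i (k + 1)) = H (axis i k)" if "r \<le> k" for k
    using hilbert_function_stable[of r i "axis i k"] r that by (simp add: axis_add)
  have const: "H (axis i k) = H (axis i r)" if "r \<le> k" for k
    using that by (induction k rule: int_ge_induct) (simp_all add: step)
  have strict: "strict_mono_on {0..r} (\<lambda>k. H (axis i k))"
  proof (rule strict_mono_onI)
    fix k l assume kl: "k \<in> {0..r}" "l \<in> {0..r}" "k < l"
    have "H (axis i k) < H (axis i (k + 1))" using mono1[of k] below[of k] kl by simp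
    also have "\<dots> \<le> H (axis i l)" using kl by (intro mono) simp
    finally show "H (axis i k) < H (axis i l)" .
  qed
  show ?thesis
    unfolding regularity_index_def hilbert_function_projection
  proof (rule the_equality)
    show "0 \<le> r \<and> strict_mono_on {0..r} (\<lambda>k. H (axis i k)) \<and> (\<forall>k\<ge>r. H (axis i k) = H (axis i r))"
      using r(1) strict const by blast
    fix s assume S: "0 \<le> s \<and> strict_mono_on {0..s} (\<lambda>k. H (axis i k)) \<and> (\<forall>k\<ge>s. H (axis i k) = H (axis i s))"
    note s = conjunct1[OF S] conjunct1[OF conjunct2[OF S]] conjunct2[OF conjunct2[OF S]]
    show "s = r"
    proof (rule ccontr)
      assume "s \<noteq> r"
      then consider "s < r" | "r < s" by linarith
      then show False
      proof cases
        case 1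
        then have "H (axis i s) < H (axis i (s + 1))"
          using s(1) by (intro strict_mono_onD[OF strict]) auto
        then show False using s(3)[THEN spec, of "s + 1"] by simp
      next
        case 2
        from strict_mono_onD[OF s(2), of r "r + 1"] have "H (axis i r) < H (axis i (r + 1))"
          using 2 r(1) by simp
        then show False using r(2) by simp
      qed
    qed
  qed
qed

lemma regularity_index_exists:
  assumes dim: "has_dimension UNIV n X 0"
  obtains r where "regularity_index n i (projection n i X) = r" "0 \<le> r"
    "H (axis i r + axis i 1) = H (axis i r)"
    "\<And>k. 0 \<le> k \<Longrightarrow> H (axis i (k + 1)) = H (axis i k) \<Longrightarrow> r \<le> k"
proof -
  let ?P = "\<lambda>N::nat. H (axis i (int N + 1)) = H (axis i (int N))"
  obtain C where C: "\<forall>a. H a \<le> int C" using hilbert_function_bounded[OF dim] by (rule exE)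
  have "\<exists>N. ?P N"
  proof (rule ccontr)
    assume no: "\<not> (\<exists>N. ?P N)"
    have "int N \<le> H (axis i (int N))" for N
    proof (induction N)
      case 0
      show ?case by (simp add: hilbert_function_def)
    next
      case (Suc N)
      have "H (axis i (int N)) \<le> H (axis i (int N + 1))"
        using hilbert_function_mono[of "axis i (int N)" i] by (simp add: axis_add)
      then have "H (axis i (int N)) < H (axis i (int N + 1))" using no by (metis order_le_less)
      then show ?case using Suc by (simp add: add.commute)
    qed
    from this[of "Suc C"] C[THEN spec, of "axis i (int (Suc C))"] show False by simp
  qed
  define N where "N = (LEAST N. ?P N)"
  have PN: "?P N" unfolding N_def using \<open>\<exists>N. ?P N\<close> by (rule LeastI_ex)
  have least: "int N \<le> k" if "0 \<le> k" "H (axis i (k + 1)) = H (axis i k)" for k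
  proof -
    have "?P (nat k)" using that by simp
    then have "N \<le> nat k" unfolding N_def by (rule Least_le)
    then show ?thesis using that(1) by simp
  qed
  have "regularity_index n i (projection n i X) = int N"
    by (rule regularity_index_eq) (use PN least in fastforce)+
  moreover have "H (axis i (int N) + axis i 1) = H (axis i (int N))" using PN by (simp add: axis_add)
  ultimately show ?thesis using least by (intro that[of "int N"]) auto
qed

end

theorem theorem4p4:
  fixes n :: "'q::finite \<Rightarrow> nat"
    and X :: "('q, 'k::field) ideal_family"
  assumes "\<And>i. n i \<ge> 1"
    and "zero_dim_subscheme UNIV n X"
  shows "smallest_relevant_domain (hilbert_function UNIV n X) {0..rem n X}"
proof -
  interpret closed_product_subscheme n X
    using assms(2) by unfold_locales (simp add: zero_dim_subscheme_def)
  have dim: "has_dimension UNIV n X 0" using assms(2) by (simp add: zero_dim_subscheme_def)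
  have rem_nonneg: "0 \<le> rem n X $ i"
    and stable: "H (axis i (rem n X $ i) + axis i 1) = H (axis i (rem n X $ i))"
    and least: "\<And>k. 0 \<le> k \<Longrightarrow> H (axis i (k + 1)) = H (axis i k) \<Longrightarrow> rem n X $ i \<le> k" for i
    using regularity_index_exists[OF dim, of i] by (auto simp: rem_def)
  show ?thesis
    unfolding smallest_relevant_domain_def
  proof (intro conjI allI impI)
    show "relevant_domain H {0..rem n X}"
      unfolding relevant_domain_def
    proof (intro conjI allI impI)
      show "rectangular_domain {0..rem n X}"
        unfolding rectangular_domain_def using rem_nonneg
        by (intro exI[of _ "rem n X"]) (simp add: less_eq_vec_def)
      fix a :: "int ^ 'q"
      show "H a = 0" if "\<not> 0 \<le> a" using that by (rule hilbert_function_outside)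
      assume "a \<notin> {0..rem n X}"
      then have "(\<exists>j. a $ j < 0) \<or> (\<exists>i. rem n X $ i < a $ i)"
        by (auto simp: less_eq_vec_def not_le)
      then show "difference H a = 0"
        unfolding difference_eq_partial
      proof (elim disjE exE)
        fix j assume "a $ j < 0"
        then show "partial_difference UNIV H a = 0"
          by (intro partial_difference_outside hilbert_function_outside)
      next
        fix i assume a: "rem n X $ i < a $ i"
        show "partial_difference UNIV H a = 0"
        proof (rule partial_difference_vanishes[where r = "rem n X $ i" and i = i])
          show "H (b + axis i 1) = H b" if "rem n X $ i \<le> b $ i" for b
            using rem_nonneg stable that by (rule hilbert_function_stable)
        qed (use a in simp_all)
      qed
    qed
    fix Q assume Q: "relevant_domain H Q"
    then obtain s where s: "0 \<le> s" "Q = {0..s}"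
      by (auto simp: relevant_domain_def rectangular_domain_def)
    have "rem n X $ i \<le> s $ i" for i
    proof (rule least)
      show "0 \<le> s $ i" using s(1) by (simp add: less_eq_vec_def)
      have "difference H a = 0" if "s $ i < a $ i" for a
      proof -
        have "a \<notin> Q" using that s(2) by (auto simp: less_eq_vec_def not_le)
        then show ?thesis using Q by (simp add: relevant_domain_def)
      qed
      then have "H (axis i (s $ i + 1)) = H (axis i (s $ i + 1) - axis i 1)"
        by (intro stable_of_difference_vanishes[where F = H and r = "s $ i"] hilbert_function_outside)
          (simp_all add: axis_def)
      then show "H (axis i (s $ i + 1)) = H (axis i (s $ i))" by (simp add: axis_add)
    qed
    then show "{0..rem n X} \<subseteq> Q" unfolding s(2) by (auto simp: less_eq_vec_def intro: order_trans)
  qed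
qed

end
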